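(* For $(\mathfrak b,\mathfrak a)\in G^{\mathbb H}_{\mathrm{aff}}=\mathbb H\rtimes\mathbb H^*$ define an operator $U_{\mathbb C}(\mathfrak b,\mathfrak a)$ on the complex Hilbert space $\mathfrak K_{\mathbb C}=L^2_{\mathbb C}(\mathbb H,d\mathfrak x)$ by $$(U_{\mathbb C}(\mathfrak b,\mathfrak a)f)(\mathfrak x)=\frac{1}{|\mathfrak a|^{2}}\,f\big(\mathfrak a^{-1}(\mathfrak x-\mathfrak b)\big),\qquad f\in\mathfrak K_{\mathbb C}.$$ Then $U_{\mathbb C}$ is a unitary irreducible representation of $G^{\mathbb H}_{\mathrm{aff}}$ on $\mathfrak K_{\mathbb C}$, and it is square-integrable in the following sense. Let $C$ be the operator on $\mathfrak K_{\mathbb C}$ given in the Fourier domain by multiplication, $$(\widehat{Cf})(\mathfrak k)=\left[\frac{2\pi}{|\mathfrak k|}\right]^{2}\widehat f(\mathfrak k),$$ with domain consisting of all $f\in\mathfrak K_{\mathbb C}$ such that $(2\pi)^4\int_{\mathbb R^4}\frac{|\widehat f(\mathfrak k)|^2}{|\mathfrak k|^4}\,d\mathfrak k<\infty$. Then for any $\eta_1,\eta_2$ in the domain of $C$ and arbitrary $f_1,f_2\in\mathfrak K_{\mathbb C}$, $$\int_{G^{\mathbb H}_{\mathrm{aff}}}\langle f_1\mid U_{\mathbb C}(\mathfrak b,\mathfrak a)\eta_1\rangle\,\langle\eta_2\mid U_{\mathbb C}(\mathfrak b,\mathfrak a)^*f_2\rangle\,d\mu_\ell(\mathfrak b,\mathfrak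 a)=\langle C\eta_2\mid C\eta_1\rangle\,\langle f_1\mid f_2\rangle .$$
   Context: $\mathbb H$ is the division algebra of quaternions, $\mathbb H^*$ its multiplicative group of nonzero elements, and $|\cdot|$ the quaternionic norm. $\mathbb H$ is identified with $\mathbb R^4$ via the real components of a quaternion, and $d\mathfrak x$ is Lebesgue measure on $\mathbb R^4$. The quaternionic affine group $G^{\mathbb H}_{\mathrm{aff}}=\mathbb H\rtimes\mathbb H^*$ is the set of pairs $(\mathfrak b,\mathfrak a)$, $\mathfrak b\in\mathbb H$, $\mathfrak a\in\mathbb H^*$, with product $(\mathfrak b,\mathfrak a)(\mathfrak b',\mathfrak a')=(\mathfrak b+\mathfrak a\mathfrak b',\mathfrak a\mathfrak a')$. Its left Haar measure is normalized as $d\mu_\ell(\mathfrak b,\mathfrak a)=\dfrac{d\mathfrak b\,d\mathfrak a}{|\mathfrak a|^{8}}$, where $d\mathfrak b,d\mathfrak a$ are Lebesgue measures on $\mathbb R^4$. Inner products on complex Hilbert spaces are conjugate-linear in the first variable and linear in the second. $\widehat f$ denotes the unitary Fourier transform on $L^2(\mathbb R^4)$, i.e. $\widehat f(\mathfrak k)=(2\pi)^{-2}\int_{\mathbb R^4}e^{-i\mathfrak k\cdot\mathfrak x}f(\mathfrak x)\,d\mathfrak x$ for $f\in L^1\cap L^2$, with the standard dot product on $\mathbb R^4$. *)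

theory Defs
  imports "HOL-Analysis.Analysis" "HOL-Algebra.Group"
begin

section \<open>The quaternions\<close>

text \<open>Quaternions are identified with their real components
  \<open>(q\<^sub>0, q\<^sub>1, q\<^sub>2, q\<^sub>3) \<in> \<real>\<^sup>4\<close>, so that the norm, the dot product, the topology and
  the Lebesgue measure are the library's. The library's \<open>*\<close> on \<^typ>\<open>real^4\<close> is
  componentwise and must not be confused with \<open>qmult\<close>.\<close>

type_synonym quat = "real ^ 4"

definition qmult :: "quat \<Rightarrow> quat \<Rightarrow> quat" (infixl \<open>\<odot>\<close> 70) where
  "p \<odot> q = vector
     [p$1 * q$1 - p$2 * q$2 - p$3 * q$3 - p$4 * q$4,
      p$1 * q$2 + p$2 * q$1 + p$3 * q$4 - p$4 * q$3,
      p$1 * q$3 - p$2 * q$4 + p$3 * q$1 + p$4 * q$2,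
      p$1 * q$4 + p$2 * q$3 - p$3 * q$2 + p$4 * q$1]"

definition qone :: quat where
  "qone = vector [1, 0, 0, 0]"

definition qconj :: "quat \<Rightarrow> quat" where
  "qconj q = vector [q$1, - q$2, - q$3, - q$4]"

definition qinv :: "quat \<Rightarrow> quat" where
  "qinv q = (1 / (norm q)\<^sup>2) *\<^sub>R qconj q"

lemma vector_4_nth [simp]:
  "(vector [w, x, y, z] :: 'a::zero ^ 4) $ 1 = w"
  "(vector [w, x, y, z] :: 'a::zero ^ 4) $ 2 = x"
  "(vector [w, x, y, z] :: 'a::zero ^ 4) $ 3 = y"
  "(vector [w, x, y, z] :: 'a::zero ^ 4) $ 4 = z"
  unfolding vector_def by (simp_all add: eval_nat_numeral)

lemma quat_eq_iff: "p = q \<longleftrightarrow> p$1 = q$1 \<and> p$2 = q$2 \<and> p$3 = q$3 \<and> p$4 = q$4"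
  for p q :: quat
  by (simp add: vec_eq_iff forall_4)

lemma norm_quat_square: "(norm q)\<^sup>2 = (q$1)\<^sup>2 + (q$2)\<^sup>2 + (q$3)\<^sup>2 + (q$4)\<^sup>2"
  for q :: quat
  by (simp add: norm_vec_def L2_set_def sum_4 add_nonneg_nonneg)

lemma qmult_assoc: "(p \<odot> q) \<odot> r = p \<odot> (q \<odot> r)"
  by (simp add: quat_eq_iff qmult_def algebra_simps)

lemma qmult_qone [simp]: "qone \<odot> q = q" "q \<odot> qone = q"
  by (simp_all add: quat_eq_iff qmult_def qone_def)

lemma bilinear_qmult: "bilinear (\<odot>)"
  by (auto simp: bilinear_def linear_iff quat_eq_iff qmult_def algebra_simps)

lemma qmult_qconj: "q \<odot> qconj q = (norm q)\<^sup>2 *\<^sub>R qone" "qconj q \<odot> q = (norm q)\<^sup>2 *\<^sub>R qone"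
  by (simp_all only: norm_quat_square)
    (simp_all add: quat_eq_iff qmult_def qconj_def qone_def algebra_simps power2_eq_square)

lemma norm_qmult: "norm (p \<odot> q) = norm p * norm q"
proof -
  have "(norm (p \<odot> q))\<^sup>2 = (norm p * norm q)\<^sup>2"
    unfolding power_mult_distrib norm_quat_square qmult_def vector_4_nth
    by (simp add: power2_eq_square ring_distribs mult_ac)
  then show ?thesis
    by (simp add: power2_eq_iff_nonneg)
qed

lemma qmult_qinv: "q \<noteq> 0 \<Longrightarrow> q \<odot> qinv q = qone" "q \<noteq> 0 \<Longrightarrow> qinv q \<odot> q = qone"
  using bilinear_rmul[OF bilinear_qmult] bilinear_lmul[OF bilinear_qmult]
  by (simp_all add: qinv_def qmult_qconj)

lemma qone_neq_0 [simp]: "qone \<noteq> 0"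
  by (simp add: quat_eq_iff qone_def)

lemma qmult_eq_0_iff [simp]: "p \<odot> q = 0 \<longleftrightarrow> p = 0 \<or> q = 0"
  by (metis norm_qmult mult_eq_0_iff norm_eq_zero)


section \<open>The quaternionic affine group and its left Haar measure\<close>

definition Gaff :: "(quat \<times> quat) monoid" where
  "Gaff = \<lparr>carrier = {(b, a). a \<noteq> 0},
           mult = (\<lambda>(b, a) (b', a'). (b + a \<odot> b', a \<odot> a')),
           one = (0, qone)\<rparr>"

lemma group_Gaff: "group Gaff"
proof (rule groupI)
  have bl: "a \<odot> (x + y) = a \<odot> x + a \<odot> y" "a \<odot> 0 = 0" for a x y
    by (simp_all add: bilinear_radd[OF bilinear_qmult] bilinear_rzero[OF bilinear_qmult])
  have bm: "a \<odot> (- x) = - (a \<odot> x)" for a x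
    by (simp add: bilinear_rneg[OF bilinear_qmult])
  show "\<one>\<^bsub>Gaff\<^esub> \<in> carrier Gaff"
    by (simp add: Gaff_def)
  fix x y z
  assume x: "x \<in> carrier Gaff"
  show "\<one>\<^bsub>Gaff\<^esub> \<otimes>\<^bsub>Gaff\<^esub> x = x"
    by (auto simp: Gaff_def split: prod.splits)
  show "\<exists>y\<in>carrier Gaff. y \<otimes>\<^bsub>Gaff\<^esub> x = \<one>\<^bsub>Gaff\<^esub>"
  proof -
    obtain b a where xa: "x = (b, a)" "a \<noteq> 0"
      using x by (auto simp: Gaff_def)
    have "qinv a \<noteq> 0"
      using qmult_qinv(1)[OF xa(2)] by (metis qmult_eq_0_iff qone_neq_0)
    then show ?thesis
      using xa by (intro bexI[of _ "(- (qinv a \<odot> b), qinv a)"])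
        (auto simp: Gaff_def qmult_qinv bl bm)
  qed
  assume y: "y \<in> carrier Gaff"
  show "x \<otimes>\<^bsub>Gaff\<^esub> y \<in> carrier Gaff"
    using x y by (auto simp: Gaff_def)
  assume z: "z \<in> carrier Gaff"
  show "x \<otimes>\<^bsub>Gaff\<^esub> y \<otimes>\<^bsub>Gaff\<^esub> z = x \<otimes>\<^bsub>Gaff\<^esub> (y \<otimes>\<^bsub>Gaff\<^esub> z)"
    by (cases x; cases y; cases z) (simp add: Gaff_def qmult_assoc bl)
qed

definition haar_Gaff :: "(quat \<times> quat) measure" where
  "haar_Gaff = density (restrict_space (lborel \<Otimes>\<^sub>M lborel) (carrier Gaff))
                       (\<lambda>(b, a). ennreal (1 / norm a ^ 8))"


section \<open>The complex Hilbert space of square-integrable functions\<close>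

definition square_integrable :: "('a::euclidean_space \<Rightarrow> complex) \<Rightarrow> bool" where
  "square_integrable f \<longleftrightarrow>
     f \<in> borel_measurable lborel \<and> integrable lborel (\<lambda>x. (cmod (f x))\<^sup>2)"

definition L2_eq :: "('a::euclidean_space \<Rightarrow> complex) \<Rightarrow> ('a \<Rightarrow> complex) \<Rightarrow> bool" where
  "L2_eq f g \<longleftrightarrow>
     square_integrable f \<and> square_integrable g \<and> (AE x in lborel. f x = g x)"

lemma square_integrable_0 [simp]: "square_integrable (\<lambda>_. 0)"
  by (simp add: square_integrable_def)

quotient_type (overloaded) 'a L2 = "'a::euclidean_space \<Rightarrow> complex" / partial: L2_eq
proof (rule part_equivpI)
  show "\<exists>f :: 'a \<Rightarrow> complex. L2_eq f f"
    by (rule exI[of _ "\<lambda>_. 0"]) (simp add: L2_eq_def)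
  show "symp (L2_eq :: ('a \<Rightarrow> complex) \<Rightarrow> _)"
    unfolding symp_def L2_eq_def by (simp add: eq_commute)
  have "AE x in lborel. f x = h x"
    if "AE x in lborel. f x = g x" "AE x in lborel. g x = h x" for f g h :: "'a \<Rightarrow> complex"
    using that by eventually_elim simp
  then show "transp (L2_eq :: ('a \<Rightarrow> complex) \<Rightarrow> _)"
    unfolding transp_def L2_eq_def by blast
qed

lemma cnj_measurable: "cnj \<in> borel_measurable borel"
  by (intro borel_measurable_continuous_onI continuous_intros)

lemma square_integrable_mult_measurable:
  "square_integrable f \<Longrightarrow> square_integrable g \<Longrightarrow>
    (\<lambda>x. cnj (f x) * g x) \<in> borel_measurable lborel"
  unfolding square_integrable_def
  by (intro borel_measurable_times measurable_compose[OF _ cnj_measurable]) auto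

lemma square_integrable_mult:
  assumes "square_integrable f" "square_integrable g"
  shows "integrable lborel (\<lambda>x. cnj (f x) * g x)"
proof (rule Bochner_Integration.integrable_bound)
  show "integrable lborel (\<lambda>x. (cmod (f x))\<^sup>2 + (cmod (g x))\<^sup>2)"
    using assms by (simp add: square_integrable_def)
  show "(\<lambda>x. cnj (f x) * g x) \<in> borel_measurable lborel"
    by (rule square_integrable_mult_measurable[OF assms])
  have "cmod u * cmod v \<le> (cmod u)\<^sup>2 + (cmod v)\<^sup>2" for u v
  proof -
    have "0 \<le> cmod u * cmod v"
      by simp
    then show ?thesis
      using sum_squares_bound[of "cmod u" "cmod v"] by linarith
  qed
  then show "AE x in lborel. norm (cnj (f x) * g x) \<le> norm ((cmod (f x))\<^sup>2 + (cmod (g x))\<^sup>2)"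
    by (simp add: norm_mult)
qed

lemma integral_cnj_mult_self:
  "(\<integral>x. cnj (f x) * f x \<partial>lborel) = complex_of_real (\<integral>x. (cmod (f x))\<^sup>2 \<partial>lborel)"
proof -
  have "cnj z * z = complex_of_real ((cmod z)\<^sup>2)" for z
    by (metis complex_norm_square mult.commute)
  then show ?thesis
    by (simp only: integral_complex_of_real)
qed

lemma integral_cnj_mult_swap:
  "(\<integral>x. cnj (f x) * g x \<partial>lborel) = cnj (\<integral>x. cnj (g x) * f x \<partial>lborel)"
proof -
  have "cnj (\<integral>x. cnj (g x) * f x \<partial>lborel) = (\<integral>x. cnj (cnj (g x) * f x) \<partial>lborel)"
    by (rule Bochner_Integration.integral_cnj[symmetric])
  then show ?thesis
    by (simp add: mult.commute)
qed

lemma square_integrable_cmult: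
  "square_integrable f \<Longrightarrow> square_integrable (\<lambda>x. c * f x)"
  by (auto simp: square_integrable_def norm_mult power_mult_distrib)

lemma square_integrable_add:
  assumes "square_integrable f" "square_integrable g"
  shows "square_integrable (\<lambda>x. f x + g x)"
  unfolding square_integrable_def
proof
  show m: "(\<lambda>x. f x + g x) \<in> borel_measurable lborel"
    using assms by (auto simp: square_integrable_def)
  show "integrable lborel (\<lambda>x. (cmod (f x + g x))\<^sup>2)"
  proof (rule Bochner_Integration.integrable_bound)
    show "integrable lborel (\<lambda>x. 2 * ((cmod (f x))\<^sup>2 + (cmod (g x))\<^sup>2))"
      using assms by (simp add: square_integrable_def)
    show "(\<lambda>x. (cmod (f x + g x))\<^sup>2) \<in> borel_measurable lborel"
      using m by measurable
    have "(cmod (u + v))\<^sup>2 \<le> 2 * ((cmod u)\<^sup>2 + (cmod v)\<^sup>2)" for u v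
    proof -
      have "(cmod (u + v))\<^sup>2 \<le> (cmod u + cmod v)\<^sup>2"
        by (intro power_mono norm_triangle_ineq norm_ge_zero)
      also have "\<dots> \<le> 2 * ((cmod u)\<^sup>2 + (cmod v)\<^sup>2)"
        using sum_squares_bound[of "cmod u" "cmod v"] by (simp add: power2_sum)
      finally show ?thesis .
    qed
    then show "AE x in lborel. norm ((cmod (f x + g x))\<^sup>2)
        \<le> norm (2 * ((cmod (f x))\<^sup>2 + (cmod (g x))\<^sup>2))"
      by simp
  qed
qed

lift_definition cscale :: "complex \<Rightarrow> 'a::euclidean_space L2 \<Rightarrow> 'a L2" (infixr \<open>*\<^sub>C\<close> 75)
  is "\<lambda>c f x. c * f x"
  by (auto simp: L2_eq_def square_integrable_cmult)

lift_definition cinner :: "'a::euclidean_space L2 \<Rightarrow> 'a L2 \<Rightarrow> complex" (\<open>\<langle>_ | _\<rangle>\<close>)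
  is "\<lambda>f g. \<integral>x. cnj (f x) * g x \<partial>lborel"
  by (rule integral_cong_AE) (auto simp: L2_eq_def square_integrable_mult_measurable[simplified])

text \<open>The underlying real inner product is the real part of the complex one. It induces
  the same norm, and it provides the topology of the Hilbert space through the class
  \<^class>\<open>real_inner\<close>.\<close>

instantiation L2 :: (euclidean_space) real_inner
begin

lift_definition zero_L2 :: "'a L2" is "\<lambda>_. 0"
  by (simp add: L2_eq_def)

lift_definition plus_L2 :: "'a L2 \<Rightarrow> 'a L2 \<Rightarrow> 'a L2" is "\<lambda>f g x. f x + g x"
  by (auto simp: L2_eq_def square_integrable_add)

definition uminus_L2 :: "'a L2 \<Rightarrow> 'a L2" where
  "- f = (- 1) *\<^sub>C f"

definition minus_L2 :: "'a L2 \<Rightarrow> 'a L2 \<Rightarrow> 'a L2" where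
  "f - g = f + - (g :: 'a L2)"

definition scaleR_L2 :: "real \<Rightarrow> 'a L2 \<Rightarrow> 'a L2" where
  "r *\<^sub>R f = of_real r *\<^sub>C f"

definition inner_L2 :: "'a L2 \<Rightarrow> 'a L2 \<Rightarrow> real" where
  "f \<bullet> g = Re \<langle>f | g\<rangle>"

definition norm_L2 :: "'a L2 \<Rightarrow> real" where
  "norm f = sqrt (Re \<langle>f | f\<rangle>)"

definition dist_L2 :: "'a L2 \<Rightarrow> 'a L2 \<Rightarrow> real" where
  "dist f g = norm (f - g :: 'a L2)"

definition sgn_L2 :: "'a L2 \<Rightarrow> 'a L2" where
  "sgn f = inverse (norm f) *\<^sub>R (f :: 'a L2)"

definition uniformity_L2 :: "('a L2 \<times> 'a L2) filter" where
  "uniformity_L2 = (INF e\<in>{0<..}. principal {(f, g :: 'a L2). dist f g < e})"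

definition open_L2 :: "'a L2 set \<Rightarrow> bool" where
  "open_L2 S \<longleftrightarrow> (\<forall>x\<in>S. \<forall>\<^sub>F (x', y) in uniformity. x' = x \<longrightarrow> y \<in> S)"

instance
proof
  fix f g h :: "'a L2" and r s :: real
  show "f + g + h = f + (g + h)"
    by transfer (auto simp: L2_eq_def square_integrable_add add.assoc)
  show "f + g = g + f"
    by transfer (auto simp: L2_eq_def square_integrable_add add.commute)
  show "0 + f = f"
    by transfer (auto simp: L2_eq_def square_integrable_add)
  show "- f + f = 0"
    unfolding uminus_L2_def
    by transfer (auto simp: L2_eq_def)
  show "f - g = f + - g"
    by (fact minus_L2_def)
  show "r *\<^sub>R (f + g) = r *\<^sub>R f + r *\<^sub>R g"
    unfolding scaleR_L2_def
    by transfer (auto simp: L2_eq_def square_integrable_add square_integrable_cmult distrib_left)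
  show "(r + s) *\<^sub>R f = r *\<^sub>R f + s *\<^sub>R f"
    unfolding scaleR_L2_def
    by transfer (auto simp: L2_eq_def square_integrable_add square_integrable_cmult distrib_right)
  show "r *\<^sub>R s *\<^sub>R f = (r * s) *\<^sub>R f"
    unfolding scaleR_L2_def
    by transfer (auto simp: L2_eq_def square_integrable_cmult mult.assoc[symmetric])
  show "1 *\<^sub>R f = f"
    unfolding scaleR_L2_def by transfer (auto simp: L2_eq_def)
  show "dist f g = norm (f - g)"
    by (fact dist_L2_def)
  show "sgn f = inverse (norm f) *\<^sub>R f"
    by (fact sgn_L2_def)
  show "uniformity = (INF e\<in>{0<..}. principal {(f, g :: 'a L2). dist f g < e})"
    by (fact uniformity_L2_def)
  show "open S \<longleftrightarrow> (\<forall>x\<in>S. \<forall>\<^sub>F (x', y) in uniformity. x' = x \<longrightarrow> y \<in> S)"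
    for S :: "'a L2 set"
    by (fact open_L2_def)
  have cnj_inner: "\<langle>f | g\<rangle> = cnj \<langle>g | f\<rangle>"
    by transfer (rule integral_cnj_mult_swap)
  then show "f \<bullet> g = g \<bullet> f"
    by (simp add: inner_L2_def)
  show "(f + g) \<bullet> h = f \<bullet> h + g \<bullet> h"
    unfolding inner_L2_def
    by transfer
      (simp only: L2_eq_def square_integrable_mult distrib_right complex_cnj_add
        Bochner_Integration.integral_add plus_complex.sel)
  show "(r *\<^sub>R f) \<bullet> g = r * (f \<bullet> g)"
    unfolding inner_L2_def scaleR_L2_def by transfer (simp add: mult.assoc del: integral_mult_left)
  have sq: "\<langle>f | f\<rangle> = of_real (\<integral>x. (cmod (rep_L2 f x))\<^sup>2 \<partial>lborel)"
    unfolding cinner.rep_eq by (fact integral_cnj_mult_self)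
  then show "0 \<le> f \<bullet> f"
    by (simp add: inner_L2_def)
  show "norm f = sqrt (f \<bullet> f)"
    by (simp add: norm_L2_def inner_L2_def)
  show "f \<bullet> f = 0 \<longleftrightarrow> f = 0"
    unfolding inner_L2_def
  proof transfer
    fix f :: "'a \<Rightarrow> complex"
    assume f: "L2_eq f f"
    have "(\<integral>x. cnj (f x) * f x \<partial>lborel) = of_real (\<integral>x. (cmod (f x))\<^sup>2 \<partial>lborel)"
      by (fact integral_cnj_mult_self)
    then show "Re (\<integral>x. cnj (f x) * f x \<partial>lborel) = 0 \<longleftrightarrow> L2_eq f (\<lambda>_. 0)"
      using f by (simp add: L2_eq_def square_integrable_def integral_nonneg_eq_0_iff_AE)
  qed
qed

end


section \<open>Unitary representations\<close>

definition clinear_op :: "('a::euclidean_space L2 \<Rightarrow> 'a L2) \<Rightarrow> bool" where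
  "clinear_op T \<longleftrightarrow> (\<forall>f g. T (f + g) = T f + T g) \<and> (\<forall>c f. T (c *\<^sub>C f) = c *\<^sub>C T f)"

definition unitary_op :: "('a::euclidean_space L2 \<Rightarrow> 'a L2) \<Rightarrow> bool" where
  "unitary_op T \<longleftrightarrow> clinear_op T \<and> surj T \<and> (\<forall>f g. \<langle>T f | T g\<rangle> = \<langle>f | g\<rangle>)"

definition unitary_group :: "('a::euclidean_space L2 \<Rightarrow> 'a L2) monoid" where
  "unitary_group = \<lparr>carrier = {T. unitary_op T}, mult = (\<circ>), one = id\<rparr>"

definition cadjoint :: "('a::euclidean_space L2 \<Rightarrow> 'a L2) \<Rightarrow> 'a L2 \<Rightarrow> 'a L2" where
  "cadjoint T = (THE S. \<forall>f g. \<langle>T f | g\<rangle> = \<langle>f | S g\<rangle>)"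

definition csubspace :: "'a::euclidean_space L2 set \<Rightarrow> bool" where
  "csubspace S \<longleftrightarrow>
     0 \<in> S \<and> (\<forall>f\<in>S. \<forall>g\<in>S. f + g \<in> S) \<and> (\<forall>c. \<forall>f\<in>S. c *\<^sub>C f \<in> S)"

text \<open>As usual, a unitary representation of a topological group is required to be
  strongly continuous.\<close>

definition unitary_rep ::
  "'g::topological_space monoid \<Rightarrow> ('g \<Rightarrow> 'a::euclidean_space L2 \<Rightarrow> 'a L2) \<Rightarrow> bool" where
  "unitary_rep G U \<longleftrightarrow>
     group G \<and> U \<in> hom G unitary_group \<and> (\<forall>f. continuous_on (carrier G) (\<lambda>g. U g f))"

definition irreducible_rep ::
  "'g monoid \<Rightarrow> ('g \<Rightarrow> 'a::euclidean_space L2 \<Rightarrow> 'a L2) \<Rightarrow> bool" where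
  "irreducible_rep G U \<longleftrightarrow>
     (\<exists>f :: 'a L2. f \<noteq> 0) \<and>
     (\<forall>S. csubspace S \<and> closed S \<and> (\<forall>g\<in>carrier G. U g ` S \<subseteq> S) \<longrightarrow> S = {0} \<or> S = UNIV)"


section \<open>The representation, the Fourier transform and the Duflo--Moore operator\<close>

text \<open>\<open>rep_L2 f\<close> is some square-integrable function in the class \<open>f\<close>, and \<open>abs_L2 \<phi>\<close> is the
  class of a square-integrable function \<open>\<phi>\<close>.\<close>

definition U_fun :: "quat \<times> quat \<Rightarrow> (quat \<Rightarrow> complex) \<Rightarrow> quat \<Rightarrow> complex" where
  "U_fun = (\<lambda>(b, a) \<phi> x. of_real (1 / (norm a)\<^sup>2) * \<phi> (qinv a \<odot> (x - b)))"

definition U_C :: "quat \<times> quat \<Rightarrow> quat L2 \<Rightarrow> quat L2" where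
  "U_C g f = abs_L2 (U_fun g (rep_L2 f))"

text \<open>The choice of the representative in \<open>U_C\<close> is immaterial.\<close>

lemma lborel_qaffine:
  assumes "a \<noteq> 0"
  obtains c where "0 < c"
    "lborel = density (distr lborel borel (\<lambda>x. qinv a \<odot> (x - b))) (\<lambda>_. ennreal c)"
proof -
  define d where "d = \<bar>det (matrix ((\<odot>) a))\<bar>"
  define T where "T = (\<lambda>x. qinv a \<odot> (x - b))"
  have lin: "linear ((\<odot>) p)" for p
    using bilinear_qmult by (simp add: bilinear_def)
  have inv: "a \<odot> (qinv a \<odot> x) = x" "qinv a \<odot> (a \<odot> x) = x" for x
    using assms by (simp_all add: qmult_assoc[symmetric] qmult_qinv)
  have "inj ((\<odot>) a)"
    by (metis injI inv(2))
  then have d: "d > 0"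
    using det_nz_iff_inj[OF lin] by (simp add: d_def)
  have "continuous_on UNIV T"
    unfolding T_def by (intro linear_continuous_on_compose[OF _ lin] continuous_intros)
  then have T [measurable]: "T \<in> borel \<rightarrow>\<^sub>M borel"
    by (rule borel_measurable_continuous_onI)
  have "lborel = density (distr lborel borel T) (\<lambda>_. ennreal (1 / d))"
  proof (rule lborel_eqI)
    fix l u :: quat
    assume le: "\<And>i. i \<in> Basis \<Longrightarrow> l \<bullet> i \<le> u \<bullet> i"
    have eq: "T -` box l u = (+) b ` ((\<odot>) a ` box l u)"
    proof (intro Set.set_eqI iffI)
      fix x
      assume "x \<in> T -` box l u"
      moreover have "x = b + a \<odot> T x"
        by (simp add: T_def inv)
      ultimately show "x \<in> (+) b ` ((\<odot>) a ` box l u)"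
        by blast
    next
      fix x
      assume "x \<in> (+) b ` ((\<odot>) a ` box l u)"
      then show "x \<in> T -` box l u"
        by (auto simp: T_def inv)
    qed
    have Tm: "T -` box l u \<in> sets lborel"
      using measurable_sets[OF T, of "box l u"] by simp
    have lm: "T -` box l u \<in> lmeasurable"
      unfolding eq by (intro measurable_translation measurable_linear_image lin lmeasurable_box)
    have "emeasure lborel (T -` box l u) = emeasure lebesgue (T -` box l u)"
      using Tm by simp
    also have "\<dots> = ennreal (measure lebesgue (T -` box l u))"
      using lm by (rule emeasure_eq_measure2)
    also have "measure lebesgue (T -` box l u) = d * measure lebesgue (box l u)"
      unfolding eq measure_translation d_def by (intro measure_linear_image lin lmeasurable_box)
    also have "measure lebesgue (box l u) = (\<Prod>i\<in>Basis. (u - l) \<bullet> i)"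
      using le by (simp add: measure_lborel_box_eq)
    finally have "emeasure lborel (T -` box l u) = ennreal (d * (\<Prod>i\<in>Basis. (u - l) \<bullet> i))" .
    then show "emeasure (density (distr lborel borel T) (\<lambda>_. ennreal (1 / d))) (box l u)
        = ennreal (\<Prod>i\<in>Basis. (u - l) \<bullet> i)"
      using d by (simp add: emeasure_density nn_integral_cmult_indicator emeasure_distr
          ennreal_mult'[symmetric])
  qed simp
  then show thesis
    using that[of "1 / d"] d by (simp add: T_def)
qed

lemma U_fun_L2_eq:
  assumes "g \<in> carrier Gaff" "L2_eq \<phi> \<psi>"
  shows "L2_eq (U_fun g \<phi>) (U_fun g \<psi>)"
proof -
  obtain b a where g: "g = (b, a)" and a: "a \<noteq> 0"
    using assms(1) by (auto simp: Gaff_def)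
  define T where "T = (\<lambda>x. qinv a \<odot> (x - b))"
  obtain c where c: "0 < c" "lborel = density (distr lborel borel T) (\<lambda>_. ennreal c)"
    unfolding T_def using lborel_qaffine[OF a] .
  have lin: "linear ((\<odot>) p)" for p
    using bilinear_qmult by (simp add: bilinear_def)
  have "continuous_on UNIV T"
    unfolding T_def by (intro linear_continuous_on_compose[OF _ lin] continuous_intros)
  then have T [measurable]: "T \<in> borel \<rightarrow>\<^sub>M borel"
    by (rule borel_measurable_continuous_onI)
  have sq: "square_integrable (U_fun g f)" if f: "square_integrable f" for f
  proof -
    have m [measurable]: "f \<in> borel_measurable borel"
      using f by (simp add: square_integrable_def)
    have "integrable (density (distr lborel borel T) (\<lambda>_. ennreal c)) (\<lambda>x. (cmod (f x))\<^sup>2)"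
      using f unfolding c(2)[symmetric] by (simp add: square_integrable_def)
    then have "integrable (distr lborel borel T) (\<lambda>x. (cmod (f x))\<^sup>2)"
      using c(1) by (subst (asm) integrable_density) auto
    then have "square_integrable (\<lambda>x. f (T x))"
      by (simp add: integrable_distr_eq square_integrable_def)
    then show ?thesis
      unfolding g U_fun_def T_def prod.case by (rule square_integrable_cmult)
  qed
  have "AE x in density (distr lborel borel T) (\<lambda>_. ennreal c). \<phi> x = \<psi> x"
    using assms(2) unfolding c(2)[symmetric] by (simp add: L2_eq_def)
  then have "AE x in distr lborel borel T. \<phi> x = \<psi> x"
    using c(1) by (simp add: AE_density)
  moreover have [measurable]: "\<phi> \<in> borel_measurable borel" "\<psi> \<in> borel_measurable borel"
    using assms(2) by (auto simp: L2_eq_def square_integrable_def)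
  ultimately have "AE x in lborel. \<phi> (T x) = \<psi> (T x)"
    by (subst (asm) AE_distr_iff) auto
  then have "AE x in lborel. U_fun g \<phi> x = U_fun g \<psi> x"
    unfolding g U_fun_def T_def prod.case by eventually_elim simp
  then show ?thesis
    using sq assms(2) by (simp add: L2_eq_def)
qed

lemma U_C_abs_L2:
  assumes "g \<in> carrier Gaff" "square_integrable \<phi>"
  shows "U_C g (abs_L2 \<phi>) = abs_L2 (U_fun g \<phi>)"
proof -
  have "L2_eq \<phi> \<phi>"
    using assms(2) by (simp add: L2_eq_def)
  then have "L2_eq (rep_L2 (abs_L2 \<phi>)) \<phi>"
    by (rule rep_abs_rsp_left[OF Quotient3_L2])
  then show ?thesis
    unfolding U_C_def by (intro Quotient3_rel_abs[OF Quotient3_L2] U_fun_L2_eq[OF assms(1)])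
qed

definition fourier_integral :: "(quat \<Rightarrow> complex) \<Rightarrow> quat \<Rightarrow> complex" where
  "fourier_integral \<phi> k =
     of_real (1 / (2 * pi)\<^sup>2) * (\<integral>x. exp (- (\<i> * of_real (k \<bullet> x))) * \<phi> x \<partial>lborel)"

text \<open>The unitary Fourier transform is the unique unitary operator given by the Fourier
  integral on \<open>L\<^sup>1 \<inter> L\<^sup>2\<close>.\<close>

definition fourier :: "quat L2 \<Rightarrow> quat L2" where
  "fourier = (THE F. unitary_op F \<and>
     (\<forall>f. integrable lborel (rep_L2 f) \<longrightarrow>
        (AE k in lborel. rep_L2 (F f) k = fourier_integral (rep_L2 f) k)))"

definition C_dom :: "quat L2 set" where
  "C_dom = {f. ennreal ((2 * pi) ^ 4) *
      (\<integral>\<^sup>+k. ennreal ((cmod (rep_L2 (fourier f) k))\<^sup>2 / norm k ^ 4) \<partial>lborel) < \<infinity>}"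

text \<open>Only meaningful on \<open>C_dom\<close>.\<close>

definition C_op :: "quat L2 \<Rightarrow> quat L2" where
  "C_op f = (THE h. AE k in lborel.
     rep_L2 (fourier h) k = of_real ((2 * pi / norm k)\<^sup>2) * rep_L2 (fourier f) k)"

end

theory Submission
  imports Defs "HOL-Probability.Characteristic_Functions"
begin

text \<open>In the Fourier domain the coefficient \<open>\<langle>f | U_C (b, a)
  \<eta>\<rangle>\<close> is \<open>(2\<pi>)\<^sup>2 |a|\<^sup>2\<close> times the Fourier
  integral, at \<open>b\<close>, of the integrable function \<open>k \<mapsto> cnj (Ff k)
  F\<eta> (a\<^sup>* k)\<close>, where \<open>F\<close> is the Fourier transform and
  \<open>a\<^sup>*\<close> is the conjugate quaternion. Injectivity of the Fourier integral on
  \<open>L\<^sup>1\<close> then gives irreducibility. Plancherel in \<open>b\<close> followed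
  by the substitution \<open>p = a\<^sup>* k\<close> in \<open>a\<close>, whose Jacobian is
  \<open>|k|\<^sup>4\<close>, gives the orthogonality relation on the diagonal, and two
  polarizations give the rest. Plancherel and injectivity both come from regularizing
  \<open>\<integral> Fu cnj Fv\<close> by a Gaussian, which turns it into a Gaussian average of
  the correlation of \<open>u\<close> and \<open>v\<close>.\<close>

section \<open>The Hilbert space\<close>

text \<open>Frequencies are moved by \<open>k \<mapsto> qconj a \<odot> k\<close>, and for nonzero
  \<open>k\<close> the map \<open>a \<mapsto> qconj a \<odot> k\<close> is a bijection of the
  nonzero quaternions. This single orbit of full measure is what makes the representation
  irreducible. It also carries the invariant measure da/|a|^4 to dp/|p|^4, which is the weight in
  the domain of C; the factor (2 pi)^4 there is the square of the constant in the coefficient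
  formula. Both \<open>fourier\<close> and \<open>C_op\<close> are definite descriptions, so
  existence and uniqueness precede any use of them, and this is why completeness of
  \<open>L2\<close> is needed. The order of the results is forced by their dependence: injectivity
  on L^1 makes the modulated Gaussians total; totality gives strong continuity of the
  representation; strong continuity gives continuity of the L^2 correlation at 0, without which the
  Gaussian limit does not yield Plancherel; and totality once more makes the extended Fourier
  transform surjective.\<close>

lemma square_integrable_rep_L2: "square_integrable (rep_L2 f)"
  using Quotient3_rel_rep[OF Quotient3_L2, of f f] by (simp add: L2_eq_def)

lemma borel_measurable_rep_L2 [measurable]: "rep_L2 f \<in> borel_measurable borel"
  using square_integrable_rep_L2[of f] by (simp add: square_integrable_def)

lemma integrable_rep_L2_square: "integrable lborel (\<lambda>x. (cmod (rep_L2 f x))\<^sup>2)"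
  using square_integrable_rep_L2[of f] by (simp add: square_integrable_def)

lemma rep_abs_L2: "square_integrable \<phi> \<Longrightarrow> AE x in lborel. rep_L2 (abs_L2 \<phi>) x = \<phi> x"
  using rep_abs_rsp_left[OF Quotient3_L2, of \<phi> \<phi>] by (simp add: L2_eq_def)

lemma abs_rep_L2 [simp]: "abs_L2 (rep_L2 f) = f"
  by (rule Quotient3_abs_rep[OF Quotient3_L2])

lemma abs_L2_cong:
  assumes "square_integrable \<phi>" "\<psi> \<in> borel_measurable borel" "AE x in lborel. \<phi> x = \<psi> x"
  shows "abs_L2 \<phi> = abs_L2 \<psi>"
proof -
  have [measurable]: "\<phi> \<in> borel_measurable borel"
    using assms(1) by (simp add: square_integrable_def)
  have "integrable lborel (\<lambda>x. (cmod (\<psi> x))\<^sup>2) \<longleftrightarrow> integrable lborel (\<lambda>x. (cmod (\<phi> x))\<^sup>2)"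
    using assms by (intro integrable_cong_AE) auto
  then have "L2_eq \<phi> \<psi>"
    using assms by (auto simp: L2_eq_def square_integrable_def)
  then show ?thesis
    by (rule Quotient3_rel_abs[OF Quotient3_L2])
qed

lemma L2_eqI: "(AE x in lborel. rep_L2 f x = rep_L2 g x) \<Longrightarrow> f = g"
  using abs_L2_cong[OF square_integrable_rep_L2 borel_measurable_rep_L2] abs_rep_L2 by metis

lemma rep_L2_add: "AE x in lborel. rep_L2 (f + g) x = rep_L2 f x + rep_L2 g x"
  unfolding plus_L2_def
  by (simp add: rep_abs_L2 square_integrable_add square_integrable_rep_L2)

lemma rep_L2_cscale: "AE x in lborel. rep_L2 (c *\<^sub>C f) x = c * rep_L2 f x"
  unfolding cscale_def
  by (simp add: rep_abs_L2 square_integrable_cmult square_integrable_rep_L2)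

lemma rep_L2_zero: "AE x in lborel. rep_L2 0 x = 0"
  unfolding zero_L2_def by (simp add: rep_abs_L2)

lemma rep_L2_diff: "AE x in lborel. rep_L2 (f - g) x = rep_L2 f x - rep_L2 g x"
proof -
  have eq: "f - g = f + (-1) *\<^sub>C g"
    by (simp add: minus_L2_def uminus_L2_def)
  show ?thesis
    unfolding eq using rep_L2_add[of f "(-1) *\<^sub>C g"] rep_L2_cscale[of "-1" g]
    by eventually_elim simp
qed

lemma abs_L2_add:
  assumes "square_integrable \<phi>" "square_integrable \<psi>"
  shows "abs_L2 (\<lambda>x. \<phi> x + \<psi> x) = abs_L2 \<phi> + abs_L2 \<psi>"
proof (rule L2_eqI)
  show "AE x in lborel. rep_L2 (abs_L2 (\<lambda>x. \<phi> x + \<psi> x)) x = rep_L2 (abs_L2 \<phi> + abs_L2 \<psi>) x"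
    using rep_abs_L2[OF assms(1)] rep_abs_L2[OF assms(2)] rep_abs_L2[OF square_integrable_add[OF assms]]
      rep_L2_add[of "abs_L2 \<phi>" "abs_L2 \<psi>"] by eventually_elim simp
qed

lemma abs_L2_cscale:
  assumes "square_integrable \<phi>"
  shows "abs_L2 (\<lambda>x. c * \<phi> x) = c *\<^sub>C abs_L2 \<phi>"
proof (rule L2_eqI)
  show "AE x in lborel. rep_L2 (abs_L2 (\<lambda>x. c * \<phi> x)) x = rep_L2 (c *\<^sub>C abs_L2 \<phi>) x"
    using rep_abs_L2[OF assms] rep_abs_L2[OF square_integrable_cmult[OF assms]]
      rep_L2_cscale[of c "abs_L2 \<phi>"] by eventually_elim simp
qed

lemma square_integrable_iff:
  "square_integrable f \<longleftrightarrow> f \<in> borel_measurable borel \<and>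
     (\<integral>\<^sup>+x. ennreal ((cmod (f x))\<^sup>2) \<partial>lborel) < \<infinity>"
  by (auto simp: square_integrable_def integrable_iff_bounded)

lemma cinner_cong:
  assumes "square_integrable \<phi>" "AE x in lborel. rep_L2 f x = \<phi> x" "square_integrable \<psi>"
    "AE x in lborel. rep_L2 g x = \<psi> x"
  shows "\<langle>f | g\<rangle> = (\<integral>x. cnj (\<phi> x) * \<psi> x \<partial>lborel)"
  unfolding cinner.rep_eq
proof (rule integral_cong_AE)
  show "AE x in lborel. cnj (rep_L2 f x) * rep_L2 g x = cnj (\<phi> x) * \<psi> x"
    using assms(2,4) by eventually_elim simp
qed (use assms square_integrable_mult_measurable square_integrable_rep_L2 in \<open>blast+\<close>)

lemma cinner_commute: "\<langle>f | g\<rangle> = cnj \<langle>g | f\<rangle>"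
  by transfer (rule integral_cnj_mult_swap)

lemma cinner_add_right: "\<langle>f | g + h\<rangle> = \<langle>f | g\<rangle> + \<langle>f | h\<rangle>"
  by transfer (simp add: L2_eq_def square_integrable_mult distrib_left)

lemma cinner_add_left: "\<langle>f + g | h\<rangle> = \<langle>f | h\<rangle> + \<langle>g | h\<rangle>"
  by (metis cinner_add_right cinner_commute complex_cnj_add)

lemma cinner_cscale_right: "\<langle>f | c *\<^sub>C g\<rangle> = c * \<langle>f | g\<rangle>"
  by transfer (simp add: mult.left_commute)

lemma cinner_cscale_left: "\<langle>c *\<^sub>C f | g\<rangle> = cnj c * \<langle>f | g\<rangle>"
  by (metis cinner_cscale_right cinner_commute complex_cnj_mult)

lemma cinner_self: "\<langle>f | f\<rangle> = of_real ((norm f)\<^sup>2)"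
proof -
  have sq: "\<langle>f | f\<rangle> = of_real (\<integral>x. (cmod (rep_L2 f x))\<^sup>2 \<partial>lborel)"
    unfolding cinner.rep_eq by (fact integral_cnj_mult_self)
  then show ?thesis
    by (simp add: norm_L2_def)
qed

lemma norm_L2_square: "(norm f)\<^sup>2 = (\<integral>x. (cmod (rep_L2 f x))\<^sup>2 \<partial>lborel)"
  using cinner_self[of f] integral_cnj_mult_self[of "rep_L2 f"]
  by (metis cinner.rep_eq of_real_eq_iff)

lemma ennreal_norm_L2:
  "(\<integral>\<^sup>+x. ennreal ((cmod (rep_L2 f x))\<^sup>2) \<partial>lborel) = ennreal ((norm f)\<^sup>2)"
  unfolding norm_L2_square by (rule nn_integral_eq_integral) (auto simp: integrable_rep_L2_square)

lemma ennreal_norm_abs_L2: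
  assumes "square_integrable \<phi>"
  shows "(\<integral>\<^sup>+x. ennreal ((cmod (\<phi> x))\<^sup>2) \<partial>lborel) = ennreal ((norm (abs_L2 \<phi>))\<^sup>2)"
  unfolding ennreal_norm_L2[symmetric]
  by (rule nn_integral_cong_AE) (use rep_abs_L2[OF assms] in eventually_elim, simp)

lemma cscale_add_right: "c *\<^sub>C (f + g) = c *\<^sub>C f + c *\<^sub>C g"
  by transfer (auto simp: L2_eq_def square_integrable_add square_integrable_cmult distrib_left)

lemma cscale_cscale [simp]: "c *\<^sub>C d *\<^sub>C f = (c * d) *\<^sub>C f"
  by transfer (auto simp: L2_eq_def square_integrable_cmult mult.assoc)

lemma norm_cscale: "norm (c *\<^sub>C f) = cmod c * norm f"
proof -
  have "\<langle>c *\<^sub>C f | c *\<^sub>C f\<rangle> = of_real ((cmod c * norm f)\<^sup>2)"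
    using complex_norm_square[of c]
    by (simp only: cinner_cscale_left cinner_cscale_right)
      (auto simp: cinner_self power_mult_distrib)
  then have "(norm (c *\<^sub>C f))\<^sup>2 = (cmod c * norm f)\<^sup>2"
    unfolding cinner_self of_real_eq_iff .
  then show ?thesis
    by (simp add: power2_eq_iff_nonneg)
qed

text \<open>The class \<open>real_inner\<close> bounds only the real part; a phase multiplied onto
  \<open>g\<close> makes the inner product real and nonnegative.\<close>

lemma cinner_Cauchy_Schwarz: "cmod \<langle>f | g\<rangle> \<le> norm f * norm g"
proof -
  define c where "c = cnj (sgn \<langle>f | g\<rangle>)"
  have "of_real (cmod \<langle>f | g\<rangle>) = c * \<langle>f | g\<rangle>"
    unfolding c_def using complex_norm_square[of "\<langle>f | g\<rangle>"]
    by (cases "\<langle>f | g\<rangle> = 0") (simp_all add: sgn_eq power2_eq_square field_simps)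
  then have "cmod \<langle>f | g\<rangle> = Re \<langle>f | c *\<^sub>C g\<rangle>"
    by (metis cinner_cscale_right Re_complex_of_real)
  also have "\<dots> \<le> norm f * norm (c *\<^sub>C g)"
    using norm_cauchy_schwarz[of f "c *\<^sub>C g"] by (simp add: inner_L2_def)
  \<comment> \<open>Since \<open>sgn 0 = 0\<close>, the phase has modulus at most 1, not always
    1.\<close>
  also have "\<dots> \<le> norm f * norm g"
    by (intro mult_left_mono) (auto simp: norm_cscale c_def norm_sgn)
  finally show ?thesis .
qed

lemma bounded_bilinear_cinner: "bounded_bilinear cinner"
proof (rule bounded_bilinear.intro)
  show "\<exists>K. \<forall>a b :: 'a L2. cmod \<langle>a | b\<rangle> \<le> norm a * norm b * K"
    by (rule exI[of _ 1]) (simp add: cinner_Cauchy_Schwarz)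
qed (simp_all add: cinner_add_left cinner_add_right scaleR_L2_def cinner_cscale_left
    cinner_cscale_right scaleR_conv_of_real)

lemma bounded_linear_cscale: "bounded_linear (cscale c)"
proof (rule bounded_linear_intro[where K = "cmod c"])
  show "c *\<^sub>C r *\<^sub>R f = r *\<^sub>R c *\<^sub>C f" for r and f :: "'a L2"
    by (simp add: scaleR_L2_def mult.commute)
qed (simp_all add: cscale_add_right norm_cscale mult.commute)

lemmas tendsto_cscale = bounded_linear.tendsto[OF bounded_linear_cscale]
lemmas cinner_diff_left = bounded_bilinear.diff_left[OF bounded_bilinear_cinner]

lemma cinner_ext: "(\<And>h. \<langle>f | h\<rangle> = \<langle>g | h\<rangle>) \<Longrightarrow> f = g"
  using cinner_self[of "f - g"] by (auto simp: cinner_diff_left)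

lemma csubspace_scaleR: "csubspace S \<Longrightarrow> f \<in> S \<Longrightarrow> r *\<^sub>R f \<in> S"
  by (simp add: csubspace_def scaleR_L2_def)

subsection \<open>Completeness\<close>

text \<open>Multiplication by such a weight turns an \<open>L\<^sup>2\<close>-Cauchy sequence into an \<open>L\<^sup>1\<close>-Cauchy one,
  for which the library has almost everywhere convergent subsequences.\<close>

lemma positive_square_integrable_weight:
  obtains w :: "'a::euclidean_space \<Rightarrow> real"
  where "w \<in> borel_measurable borel" "\<And>x. w x > 0" "square_integrable (\<lambda>x. of_real (w x))"
proof -
  obtain h :: "'a \<Rightarrow> ennreal" where h: "h \<in> borel_measurable lborel"
      "integral\<^sup>N lborel h \<noteq> \<infinity>" "\<And>x. 0 < h x \<and> h x < \<infinity>"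
    using sigma_finite_measure.Ex_finite_integrable_function[OF sigma_finite_lborel] by auto
  note [measurable] = h(1)
  define w where "w x = sqrt (enn2real (h x))" for x
  have eq: "ennreal ((w x)\<^sup>2) = h x" for x
    using h(3)[of x] by (simp add: w_def)
  show thesis
  proof
    show w: "w \<in> borel_measurable borel"
      unfolding w_def by measurable
    show "w x > 0" for x
      using h(3)[of x] by (simp add: w_def enn2real_positive_iff)
    show "square_integrable (\<lambda>x. of_real (w x))"
      using h(2) w by (simp add: square_integrable_iff eq less_top)
  qed
qed

text \<open>Riesz-Fischer. The weighted sequence is Cauchy in L^1, so a subsequence converges almost
  everywhere; Fatou's lemma shows that its pointwise limit is also the limit in norm.\<close>

lemma Cauchy_L2_convergent:
  fixes X :: "nat \<Rightarrow> 'a::euclidean_space L2"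
  assumes "Cauchy X"
  shows "convergent X"
proof -
  obtain w :: "'a \<Rightarrow> real" where w: "w \<in> borel_measurable borel" "\<And>x. w x > 0"
      "square_integrable (\<lambda>x. complex_of_real (w x))"
    by (metis positive_square_integrable_weight)
  note [measurable] = w(1)
  define W where "W = abs_L2 (\<lambda>x. complex_of_real (w x))"
  define s where "s n x = rep_L2 (X n) x * w x" for n x
  have rW: "AE x in lborel. rep_L2 W x = w x"
    unfolding W_def by (rule rep_abs_L2[OF w(3)])
  have s_int: "integrable lborel (s n)" for n
    using square_integrable_mult[OF w(3) square_integrable_rep_L2[of "X n"]]
    by (simp add: s_def[abs_def] mult.commute)
  have s_L1: "(\<integral>x. norm (s i x - s j x) \<partial>lborel) \<le> norm W * norm (X i - X j)" for i j
  proof -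
    \<comment> \<open>Taking moduli before forming the class lets Cauchy-Schwarz bound the L^1 norm,
      not merely the modulus of an integral.\<close>
    define a where "a = abs_L2 (\<lambda>x. complex_of_real (cmod (rep_L2 (X i - X j) x)))"
    have sqa: "square_integrable (\<lambda>x. complex_of_real (cmod (rep_L2 (X i - X j) x)))"
      using square_integrable_rep_L2[of "X i - X j"] by (simp add: square_integrable_def)
    have na: "norm a = norm (X i - X j)"
      using ennreal_norm_abs_L2[OF sqa] ennreal_norm_L2[of "X i - X j"]
      by (simp add: a_def power2_eq_iff_nonneg)
    have "complex_of_real (\<integral>x. norm (s i x - s j x) \<partial>lborel)
        = (\<integral>x. complex_of_real (norm (s i x - s j x)) \<partial>lborel)"
      by simp
    also have "\<dots> = (\<integral>x. cnj (of_real (w x)) * of_real (cmod (rep_L2 (X i - X j) x)) \<partial>lborel)"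
    proof (rule integral_cong_AE)
      show "AE x in lborel. complex_of_real (norm (s i x - s j x)) =
          cnj (of_real (w x)) * of_real (cmod (rep_L2 (X i - X j) x))"
        using rep_L2_diff[of "X i" "X j"]
      proof eventually_elim
        case (elim x)
        then show ?case
          using w(2)[of x] by (simp add: s_def left_diff_distrib[symmetric] norm_mult)
      qed
    qed (auto simp: s_def)
    also have "\<dots> = \<langle>W | a\<rangle>"
      by (rule cinner_cong[symmetric, OF w(3) rW sqa]) (simp add: a_def rep_abs_L2[OF sqa])
    finally have "(\<integral>x. norm (s i x - s j x) \<partial>lborel) \<le> cmod \<langle>W | a\<rangle>"
      by (metis norm_of_real abs_ge_self)
    then show ?thesis
      using cinner_Cauchy_Schwarz[of W a] na by simp
  qed
  have "\<exists>N. \<forall>i\<ge>N. \<forall>j\<ge>N. (\<integral>x. norm (s i x - s j x) \<partial>lborel) < e" if "e > 0" for e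
  proof -
    \<comment> \<open>Adding 1 keeps the denominator positive without an appeal to
      \<open>norm W > 0\<close>.\<close>
    have "e / (norm W + 1) > 0"
      using that by (simp add: add_nonneg_pos)
    then obtain N where N: "\<And>i j. i \<ge> N \<Longrightarrow> j \<ge> N \<Longrightarrow> norm (X i - X j) < e / (norm W + 1)"
      using assms unfolding Cauchy_def dist_norm by meson
    have "(\<integral>x. norm (s i x - s j x) \<partial>lborel) < e" if "i \<ge> N" "j \<ge> N" for i j
    proof -
      have "norm W * norm (X i - X j) \<le> (norm W + 1) * norm (X i - X j)"
        by (simp add: mult_right_mono)
      also have "\<dots> < e"
        using N[OF that] by (simp add: pos_less_divide_eq add_nonneg_pos mult.commute)
      finally show ?thesis
        using s_L1[of i j] by simp
    qed
    then show ?thesis by blast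
  qed
  then obtain r where r: "strict_mono r" "AE x in lborel. Cauchy (\<lambda>i. s (r i) x)"
    using cauchy_L1_AE_cauchy_subseq[where s = s and M = lborel] s_int by blast
  define \<phi> where "\<phi> x = lim (\<lambda>i. rep_L2 (X (r i)) x)" for x
  have [measurable]: "\<phi> \<in> borel_measurable borel"
    unfolding \<phi>_def by measurable
  have lim: "AE x in lborel. (\<lambda>i. rep_L2 (X (r i)) x) \<longlonglongrightarrow> \<phi> x"
    using r(2)
  proof eventually_elim
    case (elim x)
    \<comment> \<open>Positivity of \<open>w\<close> allows the weight to be divided out
      pointwise.\<close>
    then have "convergent (\<lambda>i. s (r i) x * of_real (1 / w x))"
      by (intro convergent_mult convergent_const) (simp add: Cauchy_convergent_iff)
    moreover have "s (r i) x * of_real (1 / w x) = rep_L2 (X (r i)) x" for i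
      using w(2)[of x] by (simp add: s_def)
    ultimately show ?case
      by (simp add: \<phi>_def convergent_LIMSEQ_iff)
  qed
  \<comment> \<open>Letting only the index \<open>j\<close> tend to infinity carries the Cauchy
    bound over to the distance from the limit.\<close>
  have fatou: "(\<integral>\<^sup>+x. ennreal ((cmod (\<phi> x - rep_L2 (X (r i)) x))\<^sup>2) \<partial>lborel) \<le> ennreal (e\<^sup>2)"
    if e: "e > 0" and N: "\<And>i j. i \<ge> N \<Longrightarrow> j \<ge> N \<Longrightarrow> norm (X i - X j) < e" and i: "i \<ge> N" for e N i
  proof -
    have "(\<integral>\<^sup>+x. ennreal ((cmod (\<phi> x - rep_L2 (X (r i)) x))\<^sup>2) \<partial>lborel)
        = (\<integral>\<^sup>+x. liminf (\<lambda>j. ennreal ((cmod (rep_L2 (X (r j)) x - rep_L2 (X (r i)) x))\<^sup>2)) \<partial>lborel)"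
    proof (rule nn_integral_cong_AE, use lim in eventually_elim)
      case (elim x)
      have "(\<lambda>j. ennreal ((cmod (rep_L2 (X (r j)) x - rep_L2 (X (r i)) x))\<^sup>2))
          \<longlonglongrightarrow> ennreal ((cmod (\<phi> x - rep_L2 (X (r i)) x))\<^sup>2)"
        by (intro tendsto_ennrealI tendsto_intros elim)
      from lim_imp_Liminf[OF trivial_limit_sequentially this] show ?case
        by (rule sym)
    qed
    also have "\<dots> \<le> liminf (\<lambda>j. \<integral>\<^sup>+x. ennreal ((cmod (rep_L2 (X (r j)) x - rep_L2 (X (r i)) x))\<^sup>2) \<partial>lborel)"
      by (rule nn_integral_liminf) measurable
    also have "\<dots> = liminf (\<lambda>j. ennreal ((norm (X (r j) - X (r i)))\<^sup>2))"
    proof -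
      have "(\<integral>\<^sup>+x. ennreal ((cmod (rep_L2 (X (r j)) x - rep_L2 (X (r i)) x))\<^sup>2) \<partial>lborel)
          = ennreal ((norm (X (r j) - X (r i)))\<^sup>2)" for j
        unfolding ennreal_norm_L2[symmetric]
        by (rule nn_integral_cong_AE) (use rep_L2_diff[of "X (r j)" "X (r i)"] in eventually_elim, simp)
      then show ?thesis by simp
    qed
    also have "\<dots> \<le> ennreal (e\<^sup>2)"
    proof (rule Liminf_le[OF trivial_limit_sequentially])
      show "\<forall>\<^sub>F j in sequentially. ennreal ((norm (X (r j) - X (r i)))\<^sup>2) \<le> ennreal (e\<^sup>2)"
        using eventually_ge_at_top[of N]
      proof eventually_elim
        case (elim j)
        then have "r j \<ge> N" "r i \<ge> N"
          using strict_mono_imp_increasing[OF r(1)] i order_trans by blast+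
        then show ?case
          using N[of "r j" "r i"] by (intro ennreal_leI power_mono) auto
      qed
    qed
    finally show ?thesis .
  qed
  have CauchyN: "\<exists>N. \<forall>i\<ge>N. \<forall>j\<ge>N. norm (X i - X j) < e" if "e > 0" for e
    using assms that unfolding Cauchy_def dist_norm by blast
  have sq: "square_integrable \<phi>"
  proof -
    obtain N where N: "\<And>i j. i \<ge> N \<Longrightarrow> j \<ge> N \<Longrightarrow> norm (X i - X j) < 1"
      using CauchyN[of 1] by auto
    \<comment> \<open>Fatou controls only differences, so a fixed term of the sequence is added
      back.\<close>
    have "square_integrable (\<lambda>x. \<phi> x - rep_L2 (X (r N)) x)"
      using fatou[of 1 N N, OF _ N] by (auto simp: square_integrable_iff intro: le_less_trans)
    from square_integrable_add[OF this square_integrable_rep_L2[of "X (r N)"]]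
    show ?thesis by simp
  qed
  define f where "f = abs_L2 \<phi>"
  have rf: "AE x in lborel. rep_L2 f x = \<phi> x"
    unfolding f_def by (rule rep_abs_L2[OF sq])
  have "(\<lambda>i. X (r i)) \<longlonglongrightarrow> f"
  proof (rule metric_LIMSEQ_I)
    fix e :: real
    assume e: "e > 0"
    then obtain N where N: "\<And>i j. i \<ge> N \<Longrightarrow> j \<ge> N \<Longrightarrow> norm (X i - X j) < e / 2"
      using CauchyN[of "e / 2"] by auto
    have "dist (X (r i)) f < e" if "i \<ge> N" for i
    proof -
      have "ennreal ((norm (f - X (r i)))\<^sup>2)
          = (\<integral>\<^sup>+x. ennreal ((cmod (\<phi> x - rep_L2 (X (r i)) x))\<^sup>2) \<partial>lborel)"
        unfolding ennreal_norm_L2[symmetric]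
        by (rule nn_integral_cong_AE) (use rep_L2_diff[of f "X (r i)"] rf in eventually_elim, simp)
      also have "\<dots> \<le> ennreal ((e / 2)\<^sup>2)"
        using fatou[of "e / 2" N i, OF _ N that] e by simp
      finally have "norm (f - X (r i)) \<le> e / 2"
        using e by (simp add: power2_le_iff_abs_le)
      then show ?thesis
        using e by (simp add: dist_norm norm_minus_commute)
    qed
    then show "\<exists>N. \<forall>i\<ge>N. dist (X (r i)) f < e" by blast
  qed
  then have "X \<longlonglongrightarrow> f"
    unfolding comp_def[symmetric] by (rule Cauchy_converges_subseq[OF assms r(1)])
  then show ?thesis
    by (rule convergentI)
qed

instance L2 :: (euclidean_space) complete_space
  by standard (rule Cauchy_L2_convergent)

subsection \<open>Orthogonal complements of closed subspaces\<close>

text \<open>The projection theorem: \<open>e\<close> is the residual of a nearest point in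
  \<open>S\<close>. Completeness supplies the nearest point, and stability of \<open>S\<close> under
  multiplication by \<open>\<i>\<close> upgrades real orthogonality to complex
  orthogonality.\<close>

lemma exists_orthogonal_vector:
  assumes S: "csubspace S" "closed S" "S \<noteq> UNIV"
  obtains e where "e \<noteq> 0" "\<And>s. s \<in> S \<Longrightarrow> \<langle>e | s\<rangle> = 0"
proof -
  obtain x where x: "x \<notin> S"
    using S(3) by blast
  have ne: "S \<noteq> {}"
    using S(1) by (auto simp: csubspace_def)
  define d where "d = infdist x S"
  have "\<exists>s\<in>S. dist x s < d + 1 / Suc n" for n
    using cINF_less_iff[OF ne, of "dist x" "d + 1 / Suc n"] ne
    by (auto simp: d_def infdist_notempty)
  then obtain s where s: "\<And>n. s n \<in> S" "\<And>n. dist x (s n) < d + 1 / Suc n"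
    by metis
  have d0: "d \<ge> 0"
    by (simp add: d_def infdist_nonneg)
  \<comment> \<open>The midpoint of \<open>s m\<close> and \<open>s n\<close> lies in
    \<open>S\<close>, hence at distance at least \<open>d\<close> from \<open>x\<close>; the
    parallelogram law then forces the two points together.\<close>
  have para: "(norm (s m - s n))\<^sup>2 \<le> 2 * (d + 1 / Suc m)\<^sup>2 + 2 * (d + 1 / Suc n)\<^sup>2 - 4 * d\<^sup>2" for m n
  proof -
    define p where "p = x - s m"
    define q where "q = x - s n"
    have "(1/2) *\<^sub>R (s m + s n) \<in> S"
      using S(1) s(1) csubspace_scaleR[OF S(1)] by (simp add: csubspace_def)
    then have "d \<le> dist x ((1/2) *\<^sub>R (s m + s n))"
      unfolding d_def by (rule infdist_le)
    also have "x - (1/2) *\<^sub>R (s m + s n) = (1/2) *\<^sub>R (p + q)"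
      by (simp add: p_def q_def algebra_simps flip: scaleR_2)
    then have "dist x ((1/2) *\<^sub>R (s m + s n)) = norm (p + q) / 2"
      by (simp add: dist_norm)
    finally have 1: "(2 * d)\<^sup>2 \<le> (norm (p + q))\<^sup>2"
      using d0 by (intro power_mono) auto
    have 2: "(norm p)\<^sup>2 \<le> (d + 1 / Suc m)\<^sup>2" "(norm q)\<^sup>2 \<le> (d + 1 / Suc n)\<^sup>2"
      using s(2)[of m] s(2)[of n] by (auto intro!: power_mono simp: p_def q_def dist_norm)
    have "(norm (q - p))\<^sup>2 + (norm (p + q))\<^sup>2 = 2 * (norm p)\<^sup>2 + 2 * (norm q)\<^sup>2"
      by (simp add: power2_norm_eq_inner algebra_simps inner_commute)
    moreover have "q - p = s m - s n"
      by (simp add: p_def q_def)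
    ultimately show ?thesis
      using 1 2 by (simp add: power_mult_distrib)
  qed
  have "Cauchy s"
  proof (rule metric_CauchyI)
    fix e :: real
    assume e: "e > 0"
    have "(\<lambda>n. (d + 1 / Suc n)\<^sup>2) \<longlonglongrightarrow> (d + 0)\<^sup>2"
      by (intro tendsto_intros LIMSEQ_Suc[OF lim_1_over_n])
    then have "(\<lambda>n. (d + 1 / Suc n)\<^sup>2) \<longlonglongrightarrow> d\<^sup>2"
      by simp
    moreover have "d\<^sup>2 < d\<^sup>2 + e\<^sup>2 / 4"
      using e by simp
    ultimately have "\<forall>\<^sub>F n in sequentially. (d + 1 / Suc n)\<^sup>2 < d\<^sup>2 + e\<^sup>2 / 4"
      by (rule order_tendstoD(2))
    then obtain N where N: "\<And>n. n \<ge> N \<Longrightarrow> (d + 1 / Suc n)\<^sup>2 < d\<^sup>2 + e\<^sup>2 / 4"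
      by (auto simp: eventually_sequentially)
    have "dist (s m) (s n) < e" if "m \<ge> N" "n \<ge> N" for m n
    proof -
      have "(norm (s m - s n))\<^sup>2 < e\<^sup>2"
        using para[of m n] N[OF that(1)] N[OF that(2)] by simp
      then show ?thesis
        using e by (simp add: dist_norm power2_less_imp_less)
    qed
    then show "\<exists>N. \<forall>m\<ge>N. \<forall>n\<ge>N. dist (s m) (s n) < e" by blast
  qed
  then obtain t where t: "s \<longlonglongrightarrow> t"
    using Cauchy_convergent convergent_def by blast
  have tS: "t \<in> S"
    using closed_sequentially[OF S(2)] s(1) t by blast
  define e where "e = x - t"
  have ne: "norm e \<le> d"
  proof (rule LIMSEQ_le)
    show "(\<lambda>n. norm (x - s n)) \<longlonglongrightarrow> norm e"
      unfolding e_def by (intro tendsto_intros t)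
    show "(\<lambda>n. d + 1 / Suc n) \<longlonglongrightarrow> d"
      using tendsto_add[OF tendsto_const LIMSEQ_Suc[OF lim_1_over_n], of d] by simp
    show "\<exists>N. \<forall>n\<ge>N. norm (x - s n) \<le> d + 1 / Suc n"
      using s(2) by (auto simp: dist_norm less_imp_le)
  qed
  have inner0: "e \<bullet> u = 0" if u: "u \<in> S" for u
  proof (cases "u = 0")
    case False
    \<comment> \<open>This \<open>r\<close> minimizes the norm of \<open>e - r *\<^sub>R u\<close>;
      unless \<open>e \<bullet> u = 0\<close>, the resulting point of \<open>S\<close> would be
      closer to \<open>x\<close> than \<open>d\<close>.\<close>
    define r where "r = (e \<bullet> u) / (u \<bullet> u)"
    have uu: "u \<bullet> u > 0"
      using False by simp
    have "t + r *\<^sub>R u \<in> S"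
      using S(1) tS u csubspace_scaleR[OF S(1)] by (simp add: csubspace_def)
    then have "d \<le> norm (e - r *\<^sub>R u)"
      using infdist_le[of "t + r *\<^sub>R u" S x] by (simp add: d_def e_def dist_norm algebra_simps)
    then have "(norm e)\<^sup>2 \<le> (norm (e - r *\<^sub>R u))\<^sup>2"
      using ne by (intro power_mono) auto
    also have "\<dots> = (norm e)\<^sup>2 - (e \<bullet> u)\<^sup>2 / (u \<bullet> u)"
      unfolding power2_norm_eq_inner r_def using uu
      by (simp add: inner_diff_left inner_diff_right inner_commute field_simps power2_eq_square)
    finally have "(e \<bullet> u)\<^sup>2 \<le> 0"
      using uu by (simp add: field_simps)
    then show ?thesis
      by simp
  qed simp
  show thesis
  proof
    show "e \<noteq> 0"
      using x tS by (auto simp: e_def)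
    fix u
    assume u: "u \<in> S"
    have "Re \<langle>e | u\<rangle> = 0"
      using inner0[OF u] by (simp add: inner_L2_def)
    moreover have "\<i> *\<^sub>C u \<in> S"
      using S(1) u by (simp add: csubspace_def)
    then have "Im \<langle>e | u\<rangle> = 0"
      using inner0[of "\<i> *\<^sub>C u"] by (simp add: inner_L2_def cinner_cscale_right)
    ultimately show "\<langle>e | u\<rangle> = 0"
      by (simp add: complex_eq_iff)
  qed
qed

section \<open>Change of variables under similarities\<close>

text \<open>Dividing by \<open>r\<close> leaves an orthogonal map, of determinant 1 or -1; the
  scaling contributes one factor \<open>r\<close> per dimension.\<close>

lemma abs_det_similarity:
  fixes T :: "real^'n::{finite,wellorder} \<Rightarrow> real^'n::{finite,wellorder}"
  assumes "linear T" "\<And>x. norm (T x) = r * norm x" "r > 0"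
  shows "\<bar>det (matrix T)\<bar> = r ^ CARD('n)"
proof -
  define Q where "Q x = (1 / r) *\<^sub>R T x" for x
  have lQ: "linear Q"
    unfolding Q_def by (rule linear_compose_scale_right[OF assms(1)])
  have nQ: "norm (Q x) = norm x" for x
    using assms(3) by (simp add: Q_def assms(2))
  have "orthogonal_transformation Q"
    unfolding orthogonal_transformation using lQ nQ by blast
  then have 1: "\<bar>det (matrix Q)\<bar> = 1"
    by (rule orthogonal_transformation_det)
  have "T = (*\<^sub>R) r \<circ> Q"
    using assms(3) by (auto simp: Q_def)
  then have "matrix T = matrix ((*\<^sub>R) r) ** matrix Q"
    by (metis matrix_compose linear_scale_self lQ)
  then show ?thesis
    using 1 assms(3) by (simp add: det_mul abs_mult)
qed

text \<open>The orthogonality relation depends on the value of the Jacobian, whereas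
  \<open>lborel_qaffine\<close> only yields some positive constant. It is enough to compare the two
  measures on boxes.\<close>

lemma lborel_similarity:
  fixes T :: "real^'n::{finite,wellorder} \<Rightarrow> real^'n::{finite,wellorder}"
  assumes T: "linear T" "\<And>x. norm (T x) = r * norm x" "r > 0"
  shows "lborel = density (distr lborel borel (\<lambda>x. b + T x)) (\<lambda>_. ennreal (r ^ CARD('n)))"
proof -
  define A where "A = (\<lambda>x. b + T x)"
  have "inj T"
    unfolding linear_injective_0[OF T(1)]
    using T(2,3) by (metis norm_eq_zero mult_eq_0_iff less_irrefl)
  then obtain S where S: "linear S" "\<And>x. S (T x) = x" "\<And>x. T (S x) = x"
    using linear_injective_isomorphism[OF T(1)] by metis
  have nS: "norm (S x) = (1 / r) * norm x" for x
    using T(2)[of "S x"] T(3) by (simp add: S(3))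
  have det: "\<bar>det (matrix S)\<bar> = (1 / r) ^ CARD('n)"
    using abs_det_similarity[OF S(1) nS] T(3) by simp
  have "continuous_on UNIV A"
    unfolding A_def by (intro continuous_intros linear_continuous_on linear_linear[THEN iffD2] T(1))
  then have [measurable]: "A \<in> borel \<rightarrow>\<^sub>M borel"
    by (rule borel_measurable_continuous_onI)
  have "lborel = density (distr lborel borel A) (\<lambda>_. ennreal (r ^ CARD('n)))"
  proof (rule lborel_eqI)
    fix l u :: "real^'n::{finite,wellorder}"
    assume le: "\<And>i. i \<in> Basis \<Longrightarrow> l \<bullet> i \<le> u \<bullet> i"
    have eq: "A -` box l u = S ` ((+) (-b) ` box l u)"
      by (auto simp: A_def image_iff S) (metis S(2) add.left_neutral add_diff_cancel_left' uminus_add_conv_diff)+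
    have Am: "A -` box l u \<in> sets lborel"
      using measurable_sets[of A borel borel "box l u"] by simp
    have lm: "A -` box l u \<in> lmeasurable"
      unfolding eq by (intro measurable_linear_image measurable_translation S lmeasurable_box)
    have "emeasure lborel (A -` box l u) = emeasure lebesgue (A -` box l u)"
      using Am by simp
    also have "\<dots> = ennreal (measure lebesgue (A -` box l u))"
      using lm by (rule emeasure_eq_measure2)
    also have "measure lebesgue (A -` box l u) = (1 / r) ^ CARD('n) * measure lebesgue (box l u)"
      unfolding eq det[symmetric] measure_linear_image[OF S(1) measurable_translation[OF lmeasurable_box]]
        measure_translation ..
    also have "measure lebesgue (box l u) = (\<Prod>i\<in>Basis. (u - l) \<bullet> i)"
      using le by (simp add: measure_lborel_box_eq)
    finally have "emeasure lborel (A -` box l u)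
        = ennreal ((1 / r) ^ CARD('n) * (\<Prod>i\<in>Basis. (u - l) \<bullet> i))" .
    then show "emeasure (density (distr lborel borel A) (\<lambda>_. ennreal (r ^ CARD('n)))) (box l u)
        = ennreal (\<Prod>i\<in>Basis. (u - l) \<bullet> i)"
      using T(3) by (simp add: emeasure_density nn_integral_cmult_indicator emeasure_distr
          ennreal_mult'[symmetric] power_divide)
  qed simp
  then show ?thesis
    by (simp add: A_def)
qed

context
  fixes T :: "real^'n::{finite,wellorder} \<Rightarrow> real^'n::{finite,wellorder}" and r :: real and b :: "real^'n::{finite,wellorder}"
  assumes T: "linear T" "\<And>x. norm (T x) = r * norm x" "r > 0"
begin

lemma measurable_similarity: "(\<lambda>x. b + T x) \<in> borel \<rightarrow>\<^sub>M borel"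
  by (intro borel_measurable_continuous_onI continuous_intros linear_continuous_on
      linear_linear[THEN iffD2] T(1))

lemma nn_integral_similarity:
  assumes [measurable]: "f \<in> borel_measurable borel"
  shows "(\<integral>\<^sup>+x. f (b + T x) \<partial>lborel) = ennreal (1 / r ^ CARD('n)) * (\<integral>\<^sup>+x. f x \<partial>lborel)"
proof -
  note [measurable] = measurable_similarity
  have "(\<integral>\<^sup>+x. f x \<partial>lborel) = ennreal (r ^ CARD('n)) * (\<integral>\<^sup>+x. f (b + T x) \<partial>lborel)"
    by (subst lborel_similarity[OF T, of b])
      (simp add: nn_integral_density nn_integral_distr nn_integral_cmult)
  moreover have "ennreal (1 / r ^ CARD('n)) * ennreal (r ^ CARD('n)) = 1"
    using T(3) by (simp add: ennreal_mult'[symmetric])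
  ultimately show ?thesis
    by (simp add: mult.assoc[symmetric])
qed

lemma integrable_similarity:
  fixes f :: "real^'n::{finite,wellorder} \<Rightarrow> 'b::{banach, second_countable_topology}"
  assumes "integrable lborel f"
  shows "integrable lborel (\<lambda>x. f (b + T x))"
proof -
  note [measurable] = measurable_similarity
  have [measurable]: "f \<in> borel_measurable borel"
    using assms by (auto dest: borel_measurable_integrable)
  show ?thesis
    using assms T(3) nn_integral_similarity[of "\<lambda>x. ennreal (norm (f x))"]
    by (auto simp: integrable_iff_bounded ennreal_mult_less_top)
qed

lemma integral_similarity:
  fixes f :: "real^'n::{finite,wellorder} \<Rightarrow> 'b::{banach, second_countable_topology}"
  assumes [measurable]: "f \<in> borel_measurable borel"
  shows "(\<integral>x. f (b + T x) \<partial>lborel) = (1 / r ^ CARD('n)) *\<^sub>R (\<integral>x. f x \<partial>lborel)"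
proof -
  note [measurable] = measurable_similarity
  have "(\<integral>x. f x \<partial>lborel) = r ^ CARD('n) *\<^sub>R (\<integral>x. f (b + T x) \<partial>lborel)"
    using T(3) by (subst lborel_similarity[OF T, of b])
      (simp add: integral_density integral_distr)
  then show ?thesis
    using T(3) by simp
qed

end

section \<open>The representation\<close>

lemma linear_qmult: "linear ((\<odot>) p)"
  using bilinear_qmult by (simp add: bilinear_def)

lemma qmult_algebra:
  "p \<odot> (x + y) = p \<odot> x + p \<odot> y" "p \<odot> (x - y) = p \<odot> x - p \<odot> y" "p \<odot> (- x) = - (p \<odot> x)"
  "p \<odot> 0 = 0"
  using linear_qmult[of p] by (simp_all add: linear_add linear_diff linear_neg linear_0)

lemma continuous_on_qmult [continuous_intros]:
  "continuous_on S f \<Longrightarrow> continuous_on S g \<Longrightarrow> continuous_on S (\<lambda>x. f x \<odot> g x)"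
  by (rule bounded_bilinear.continuous_on[OF bilinear_conv_bounded_bilinear[THEN iffD1, OF bilinear_qmult]])

lemma norm_qconj [simp]: "norm (qconj q) = norm q"
proof -
  have "(norm (qconj q))\<^sup>2 = (norm q)\<^sup>2"
    by (simp add: norm_quat_square qconj_def)
  then show ?thesis
    by (simp add: power2_eq_iff_nonneg)
qed

lemma qconj_eq_0_iff [simp]: "qconj q = 0 \<longleftrightarrow> q = 0"
  by (metis norm_eq_zero norm_qconj)

lemma linear_qconj: "linear qconj"
  by (auto simp: linear_iff quat_eq_iff qconj_def)

lemma continuous_on_qconj [continuous_intros]:
  "continuous_on S f \<Longrightarrow> continuous_on S (\<lambda>x. qconj (f x))"
  by (rule bounded_linear.continuous_on[OF linear_conv_bounded_linear[THEN iffD1, OF linear_qconj]])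

lemma continuous_on_qinv [continuous_intros]:
  "continuous_on S f \<Longrightarrow> (\<And>x. x \<in> S \<Longrightarrow> f x \<noteq> 0) \<Longrightarrow> continuous_on S (\<lambda>x. qinv (f x))"
  unfolding qinv_def by (intro continuous_intros) auto

lemma norm_qinv: "norm (qinv q) = 1 / norm q"
  by (simp add: qinv_def power2_eq_square)

lemma qinv_eq_0_iff [simp]: "qinv q = 0 \<longleftrightarrow> q = 0"
  by (metis norm_eq_zero norm_qinv divide_eq_0_iff zero_neq_one)

lemma qinv_unique: "p \<odot> q = qone \<Longrightarrow> qinv p = q"
proof -
  assume pq: "p \<odot> q = qone"
  then have "p \<noteq> 0"
    using qmult_eq_0_iff[of p q] by auto
  then have "q = qinv p \<odot> (p \<odot> q)"
    by (simp add: qmult_assoc[symmetric] qmult_qinv)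
  then show "qinv p = q"
    by (simp add: pq)
qed

lemma qinv_qinv [simp]: "q \<noteq> 0 \<Longrightarrow> qinv (qinv q) = q"
  by (intro qinv_unique qmult_qinv)

lemma qinv_qmult: "p \<noteq> 0 \<Longrightarrow> q \<noteq> 0 \<Longrightarrow> qinv (p \<odot> q) = qinv q \<odot> qinv p"
  by (rule qinv_unique) (metis qmult_assoc qmult_qinv(1) qmult_qone(2))

lemma qmult_qinv_cancel: "p \<noteq> 0 \<Longrightarrow> p \<odot> (qinv p \<odot> q) = q" "p \<noteq> 0 \<Longrightarrow> qinv p \<odot> (p \<odot> q) = q"
  by (simp_all add: qmult_assoc[symmetric] qmult_qinv)

text \<open>This adjoint relation is what puts the conjugate quaternion into the frequency
  domain.\<close>

lemma inner_qmult: "k \<bullet> (a \<odot> x) = (qconj a \<odot> k) \<bullet> x"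
  by (simp add: inner_vec_def sum_4 qmult_def qconj_def algebra_simps)

lemma borel_measurable_U_fun [measurable]:
  "\<phi> \<in> borel_measurable borel \<Longrightarrow> U_fun g \<phi> \<in> borel_measurable borel"
proof -
  assume [measurable]: "\<phi> \<in> borel_measurable borel"
  have [measurable]: "(\<lambda>x. qinv (snd g) \<odot> (x - fst g)) \<in> borel \<rightarrow>\<^sub>M borel"
    by (intro borel_measurable_continuous_onI continuous_intros)
  show ?thesis
    unfolding U_fun_def split_beta by measurable
qed

lemma square_integrable_U_fun:
  "g \<in> carrier Gaff \<Longrightarrow> square_integrable \<phi> \<Longrightarrow> square_integrable (U_fun g \<phi>)"
  using U_fun_L2_eq[of g \<phi> \<phi>] by (simp add: L2_eq_def)

lemma rep_L2_U_C:
  assumes "g \<in> carrier Gaff"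
  shows "AE x in lborel. rep_L2 (U_C g f) x = U_fun g (rep_L2 f) x"
  unfolding U_C_def by (intro rep_abs_L2 square_integrable_U_fun assms square_integrable_rep_L2)

lemma carrier_Gaff_iff [simp]: "(b, a) \<in> carrier Gaff \<longleftrightarrow> a \<noteq> 0"
  by (simp add: Gaff_def)

lemma integral_U_substitution:
  fixes f :: "quat \<Rightarrow> 'b::{banach, second_countable_topology}"
  assumes "a \<noteq> 0" and f: "f \<in> borel_measurable borel"
  shows "(\<integral>x. f (qinv a \<odot> (x - b)) \<partial>lborel) = norm a ^ 4 *\<^sub>R (\<integral>x. f x \<partial>lborel)"
proof -
  \<comment> \<open>Left multiplication by \<open>qinv a\<close> scales norms by 1/|a|, so its
    Jacobian in dimension 4 is |a|^(-4).\<close>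
  have "(\<integral>x. f (- (qinv a \<odot> b) + qinv a \<odot> x) \<partial>lborel)
      = (1 / (1 / norm a) ^ CARD(4)) *\<^sub>R (\<integral>x. f x \<partial>lborel)"
    using assms by (intro integral_similarity linear_qmult) (simp_all add: norm_qmult norm_qinv)
  then show ?thesis
    by (simp add: qmult_algebra power_divide)
qed

text \<open>The prefactor |a|^(-2) enters twice, and the resulting |a|^(-4) cancels the |a|^4 of the
  substitution.\<close>

lemma cinner_U_C:
  assumes "g \<in> carrier Gaff"
  shows "\<langle>U_C g f | U_C g h\<rangle> = \<langle>f | h\<rangle>"
proof -
  obtain b a where g: "g = (b, a)" and a: "a \<noteq> 0"
    using assms by (auto simp: Gaff_def)
  have "\<langle>U_C g f | U_C g h\<rangle> = (\<integral>x. cnj (U_fun g (rep_L2 f) x) * U_fun g (rep_L2 h) x \<partial>lborel)"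
    by (intro cinner_cong rep_L2_U_C assms square_integrable_U_fun square_integrable_rep_L2)
  also have "\<dots> = (\<integral>x. (\<lambda>y. of_real (1 / norm a ^ 4) * (cnj (rep_L2 f y) * rep_L2 h y)) (qinv a \<odot> (x - b)) \<partial>lborel)"
    by (rule Bochner_Integration.integral_cong) (simp_all add: g U_fun_def eval_nat_numeral)
  also have "\<dots> = norm a ^ 4 *\<^sub>R (\<integral>y. of_real (1 / norm a ^ 4) * (cnj (rep_L2 f y) * rep_L2 h y) \<partial>lborel)"
    using square_integrable_mult_measurable[OF square_integrable_rep_L2[of f] square_integrable_rep_L2[of h]]
    by (intro integral_U_substitution a) simp
  also have "\<dots> = \<langle>f | h\<rangle>"
    using a by (simp add: cinner.rep_eq scaleR_conv_of_real del: integral_mult_left_zero integral_mult_right_zero)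
  finally show ?thesis .
qed

lemma clinear_op_U_C:
  assumes "g \<in> carrier Gaff"
  shows "clinear_op (U_C g)"
  unfolding clinear_op_def
proof (intro conjI allI)
  fix f h :: "quat L2" and c
  have "f + h = abs_L2 (\<lambda>x. rep_L2 f x + rep_L2 h x)"
    by (simp add: abs_L2_add square_integrable_rep_L2)
  then have "U_C g (f + h) = abs_L2 (U_fun g (\<lambda>x. rep_L2 f x + rep_L2 h x))"
    using assms by (simp only: U_C_abs_L2 square_integrable_add square_integrable_rep_L2)
  also have "U_fun g (\<lambda>x. rep_L2 f x + rep_L2 h x) = (\<lambda>x. U_fun g (rep_L2 f) x + U_fun g (rep_L2 h) x)"
    by (auto simp: U_fun_def add_divide_distrib split: prod.splits)
  also have "abs_L2 \<dots> = U_C g f + U_C g h"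
    unfolding U_C_def by (intro abs_L2_add square_integrable_U_fun assms square_integrable_rep_L2)
  finally show "U_C g (f + h) = U_C g f + U_C g h" .
  have "c *\<^sub>C f = abs_L2 (\<lambda>x. c * rep_L2 f x)"
    by (simp add: abs_L2_cscale square_integrable_rep_L2)
  then have "U_C g (c *\<^sub>C f) = abs_L2 (U_fun g (\<lambda>x. c * rep_L2 f x))"
    using assms by (simp only: U_C_abs_L2 square_integrable_cmult square_integrable_rep_L2)
  also have "U_fun g (\<lambda>x. c * rep_L2 f x) = (\<lambda>x. c * U_fun g (rep_L2 f) x)"
    by (auto simp: U_fun_def split: prod.splits)
  also have "abs_L2 \<dots> = c *\<^sub>C U_C g f"
    unfolding U_C_def by (intro abs_L2_cscale square_integrable_U_fun assms square_integrable_rep_L2)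
  finally show "U_C g (c *\<^sub>C f) = c *\<^sub>C U_C g f" .
qed

text \<open>Inversion reverses a product of quaternions, so composing the two substitutions
  reproduces the group law in the right order.\<close>

lemma U_C_mult:
  assumes "g \<in> carrier Gaff" "h \<in> carrier Gaff"
  shows "U_C (g \<otimes>\<^bsub>Gaff\<^esub> h) f = U_C g (U_C h f)"
proof -
  obtain b a b' a' where gh: "g = (b, a)" "h = (b', a')" and a: "a \<noteq> 0" "a' \<noteq> 0"
    using assms by (auto simp: Gaff_def)
  have mult: "g \<otimes>\<^bsub>Gaff\<^esub> h = (b + a \<odot> b', a \<odot> a')"
    by (simp add: Gaff_def gh)
  have "U_fun (g \<otimes>\<^bsub>Gaff\<^esub> h) \<phi> = U_fun g (U_fun h \<phi>)" for \<phi>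
    unfolding mult using a
    by (auto simp: gh U_fun_def norm_qmult qinv_qmult qmult_assoc qmult_algebra qmult_qinv_cancel
        power_mult_distrib diff_diff_eq)
  then show ?thesis
    using assms U_C_abs_L2[of g "U_fun h (rep_L2 f)"]
    by (simp add: U_C_def[of h] U_C_def[of "g \<otimes>\<^bsub>Gaff\<^esub> h"] square_integrable_U_fun square_integrable_rep_L2)
qed

lemma qinv_qone [simp]: "qinv qone = qone"
  by (rule qinv_unique) simp

lemma norm_qone [simp]: "norm qone = 1"
proof -
  have "(norm qone)\<^sup>2 = 1"
    by (simp add: norm_quat_square qone_def)
  then show ?thesis
    using power2_eq_iff_nonneg[of "norm qone" 1] by simp
qed

lemma U_C_one: "U_C \<one>\<^bsub>Gaff\<^esub> f = f"
  by (simp add: U_C_def U_fun_def Gaff_def)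

lemma U_C_inv:
  assumes "g \<in> carrier Gaff"
  shows "U_C g (U_C (inv\<^bsub>Gaff\<^esub> g) f) = f" "U_C (inv\<^bsub>Gaff\<^esub> g) (U_C g f) = f"
  using assms group_Gaff
  by (simp_all add: U_C_mult[symmetric] U_C_one group.r_inv group.l_inv group.inv_closed)

lemma unitary_op_U_C: "g \<in> carrier Gaff \<Longrightarrow> unitary_op (U_C g)"
  unfolding unitary_op_def using clinear_op_U_C cinner_U_C U_C_inv(1) by (metis surjI)

lemma U_C_hom: "U_C \<in> hom Gaff unitary_group"
  by (rule homI) (auto simp: unitary_group_def unitary_op_U_C U_C_mult)

section \<open>Unitary operators and their adjoints\<close>

lemma unitary_op_add: "unitary_op T \<Longrightarrow> T (f + g) = T f + T g"
  by (simp add: unitary_op_def clinear_op_def)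

lemma unitary_op_cscale: "unitary_op T \<Longrightarrow> T (c *\<^sub>C f) = c *\<^sub>C T f"
  by (simp add: unitary_op_def clinear_op_def)

lemma unitary_op_cinner: "unitary_op T \<Longrightarrow> \<langle>T f | T g\<rangle> = \<langle>f | g\<rangle>"
  by (simp add: unitary_op_def)

lemma unitary_op_diff: "unitary_op T \<Longrightarrow> T (f - g) = T f - T g"
  by (simp add: unitary_op_add unitary_op_cscale minus_L2_def uminus_L2_def)

lemma norm_unitary_op: "unitary_op T \<Longrightarrow> norm (T f) = norm f"
  by (simp add: norm_L2_def unitary_op_cinner)

lemma dist_unitary_op: "unitary_op T \<Longrightarrow> dist (T f) (T g) = dist f g"
  by (simp add: dist_norm unitary_op_diff[symmetric] norm_unitary_op)

lemma tendsto_unitary_op: "unitary_op T \<Longrightarrow> (X \<longlongrightarrow> f) F \<Longrightarrow> ((\<lambda>n. T (X n)) \<longlongrightarrow> T f) F"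
  unfolding tendsto_iff by (simp add: dist_unitary_op)

text \<open>Since \<open>cadjoint\<close> is a definite description, the inverse of \<open>T\<close>
  is first shown to be the only operator that fits it.\<close>

lemma cadjoint_unitary:
  assumes "unitary_op T"
  shows "\<langle>f | cadjoint T g\<rangle> = \<langle>T f | g\<rangle>"
proof -
  have surj: "T (inv_into UNIV T g) = g" for g
    using assms by (simp add: unitary_op_def surj_f_inv_f)
  have "cadjoint T = inv_into UNIV T"
    unfolding cadjoint_def
  proof (rule the_equality)
    show 1: "\<forall>f g. \<langle>T f | g\<rangle> = \<langle>f | inv_into UNIV T g\<rangle>"
      by (metis assms surj unitary_op_cinner)
    fix S
    assume "\<forall>f g. \<langle>T f | g\<rangle> = \<langle>f | S g\<rangle>"
    then show "S = inv_into UNIV T"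
      using 1 by (intro ext cinner_ext) (metis cinner_commute)
  qed
  then show ?thesis
    by (metis assms surj unitary_op_cinner)
qed

section \<open>Gaussians\<close>

text \<open>The half in the exponent makes \<open>gauss 1\<close> a fixed point of the unitary
  Fourier transform on R^4; the total mass is left unnormalized.\<close>

definition gauss :: "real \<Rightarrow> 'a::real_inner \<Rightarrow> real" where
  "gauss s x = exp (- (s * (norm x)\<^sup>2 / 2))"

lemma gauss_pos [simp]: "gauss s x > 0" and gauss_nonneg [simp]: "gauss s x \<ge> 0"
  by (simp_all add: gauss_def)

lemma gauss_le_1: "s \<ge> 0 \<Longrightarrow> gauss s x \<le> 1"
  by (simp add: gauss_def)

lemma borel_measurable_gauss [measurable]:
  "gauss s \<in> borel_measurable (borel :: 'a::euclidean_space measure)"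
  unfolding gauss_def by measurable

lemma continuous_on_gauss [continuous_intros]:
  "continuous_on S f \<Longrightarrow> continuous_on S (\<lambda>x. gauss s (f x))"
  unfolding gauss_def by (intro continuous_intros) auto

lemma gauss_scaleR: "gauss s (r *\<^sub>R x) = gauss (s * r\<^sup>2) x"
  by (simp add: gauss_def power_mult_distrib mult.assoc)

text \<open>A rescaling of the characteristic function of the standard normal distribution.\<close>

lemma gaussian_integral_real:
  fixes s t :: real
  assumes "s > 0"
  shows "integrable lborel (\<lambda>x. exp (- (\<i> * of_real (t * x))) * of_real (gauss s x))" (is ?I)
    and "(\<integral>x. exp (- (\<i> * of_real (t * x))) * of_real (gauss s x) \<partial>lborel)
      = of_real (sqrt (2 * pi / s) * exp (- (t\<^sup>2 / (2 * s))))" (is ?E)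
proof -
  define r where "r = sqrt s"
  have r: "r > 0" "r\<^sup>2 = s"
    using assms by (simp_all add: r_def)
  \<comment> \<open>The frequency \<open>- (t / r)\<close> becomes \<open>- t\<close> once
    \<open>r * x\<close> is substituted for the variable.\<close>
  define f where "f x = std_normal_density x *\<^sub>R iexp (- (t / r) * x)" for x
  have f_int: "integrable lborel f"
  proof (rule Bochner_Integration.integrable_bound)
    show "integrable lborel std_normal_density"
      by simp
    show "f \<in> borel_measurable lborel"
      unfolding f_def by measurable
  qed (simp add: f_def)
  have eq: "f (r * x) = of_real (1 / sqrt (2 * pi)) * (exp (- (\<i> * of_real (t * x))) * of_real (gauss s x))" for x
    using r by (simp add: f_def std_normal_density_def gauss_def scaleR_conv_of_real
        power_mult_distrib exp_of_real)
  have "integrable lborel (\<lambda>x. f (0 + r * x))"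
    using f_int r(1) by (subst lborel_integrable_real_affine_iff) auto
  then have "integrable lborel (\<lambda>x. of_real (sqrt (2 * pi)) * f (r * x))"
    by simp
  then show ?I
    unfolding eq by simp
  have "(\<integral>x. f x \<partial>lborel) = char std_normal_distribution (- (t / r))"
    unfolding char_def f_def by (subst integral_density) auto
  also have "\<dots> = of_real (exp (- (t\<^sup>2 / (2 * s))))"
    using r by (simp add: char_std_normal_distribution power_divide mult.commute)
  finally have "of_real (exp (- (t\<^sup>2 / (2 * s)))) = \<bar>r\<bar> *\<^sub>R (\<integral>x. f (0 + r * x) \<partial>lborel)"
    using lborel_integral_real_affine[of r f 0] r by simp
  also have "(\<integral>x. f (0 + r * x) \<partial>lborel) = of_real (1 / sqrt (2 * pi)) *
      (\<integral>x. exp (- (\<i> * of_real (t * x))) * of_real (gauss s x) \<partial>lborel)"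
    by (simp add: eq del: of_real_divide)
  finally have E: "of_real (exp (- (t\<^sup>2 / (2 * s)))) = of_real (r / sqrt (2 * pi)) *
      (\<integral>x. exp (- (\<i> * of_real (t * x))) * of_real (gauss s x) \<partial>lborel)"
    using r by (simp add: scaleR_conv_of_real)
  have "of_real (sqrt (2 * pi / s)) * complex_of_real (exp (- (t\<^sup>2 / (2 * s)))) = of_real (sqrt (2 * pi / s) * (r / sqrt (2 * pi))) *
      (\<integral>x. exp (- (\<i> * of_real (t * x))) * of_real (gauss s x) \<partial>lborel)"
    unfolding E by (simp only: of_real_mult mult.assoc)
  moreover have "sqrt (2 * pi / s) * (r / sqrt (2 * pi)) = 1"
    using assms by (simp add: r_def real_sqrt_divide)
  ultimately show ?E
    by (simp only: of_real_mult of_real_1 mult_1_left)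
qed

text \<open>Both the character and the Gaussian are products over the coordinates, so the integral
  factors into one-dimensional ones.\<close>

lemma gaussian_integral:
  fixes k :: "'a::euclidean_space"
  assumes "s > 0"
  shows "integrable lborel (\<lambda>x. exp (- (\<i> * of_real (k \<bullet> x))) * of_real (gauss s x))" (is ?I)
    and "(\<integral>x. exp (- (\<i> * of_real (k \<bullet> x))) * of_real (gauss s x) \<partial>lborel)
      = of_real (sqrt (2 * pi / s) ^ DIM('a) * exp (- ((norm k)\<^sup>2 / (2 * s))))" (is ?E)
proof -
  interpret product_sigma_finite "\<lambda>_::'a. lborel :: real measure"
    by standard
  define h where "h b y = exp (- (\<i> * of_real ((k \<bullet> b) * y))) * of_real (gauss s y)" for b :: 'a and y :: real
  define F where "F x = exp (- (\<i> * of_real (k \<bullet> x))) * of_real (gauss s x)" for x :: 'a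
  have [measurable]: "F \<in> borel_measurable borel"
    unfolding F_def by measurable
  have F_eq: "F (\<Sum>b\<in>Basis. y b *\<^sub>R b) = (\<Prod>b\<in>Basis. h b (y b))" for y
  proof -
    have "k \<bullet> (\<Sum>b\<in>Basis. y b *\<^sub>R b) = (\<Sum>b\<in>Basis. (k \<bullet> b) * y b)"
      by (simp add: inner_sum_right mult.commute)
    moreover have "(norm (\<Sum>b\<in>Basis. y b *\<^sub>R b))\<^sup>2 = (\<Sum>b\<in>Basis. (y b)\<^sup>2)"
      by (subst euclidean_inner[of "\<Sum>b\<in>Basis. y b *\<^sub>R b" "\<Sum>b\<in>Basis. y b *\<^sub>R b", folded power2_norm_eq_inner])
        (simp add: power2_eq_square)
    ultimately show ?thesis
      by (simp add: F_def h_def gauss_def prod.distrib sum_distrib_left sum_divide_distrib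
          exp_sum sum_negf[symmetric])
  qed
  have h_int: "integrable lborel (h b)" for b
    unfolding h_def using gaussian_integral_real(1)[OF assms] .
  have [measurable]: "(\<lambda>f. \<Sum>b\<in>Basis. f b *\<^sub>R b) \<in> (\<Pi>\<^sub>M b\<in>Basis. lborel) \<rightarrow>\<^sub>M (borel :: 'a measure)"
    by measurable
  have "integrable (\<Pi>\<^sub>M b\<in>Basis. lborel) (\<lambda>y. \<Prod>b\<in>Basis. h b (y b))"
    by (rule product_integrable_prod) (auto simp: h_int)
  then have "integrable lborel F"
    by (subst lborel_eq) (simp add: integrable_distr_eq F_eq)
  then show ?I
    by (simp add: F_def[abs_def])
  have "(\<integral>x. F x \<partial>lborel) = (\<integral>y. (\<Prod>b\<in>Basis. h b (y b)) \<partial>(\<Pi>\<^sub>M b\<in>Basis. lborel))"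
    by (subst lborel_eq) (simp add: integral_distr F_eq)
  also have "\<dots> = (\<Prod>b\<in>Basis. \<integral>y. h b y \<partial>lborel)"
    by (rule product_integral_prod) (auto simp: h_int)
  also have "\<dots> = (\<Prod>b\<in>Basis. of_real (sqrt (2 * pi / s) * exp (- ((k \<bullet> b)\<^sup>2 / (2 * s)))))"
    unfolding h_def using gaussian_integral_real(2)[OF assms] by simp
  also have "\<dots> = of_real (sqrt (2 * pi / s) ^ DIM('a) * exp (- (\<Sum>b\<in>Basis. (k \<bullet> b)\<^sup>2 / (2 * s))))"
    by (simp only: of_real_prod[symmetric] prod.distrib prod_constant sum_negf[symmetric]
        exp_sum[OF finite_Basis])
  also have "(\<Sum>b\<in>Basis. (k \<bullet> b)\<^sup>2 / (2 * s)) = (norm k)\<^sup>2 / (2 * s)"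
    unfolding power2_norm_eq_inner
    by (subst euclidean_inner) (simp add: power2_eq_square sum_divide_distrib)
  finally show ?E
    by (simp add: F_def)
qed

lemma integrable_gauss: "s > 0 \<Longrightarrow> integrable lborel (gauss s :: 'a::euclidean_space \<Rightarrow> real)"
  using gaussian_integral(1)[of s "0 :: 'a", THEN integrable_norm] by simp

lemma integral_gauss:
  "s > 0 \<Longrightarrow> (\<integral>x. gauss s (x::'a::euclidean_space) \<partial>lborel) = sqrt (2 * pi / s) ^ DIM('a)"
  using gaussian_integral(2)[of s "0 :: 'a"]
  by (simp del: of_real_mult of_real_power) 

section \<open>The Fourier integral of integrable functions\<close>

text \<open>Packages the absolute integrability that Fubini's theorem asks for. The intended case is
  Gaussian decay in the frequency and an integrable function of the position.\<close>

lemma Fubini_dominated: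
  fixes f :: "'a::euclidean_space \<Rightarrow> 'b::euclidean_space \<Rightarrow> complex"
  assumes [measurable]: "(\<lambda>(x, y). f x y) \<in> borel_measurable (borel \<Otimes>\<^sub>M borel)"
    and bound: "\<And>x y. cmod (f x y) \<le> g x * h y"
    and int: "integrable lborel g" "integrable lborel h"
  shows "(\<integral>x. \<integral>y. f x y \<partial>lborel \<partial>lborel) = (\<integral>y. \<integral>x. f x y \<partial>lborel \<partial>lborel)"
proof -
  have fy: "integrable lborel (f x)" for x
    by (rule Bochner_Integration.integrable_bound[OF integrable_mult_right[OF int(2), of "g x"]])
      (use bound[of x] in \<open>auto intro: order_trans[OF _ abs_ge_self]\<close>)
  have "integrable (lborel \<Otimes>\<^sub>M lborel) (\<lambda>(x, y). f x y)"
  proof (rule lborel_pair.Fubini_integrable)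
    show "integrable lborel (\<lambda>x. \<integral>y. norm (case (x, y) of (x, y) \<Rightarrow> f x y) \<partial>lborel)"
    proof (rule Bochner_Integration.integrable_bound[OF integrable_mult_left[OF int(1)]])
      show "AE x in lborel. norm (\<integral>y. norm (case (x, y) of (x, y) \<Rightarrow> f x y) \<partial>lborel)
          \<le> norm (g x * (\<integral>y. h y \<partial>lborel))"
      proof (rule AE_I2)
        fix x
        have "(\<integral>y. norm (f x y) \<partial>lborel) \<le> (\<integral>y. g x * h y \<partial>lborel)"
          using bound fy int(2) by (intro integral_mono) auto
        then show "norm (\<integral>y. norm (case (x, y) of (x, y) \<Rightarrow> f x y) \<partial>lborel)
          \<le> norm (g x * (\<integral>y. h y \<partial>lborel))"
          by simp
      qed
    qed measurable
  qed (use fy in \<open>auto\<close>)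
  then show ?thesis
    by (rule lborel_pair.Fubini_integral[symmetric])
qed

lemma borel_measurable_fourier_integral [measurable]:
  assumes [measurable]: "u \<in> borel_measurable borel"
  shows "fourier_integral u \<in> borel_measurable borel"
  unfolding fourier_integral_def by measurable

lemma integrable_fourier_kernel:
  "integrable lborel u \<Longrightarrow> integrable lborel (\<lambda>x. exp (- (\<i> * of_real (k \<bullet> x))) * u x)"
  by (rule Bochner_Integration.integrable_bound[of _ u]) (auto simp: norm_mult)

lemma norm_fourier_integral_le:
  "cmod (fourier_integral u k) \<le> 1 / (2 * pi)\<^sup>2 * (\<integral>x. cmod (u x) \<partial>lborel)"
proof -
  have "cmod (\<integral>x. exp (- (\<i> * of_real (k \<bullet> x))) * u x \<partial>lborel)
      \<le> (\<integral>x. cmod (exp (- (\<i> * of_real (k \<bullet> x))) * u x) \<partial>lborel)"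
    by (rule integral_norm_bound)
  then show ?thesis
    by (simp add: fourier_integral_def norm_mult norm_divide norm_power divide_right_mono)
qed

text \<open>Regularized Fourier inversion: the transform of the Gaussian is an approximate identity.
  Rescaling by \<open>sqrt s\<close> moves \<open>s\<close> from the kernel into the argument of
  \<open>u\<close>, where a limit is easier to take, and all powers of \<open>2 * pi\<close> and
  \<open>s\<close> cancel.\<close>

lemma integral_gauss_fourier_integral:
  assumes u: "integrable lborel u" and s: "s > 0"
  shows "(\<integral>k. of_real (gauss s k) * exp (\<i> * of_real (k \<bullet> y)) * fourier_integral u k \<partial>lborel)
    = (\<integral>w. of_real (gauss 1 w) * u (y + sqrt s *\<^sub>R w) \<partial>lborel)"
proof -
  have [measurable]: "u \<in> borel_measurable borel"
    using u by (auto dest: borel_measurable_integrable)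
  define c where "c = complex_of_real (1 / (2 * pi)\<^sup>2)"
  define f where "f k x = of_real (gauss s k) * exp (\<i> * of_real (k \<bullet> y)) * (exp (- (\<i> * of_real (k \<bullet> x))) * u x)"
    for k x :: quat
  have "(\<integral>k. of_real (gauss s k) * exp (\<i> * of_real (k \<bullet> y)) * fourier_integral u k \<partial>lborel)
      = (\<integral>k. c * (\<integral>x. f k x \<partial>lborel) \<partial>lborel)"
  proof (rule Bochner_Integration.integral_cong[OF refl])
    show "of_real (gauss s k) * exp (\<i> * of_real (k \<bullet> y)) * fourier_integral u k = c * (\<integral>x. f k x \<partial>lborel)" for k
      unfolding f_def c_def fourier_integral_def integral_mult_right_zero by (simp only: mult_ac)
  qed
  also have "\<dots> = c * (\<integral>k. \<integral>x. f k x \<partial>lborel \<partial>lborel)"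
    by simp
  also have "(\<integral>k. \<integral>x. f k x \<partial>lborel \<partial>lborel) = (\<integral>x. \<integral>k. f k x \<partial>lborel \<partial>lborel)"
  proof (rule Fubini_dominated[of f "gauss s" "\<lambda>x. cmod (u x)"])
    show "(\<lambda>(k, x). f k x) \<in> borel_measurable (borel \<Otimes>\<^sub>M borel)"
      unfolding f_def by measurable
  qed (use u in \<open>auto simp: f_def norm_mult integrable_gauss s\<close>)
  also have "\<dots> = (\<integral>x. of_real ((2 * pi / s)\<^sup>2) * (of_real (gauss (1/s) (x - y)) * u x) \<partial>lborel)"
  proof (rule Bochner_Integration.integral_cong[OF refl])
    fix x
    have "(\<integral>k. f k x \<partial>lborel)
        = (\<integral>k. u x * (exp (- (\<i> * of_real ((x - y) \<bullet> k))) * of_real (gauss s k)) \<partial>lborel)"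
    proof (rule Bochner_Integration.integral_cong[OF refl])
      fix k
      have "(x - y) \<bullet> k = k \<bullet> x - k \<bullet> y"
        by (simp add: inner_commute[of "x - y" k] inner_diff_right)
      then have "- (\<i> * of_real ((x - y) \<bullet> k)) = \<i> * of_real (k \<bullet> y) + - (\<i> * of_real (k \<bullet> x))"
        by (simp only: of_real_diff) (simp add: algebra_simps)
      then have "exp (- (\<i> * of_real ((x - y) \<bullet> k))) = exp (\<i> * of_real (k \<bullet> y)) * exp (- (\<i> * of_real (k \<bullet> x)))"
        by (simp only: exp_add)
      then show "f k x = u x * (exp (- (\<i> * of_real ((x - y) \<bullet> k))) * of_real (gauss s k))"
        by (simp add: f_def)
    qed
    also have "\<dots> = u x * of_real (sqrt (2 * pi / s) ^ DIM(quat) * exp (- ((norm (x - y))\<^sup>2 / (2 * s))))"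
      by (simp only: integral_mult_right_zero gaussian_integral(2)[OF s])
    also have "sqrt (2 * pi / s) ^ DIM(quat) = (2 * pi / s)\<^sup>2"
      using s power_mult[of "sqrt (2 * pi / s)" 2 2] by simp
    also have "exp (- ((norm (x - y))\<^sup>2 / (2 * s))) = gauss (1/s) (x - y)"
      by (simp add: gauss_def)
    finally show "(\<integral>k. f k x \<partial>lborel) = of_real ((2 * pi / s)\<^sup>2) * (of_real (gauss (1/s) (x - y)) * u x)"
      by (simp add: mult_ac)
  qed
  also have "\<dots> = of_real ((2 * pi / s)\<^sup>2) * (\<integral>x. of_real (gauss (1/s) (x - y)) * u x \<partial>lborel)"
    by (simp only: integral_mult_right_zero)
  also have "(\<integral>x. of_real (gauss (1/s) (x - y)) * u x \<partial>lborel)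
      = s\<^sup>2 *\<^sub>R (\<integral>w. of_real (gauss 1 w) * u (y + sqrt s *\<^sub>R w) \<partial>lborel)"
  proof -
    have "(\<integral>w. of_real (gauss (1/s) ((y + sqrt s *\<^sub>R w) - y)) * u (y + sqrt s *\<^sub>R w) \<partial>lborel)
        = (1 / sqrt s ^ CARD(4)) *\<^sub>R (\<integral>x. of_real (gauss (1/s) (x - y)) * u x \<partial>lborel)"
      using s by (intro integral_similarity[of "\<lambda>w. sqrt s *\<^sub>R w"]) (auto intro: linear_scale_self)
    moreover have "sqrt s ^ CARD(4) = s\<^sup>2"
      using s power_mult[of "sqrt s" 2 2] by simp
    moreover have "gauss (1/s) (sqrt s *\<^sub>R w) = gauss 1 w" for w :: quat
      using s by (simp add: gauss_scaleR)
    ultimately show ?thesis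
      using s by simp
  qed
  finally show ?thesis
    using s by (simp add: c_def scaleR_conv_of_real field_simps)
qed

lemma borel_measurable_correlation [measurable]:
  fixes u v :: "quat \<Rightarrow> complex"
  assumes [measurable]: "u \<in> borel_measurable borel" "v \<in> borel_measurable borel"
  shows "(\<lambda>z. \<integral>y. cnj (v y) * u (y + z) \<partial>lborel) \<in> borel_measurable borel"
proof -
  note [measurable] = cnj_measurable
  show ?thesis by measurable
qed

text \<open>Regularized Plancherel: without the Gaussian the frequency integral need not converge
  absolutely. The transform of \<open>v\<close> is expanded as an integral over \<open>y\<close>,
  and regularized inversion is applied for each fixed \<open>y\<close>.\<close>

lemma integral_fourier_product_gauss:
  assumes u: "integrable lborel u" and v: "integrable lborel v" and s: "s > 0"
  shows "(\<integral>k. of_real (gauss s k) * (fourier_integral u k * cnj (fourier_integral v k)) \<partial>lborel)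
    = of_real (1 / (2 * pi)\<^sup>2) *
      (\<integral>w. of_real (gauss 1 w) * (\<integral>y. cnj (v y) * u (y + sqrt s *\<^sub>R w) \<partial>lborel) \<partial>lborel)"
proof -
  have [measurable]: "u \<in> borel_measurable borel" "v \<in> borel_measurable borel"
    using u v by (auto dest: borel_measurable_integrable)
  note [measurable] = cnj_measurable
  define c where "c = complex_of_real (1 / (2 * pi)\<^sup>2)"
  define B where "B = 1 / (2 * pi)\<^sup>2 * (\<integral>x. cmod (u x) \<partial>lborel)"
  define f where "f k y = of_real (gauss s k) * fourier_integral u k * (exp (\<i> * of_real (k \<bullet> y)) * cnj (v y))"
    for k y :: quat
  have "(\<integral>k. of_real (gauss s k) * (fourier_integral u k * cnj (fourier_integral v k)) \<partial>lborel)
      = (\<integral>k. c * (\<integral>y. f k y \<partial>lborel) \<partial>lborel)"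
  proof (rule Bochner_Integration.integral_cong[OF refl])
    fix k :: quat
    have "cnj (fourier_integral v k) = c * (\<integral>y. exp (\<i> * of_real (k \<bullet> y)) * cnj (v y) \<partial>lborel)"
      unfolding fourier_integral_def c_def complex_cnj_mult Bochner_Integration.integral_cnj[symmetric]
      by (simp add: exp_cnj)
    then show "of_real (gauss s k) * (fourier_integral u k * cnj (fourier_integral v k)) = c * (\<integral>y. f k y \<partial>lborel)"
      unfolding f_def integral_mult_right_zero by (simp only: mult_ac)
  qed
  also have "\<dots> = c * (\<integral>k. \<integral>y. f k y \<partial>lborel \<partial>lborel)"
    by simp
  also have "(\<integral>k. \<integral>y. f k y \<partial>lborel \<partial>lborel) = (\<integral>y. \<integral>k. f k y \<partial>lborel \<partial>lborel)"
  proof (rule Fubini_dominated[of f "\<lambda>k. gauss s k * B" "\<lambda>y. cmod (v y)"])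
    show "(\<lambda>(k, y). f k y) \<in> borel_measurable (borel \<Otimes>\<^sub>M borel)"
      unfolding f_def by measurable
    show "cmod (f k y) \<le> gauss s k * B * cmod (v y)" for k y
      using norm_fourier_integral_le[of u k, folded B_def]
      by (simp add: f_def norm_mult mult_right_mono)
  qed (use v in \<open>auto simp: integrable_gauss s\<close>)
  also have "\<dots> = (\<integral>y. cnj (v y) * (\<integral>w. of_real (gauss 1 w) * u (y + sqrt s *\<^sub>R w) \<partial>lborel) \<partial>lborel)"
  proof (rule Bochner_Integration.integral_cong[OF refl])
    fix y
    have "(\<integral>k. f k y \<partial>lborel)
      = (\<integral>k. cnj (v y) * (of_real (gauss s k) * exp (\<i> * of_real (k \<bullet> y)) * fourier_integral u k) \<partial>lborel)"
      by (simp add: f_def mult_ac)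
    then show "(\<integral>k. f k y \<partial>lborel) = cnj (v y) * (\<integral>w. of_real (gauss 1 w) * u (y + sqrt s *\<^sub>R w) \<partial>lborel)"
      by (simp only: integral_mult_right_zero integral_gauss_fourier_integral[OF u s])
  qed
  also have "\<dots> = (\<integral>y. \<integral>w. of_real (gauss 1 w) * (cnj (v y) * u (y + sqrt s *\<^sub>R w)) \<partial>lborel \<partial>lborel)"
    by (simp add: mult_ac flip: integral_mult_right_zero)
  also have "\<dots> = (\<integral>w. \<integral>y. of_real (gauss 1 w) * (cnj (v y) * u (y + sqrt s *\<^sub>R w)) \<partial>lborel \<partial>lborel)"
  proof -
    \<comment> \<open>No product bound is at hand here, because \<open>u\<close> couples both
      variables. With the Gaussian bounded by 1, translation invariance makes the
      \<open>w\<close>-integral of the modulus of \<open>u\<close> a constant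
      \<open>A\<close>.\<close>
    define h where "h y w = of_real (gauss 1 w) * (cnj (v y) * u (y + sqrt s *\<^sub>R w))" for y w :: quat
    have [measurable]: "(\<lambda>(y, w). h y w) \<in> borel_measurable (lborel \<Otimes>\<^sub>M lborel)"
      unfolding h_def by measurable
    define A where "A = (\<integral>w. cmod (u w) \<partial>lborel) / sqrt s ^ CARD(4)"
    have u': "integrable lborel (\<lambda>w. u (y + sqrt s *\<^sub>R w))" for y
      using s u by (intro integrable_similarity[of "\<lambda>w. sqrt s *\<^sub>R w" "sqrt s"]) (auto intro: linear_scale_self)
    have nu': "(\<integral>w. cmod (u (y + sqrt s *\<^sub>R w)) \<partial>lborel) = A" for y
      using s integral_similarity[of "\<lambda>w. sqrt s *\<^sub>R w" "sqrt s" "\<lambda>w. cmod (u w)" y]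
      by (simp add: A_def linear_scale_self)
    have hle: "cmod (h y w) \<le> cmod (v y) * cmod (u (y + sqrt s *\<^sub>R w))" for y w
      using gauss_le_1[of 1 w] by (simp add: h_def norm_mult mult_left_le_one_le)
    have hint: "integrable lborel (h y)" for y
      by (rule Bochner_Integration.integrable_bound[OF integrable_mult_right[OF integrable_norm[OF u'[of y]], of "cmod (v y)"]])
        (use hle[of y] in \<open>auto simp: h_def\<close>)
    have "integrable (lborel \<Otimes>\<^sub>M lborel) (\<lambda>(y, w). h y w)"
    proof (rule lborel_pair.Fubini_integrable)
      show "integrable lborel (\<lambda>y. \<integral>w. norm (case (y, w) of (y, w) \<Rightarrow> h y w) \<partial>lborel)"
      proof (rule Bochner_Integration.integrable_bound[OF integrable_mult_left[OF integrable_norm[OF v], of A]])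
        show "AE y in lborel. norm (\<integral>w. norm (case (y, w) of (y, w) \<Rightarrow> h y w) \<partial>lborel) \<le> norm (norm (v y) * A)"
        proof (rule AE_I2)
          fix y
          have "(\<integral>w. norm (h y w) \<partial>lborel) \<le> (\<integral>w. cmod (v y) * cmod (u (y + sqrt s *\<^sub>R w)) \<partial>lborel)"
            using hint hle u' by (intro integral_mono) auto
          also have "\<dots> = cmod (v y) * A"
            by (simp add: nu')
          finally show "norm (\<integral>w. norm (case (y, w) of (y, w) \<Rightarrow> h y w) \<partial>lborel) \<le> norm (norm (v y) * A)"
            by simp
        qed
      qed measurable
    qed (use hint in auto)
    then show ?thesis
      unfolding h_def by (rule lborel_pair.Fubini_integral[symmetric])
  qed
  also have "\<dots> = (\<integral>w. of_real (gauss 1 w) * (\<integral>y. cnj (v y) * u (y + sqrt s *\<^sub>R w) \<partial>lborel) \<partial>lborel)"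
    by (simp only: integral_mult_right_zero)
  finally show ?thesis
    by (simp add: c_def)
qed

text \<open>Boundedness and continuity are asked of the correlation rather than of \<open>u\<close>
  or \<open>v\<close>, so that two cases fit: a bounded continuous \<open>v\<close>, for
  injectivity, and \<open>v = u\<close> in L^2, for Plancherel. The mass
  \<open>(2 * pi)\<^sup>2\<close> of the Gaussian cancels the prefactor.\<close>

lemma fourier_product_gauss_tendsto:
  fixes u v :: "quat \<Rightarrow> complex"
  assumes u: "integrable lborel u" and v: "integrable lborel v"
    and bound: "\<And>z. cmod (\<integral>y. cnj (v y) * u (y + z) \<partial>lborel) \<le> B"
    and cont: "isCont (\<lambda>z. \<integral>y. cnj (v y) * u (y + z) \<partial>lborel) 0"
  shows "(\<lambda>n. \<integral>k. of_real (gauss (1 / Suc n) k) * (fourier_integral u k * cnj (fourier_integral v k)) \<partial>lborel)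
    \<longlonglongrightarrow> (\<integral>y. cnj (v y) * u y \<partial>lborel)"
proof -
  have [measurable]: "u \<in> borel_measurable borel" "v \<in> borel_measurable borel"
    using u v by (auto dest: borel_measurable_integrable)
  define c where "c z = (\<integral>y. cnj (v y) * u (y + z) \<partial>lborel)" for z
  have [measurable]: "c \<in> borel_measurable borel"
    unfolding c_def by measurable
  have lim: "(\<lambda>n. \<integral>w. of_real (gauss 1 w) * c (sqrt (1 / Suc n) *\<^sub>R w) \<partial>lborel)
      \<longlonglongrightarrow> (\<integral>w. of_real (gauss 1 (w::quat)) * c 0 \<partial>lborel)"
  proof (rule integral_dominated_convergence)
    show "integrable lborel (\<lambda>w :: quat. gauss 1 w * B)"
      by (simp add: integrable_gauss)
    show "AE w in lborel. (\<lambda>n. of_real (gauss 1 w) * c (sqrt (1 / Suc n) *\<^sub>R w)) \<longlonglongrightarrow> of_real (gauss 1 w) * c 0"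
    proof (rule AE_I2)
      fix w :: quat
      have "(\<lambda>n. sqrt (1 / Suc n) *\<^sub>R w) \<longlonglongrightarrow> sqrt 0 *\<^sub>R w"
        by (intro tendsto_intros LIMSEQ_Suc[OF lim_1_over_n])
      then have "(\<lambda>n. sqrt (1 / Suc n) *\<^sub>R w) \<longlonglongrightarrow> 0"
        by simp
      then have "(\<lambda>n. c (sqrt (1 / Suc n) *\<^sub>R w)) \<longlonglongrightarrow> c 0"
        using isCont_tendsto_compose[OF cont] by (simp add: c_def)
      then show "(\<lambda>n. of_real (gauss 1 w) * c (sqrt (1 / Suc n) *\<^sub>R w)) \<longlonglongrightarrow> of_real (gauss 1 w) * c 0"
        by (rule tendsto_mult_left)
    qed
    show "AE w in lborel. norm (of_real (gauss 1 w) * c (sqrt (1 / Suc n) *\<^sub>R w)) \<le> gauss 1 w * B" for n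
      using bound by (auto simp: norm_mult c_def mult_left_mono)
  qed measurable
  have "(\<integral>w. complex_of_real (gauss 1 (w::quat)) \<partial>lborel) = of_real (\<integral>w. gauss 1 (w::quat) \<partial>lborel)"
    by (rule integral_complex_of_real)
  also have "(\<integral>w. gauss 1 (w::quat) \<partial>lborel) = (2 * pi)\<^sup>2"
    using integral_gauss[where 'a = quat, of 1] power_mult[of "sqrt (2 * pi)" 2 2] by simp
  finally have 1: "(\<integral>w. complex_of_real (gauss 1 (w::quat)) \<partial>lborel) = of_real ((2 * pi)\<^sup>2)" .
  have "(\<lambda>n. of_real (1 / (2 * pi)\<^sup>2) * (\<integral>w. of_real (gauss 1 w) * c (sqrt (1 / Suc n) *\<^sub>R w) \<partial>lborel))
      \<longlonglongrightarrow> of_real (1 / (2 * pi)\<^sup>2) * (\<integral>w. of_real (gauss 1 (w::quat)) * c 0 \<partial>lborel)"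
    by (intro tendsto_mult_left lim)
  also have "of_real (1 / (2 * pi)\<^sup>2) * (\<integral>w. of_real (gauss 1 (w::quat)) * c 0 \<partial>lborel) = c 0"
    by (simp only: integral_mult_left_zero 1) simp
  finally show ?thesis
    using integral_fourier_product_gauss[OF u v] by (simp add: c_def)
qed

subsection \<open>Injectivity\<close>

text \<open>If the transform of \<open>u\<close> vanishes, so does every regularized integral, and
  their limit is the pairing with \<open>v\<close>.\<close>

lemma fourier_zero_imp_integral_zero:
  fixes u v :: "quat \<Rightarrow> complex"
  assumes u: "integrable lborel u" and zero: "\<And>k. fourier_integral u k = 0"
    and v: "integrable lborel v" "continuous_on UNIV v" "\<And>x. cmod (v x) \<le> B"
  shows "(\<integral>y. cnj (v y) * u y \<partial>lborel) = 0"
proof -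
  have [measurable]: "u \<in> borel_measurable borel" "v \<in> borel_measurable borel"
    using u v by (auto dest: borel_measurable_integrable)
  note [measurable] = cnj_measurable
  have B: "B \<ge> 0"
    using v(3)[of 0] norm_ge_zero order_trans by blast
  \<comment> \<open>Of the two functions only \<open>v\<close> is known to be continuous, so the
    translation is moved onto it; dominated convergence then works with the majorant
    \<open>B * cmod (u y)\<close>.\<close>
  have shift: "(\<integral>y. cnj (v y) * u (y + z) \<partial>lborel) = (\<integral>y. cnj (v (y - z)) * u y \<partial>lborel)" for z
    using integral_similarity[of "\<lambda>x. x" 1 "\<lambda>y. cnj (v (y - z)) * u y" z]
    by (simp add: add.commute linear_id[unfolded id_def])
  have bound: "cmod (cnj (v (y - z)) * u y) \<le> B * cmod (u y)" for y z
    using v(3)[of "y - z"] by (simp add: norm_mult mult_right_mono)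
  have "cmod (\<integral>y. cnj (v (y - z)) * u y \<partial>lborel) \<le> (\<integral>y. B * cmod (u y) \<partial>lborel)" for z
  proof (rule order_trans[OF integral_norm_bound integral_mono])
    show "integrable lborel (\<lambda>y. cmod (cnj (v (y - z)) * u y))"
      by (rule integrable_norm, rule Bochner_Integration.integrable_bound[OF integrable_mult_right[OF integrable_norm[OF u], of B]])
        (use bound B in \<open>auto simp: abs_mult\<close>)
  qed (use u bound in auto)
  moreover have "isCont (\<lambda>z. \<integral>y. cnj (v (y - z)) * u y \<partial>lborel) 0"
    unfolding continuous_at_sequentially comp_def
  proof (intro allI impI)
    fix z :: "nat \<Rightarrow> quat"
    assume z: "z \<longlonglongrightarrow> 0"
    show "(\<lambda>n. \<integral>y. cnj (v (y - z n)) * u y \<partial>lborel) \<longlonglongrightarrow> (\<integral>y. cnj (v (y - 0)) * u y \<partial>lborel)"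
    proof (rule integral_dominated_convergence)
      show "integrable lborel (\<lambda>y. B * cmod (u y))"
        using u by simp
      show "AE y in lborel. (\<lambda>n. cnj (v (y - z n)) * u y) \<longlonglongrightarrow> cnj (v (y - 0)) * u y"
      proof (rule AE_I2, intro tendsto_intros)
        fix y
        have "isCont v (y - 0)"
          using v(2) by (simp add: continuous_on_eq_continuous_at)
        moreover have "(\<lambda>n. y - z n) \<longlonglongrightarrow> y - 0"
          by (intro tendsto_intros z)
        ultimately show "(\<lambda>n. v (y - z n)) \<longlonglongrightarrow> v (y - 0)"
          by (rule isCont_tendsto_compose)
      qed
    qed (use bound in auto)
  qed
  ultimately have "(\<lambda>n. \<integral>k. of_real (gauss (1 / Suc n) k) * (fourier_integral u k * cnj (fourier_integral v k)) \<partial>lborel)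
    \<longlonglongrightarrow> (\<integral>y. cnj (v y) * u y \<partial>lborel)"
    by (intro fourier_product_gauss_tendsto[OF u v(1)]) (simp_all add: shift)
  then show ?thesis
    by (simp add: zero LIMSEQ_const_iff)
qed

text \<open>Closed sets are stable under intersection and generate the Borel sets, so the vanishing
  spreads to all Borel sets by Dynkin's argument; the real and imaginary parts are then compared
  with 0 as densities.\<close>

lemma set_integral_zero_imp_AE_zero:
  fixes g :: "'a::euclidean_space \<Rightarrow> complex"
  assumes g: "integrable lborel g"
    and closed: "\<And>C. closed C \<Longrightarrow> (\<integral>x\<in>C. g x \<partial>lborel) = 0"
  shows "AE x in lborel. g x = 0"
proof -
  have si: "set_integrable lborel A g" if "A \<in> sets borel" for A
    using integrable_mult_indicator[of A lborel g] g that by (simp add: set_integrable_def)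
  have zero: "(\<integral>x\<in>A. g x \<partial>lborel) = 0" if "A \<in> sets borel" for A
  proof -
    have "Int_stable (Collect closed)" "Collect closed \<subseteq> Pow UNIV"
      "A \<in> sigma_sets UNIV (Collect closed)"
      using that by (auto simp: Int_stable_def borel_eq_closed)
    then show ?thesis
    proof (induction rule: sigma_sets_induct_disjoint)
      case (compl A)
      have A: "A \<in> sets borel"
        using compl(1) by (simp add: borel_eq_closed)
      have "(\<integral>x\<in>(A \<union> (UNIV - A)). g x \<partial>lborel) = (\<integral>x\<in>A. g x \<partial>lborel) + (\<integral>x\<in>UNIV - A. g x \<partial>lborel)"
        using A by (intro set_integral_Un si) auto
      moreover have "(\<integral>x\<in>(A \<union> (UNIV - A)). g x \<partial>lborel) = 0"
        using closed[of UNIV] by simp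
      ultimately show ?case
        using compl(2) by simp
    next
      case (union A)
      have A: "A i \<in> sets borel" for i
        using union(2) by (auto simp: borel_eq_closed)
      have "(\<integral>x\<in>(\<Union>i. A i). g x \<partial>lborel) = (\<Sum>i. \<integral>x\<in>A i. g x \<partial>lborel)"
        using A union(1) by (intro lebesgue_integral_countable_add si) (auto simp: disjoint_family_on_def)
      then show ?case
        by (simp add: union(3))
    qed (simp_all add: closed)
  qed
  have "AE x in lborel. Re (g x) = 0"
  proof (rule density_unique_real)
    fix A :: "'a set"
    assume "A \<in> sets lborel"
    then have A: "A \<in> sets borel" by simp
    have "(\<integral>x\<in>A. Re (g x) \<partial>lborel) = Re (\<integral>x\<in>A. g x \<partial>lborel)"
      using integral_Re[OF si[OF A, unfolded set_integrable_def]] by (simp add: set_lebesgue_integral_def)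
    then show "(\<integral>x\<in>A. Re (g x) \<partial>lborel) = (\<integral>x\<in>A. 0 \<partial>lborel)"
      by (simp add: zero[OF A])
  qed (use g in auto)
  moreover have "AE x in lborel. Im (g x) = 0"
  proof (rule density_unique_real)
    fix A :: "'a set"
    assume "A \<in> sets lborel"
    then have A: "A \<in> sets borel" by simp
    have "(\<integral>x\<in>A. Im (g x) \<partial>lborel) = Im (\<integral>x\<in>A. g x \<partial>lborel)"
      using integral_Im[OF si[OF A, unfolded set_integrable_def]] by (simp add: set_lebesgue_integral_def)
    then show "(\<integral>x\<in>A. Im (g x) \<partial>lborel) = (\<integral>x\<in>A. 0 \<partial>lborel)"
      by (simp add: zero[OF A])
  qed (use g in auto)
  ultimately show ?thesis
    by eventually_elim (simp add: complex_eq_iff)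
qed

text \<open>Continuous cutoffs around a closed set need not be integrable, hence the Gaussian
  weight. It is positive, so it can be removed at the end.\<close>

lemma fourier_integral_zero_imp_AE_zero:
  assumes u: "integrable lborel u" and zero: "\<And>k. fourier_integral u k = 0"
  shows "AE x in lborel. u x = 0"
proof -
  have [measurable]: "u \<in> borel_measurable borel"
    using u by (auto dest: borel_measurable_integrable)
  define g where "g x = of_real (gauss 1 x) * u x" for x
  have [measurable]: "g \<in> borel_measurable borel"
    unfolding g_def by measurable
  have g: "integrable lborel g"
    by (rule Bochner_Integration.integrable_bound[OF u])
      (auto simp: g_def norm_mult mult_left_le_one_le gauss_le_1)
  have "(\<integral>x\<in>C. g x \<partial>lborel) = 0" if C: "closed C" for C
  proof (cases "C = {}")
    \<comment> \<open>The empty set is treated apart: \<open>infdist\<close> to it is 0 by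
      convention, so the cutoffs would tend to 1 instead of to its indicator.\<close>
    case False
    have [measurable]: "C \<in> sets borel"
      using C by (rule borel_closed)
    \<comment> \<open>continuous functions decreasing to the indicator of \<open>C\<close>\<close>
    define d where "d n x = max 0 (1 - real n * infdist x C)" for n and x :: quat
    have d: "continuous_on UNIV (d n)" "0 \<le> d n x" "d n x \<le> 1" for n x
      unfolding d_def by (auto intro!: continuous_intros simp: infdist_nonneg)
    have [measurable]: "d n \<in> borel_measurable borel" for n
      by (rule borel_measurable_continuous_onI[OF d(1)])
    have zero_n: "(\<integral>y. of_real (d n y) * g y \<partial>lborel) = 0" for n
    proof -
      define v where "v x = complex_of_real (d n x * gauss 1 x)" for x
      have [measurable]: "v \<in> borel_measurable borel"
        unfolding v_def by measurable
      have le: "cmod (v x) \<le> gauss 1 x" for x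
        using d(2,3)[of n x] by (simp add: v_def norm_mult mult_left_le_one_le)
      have "(\<integral>y. cnj (v y) * u y \<partial>lborel) = 0"
      proof (rule fourier_zero_imp_integral_zero[OF u zero])
        show "integrable lborel v"
          by (rule Bochner_Integration.integrable_bound[OF integrable_gauss[of 1]])
            (use le in auto)
        show "continuous_on UNIV v"
          unfolding v_def by (intro continuous_intros d)
        show "cmod (v x) \<le> 1" for x
          using le[of x] gauss_le_1[of 1 x] by simp
      qed
      then show ?thesis
        by (simp add: v_def g_def mult.assoc)
    qed
    have "(\<lambda>n. \<integral>y. of_real (d n y) * g y \<partial>lborel) \<longlonglongrightarrow> (\<integral>y. indicator C y *\<^sub>R g y \<partial>lborel)"
    proof (rule integral_dominated_convergence[OF _ _ integrable_norm[OF g]])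
      show "AE y in lborel. (\<lambda>n. of_real (d n y) * g y) \<longlonglongrightarrow> indicator C y *\<^sub>R g y"
      proof (rule AE_I2)
        fix y
        have "(\<lambda>n. d n y) \<longlonglongrightarrow> indicator C y"
        proof (cases "y \<in> C")
          case True
          then show ?thesis
            by (simp add: d_def)
        next
          case y: False
          then have pos: "infdist y C > 0"
            using C False in_closed_iff_infdist_zero infdist_nonneg by (metis order_le_less)
          obtain N where "real N * infdist y C > 1"
            using reals_Archimedean3[OF pos, rule_format] by blast
          then have "d n y = 0" if "n \<ge> N" for n
          proof -
            have "real N * infdist y C \<le> real n * infdist y C"
              using that pos by (intro mult_right_mono) auto
            with \<open>real N * infdist y C > 1\<close> show ?thesis
              by (simp add: d_def)
          qed
          then have "\<forall>\<^sub>F n in sequentially. d n y = 0"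
            unfolding eventually_sequentially by blast
          then show ?thesis
            using y by (simp add: tendsto_eventually)
        qed
        then show "(\<lambda>n. of_real (d n y) * g y) \<longlonglongrightarrow> indicator C y *\<^sub>R g y"
          unfolding scaleR_conv_of_real by (intro tendsto_intros)
      qed
      show "AE y in lborel. norm (of_real (d n y) * g y) \<le> norm (g y)" for n
        using d(2,3)[where n = n] by (auto simp: norm_mult mult_left_le_one_le)
    qed measurable
    then show ?thesis
      unfolding zero_n set_lebesgue_integral_def by (simp add: LIMSEQ_const_iff)
  qed (simp add: set_lebesgue_integral_def)
  then have "AE x in lborel. g x = 0"
    by (rule set_integral_zero_imp_AE_zero[OF g])
  then show ?thesis
    by eventually_elim (simp add: g_def, metis gauss_pos less_irrefl)
qed

subsection \<open>Density of modulated Gaussians\<close>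

text \<open>These test vectors are bounded, continuous and integrable, which makes dominated
  convergence available, and each is the Fourier integral of a translated Gaussian, which puts it
  into the range of the Fourier transform.\<close>

definition packet :: "quat \<Rightarrow> quat \<Rightarrow> complex" where
  "packet k x = exp (\<i> * of_real (k \<bullet> x)) * of_real (gauss 1 x)"

lemma norm_packet [simp]: "cmod (packet k x) = gauss 1 x"
  by (simp add: packet_def norm_mult)

lemma borel_measurable_packet [measurable]: "packet k \<in> borel_measurable borel"
  unfolding packet_def by measurable

lemma integrable_packet: "integrable lborel (packet k)"
  by (rule Bochner_Integration.integrable_bound[OF integrable_gauss[of 1]]) auto

lemma square_integrable_packet: "square_integrable (packet k)"
proof -
  have "(gauss 1 x)\<^sup>2 = gauss 2 x" for x :: quat
    by (simp add: gauss_def power2_eq_square flip: exp_add)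
  then show ?thesis
    by (simp add: square_integrable_def integrable_gauss)
qed

lemma continuous_packet: "continuous_on UNIV (packet k)"
  unfolding packet_def by (intro continuous_intros)

text \<open>If \<open>e\<close> is orthogonal to every packet, the Fourier integral of the Gaussian
  times \<open>e\<close> vanishes identically. The result serves as an induction principle: a
  property that cuts out a closed subspace need only be checked on packets.\<close>

lemma packet_total:
  assumes S: "csubspace S" "closed S" and packet: "\<And>k. abs_L2 (packet k) \<in> S"
  shows "S = UNIV"
proof (rule ccontr)
  assume "S \<noteq> UNIV"
  then obtain e where e: "e \<noteq> 0" "\<And>s. s \<in> S \<Longrightarrow> \<langle>e | s\<rangle> = 0"
    using exists_orthogonal_vector[OF S] by blast
  define u where "u x = of_real (gauss 1 x) * rep_L2 e x" for x
  have [measurable]: "u \<in> borel_measurable borel"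
    unfolding u_def by measurable
  have u: "integrable lborel u"
  proof (rule Bochner_Integration.integrable_bound)
    show "integrable lborel (\<lambda>x. cnj (packet 0 x) * rep_L2 e x)"
      by (intro square_integrable_mult square_integrable_packet square_integrable_rep_L2)
  qed (auto simp: u_def norm_mult)
  have "fourier_integral u k = 0" for k
  proof -
    have "0 = cnj \<langle>e | abs_L2 (packet k)\<rangle>"
      using e(2)[OF packet] by simp
    also have "\<dots> = \<langle>abs_L2 (packet k) | e\<rangle>"
      by (rule cinner_commute[symmetric])
    also have "\<dots> = (\<integral>x. cnj (packet k x) * rep_L2 e x \<partial>lborel)"
      by (intro cinner_cong rep_abs_L2 square_integrable_packet square_integrable_rep_L2) simp
    also have "\<dots> = (\<integral>x. exp (- (\<i> * of_real (k \<bullet> x))) * u x \<partial>lborel)"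
      by (simp add: packet_def u_def exp_cnj mult.assoc)
    finally show ?thesis
      by (simp add: fourier_integral_def)
  qed
  then have "AE x in lborel. u x = 0"
    by (rule fourier_integral_zero_imp_AE_zero[OF u])
  then have "AE x in lborel. rep_L2 e x = rep_L2 0 x"
    using rep_L2_zero by eventually_elim (simp add: u_def, metis gauss_pos less_irrefl)
  then show False
    using e(1) L2_eqI by blast
qed

section \<open>Strong continuity\<close>

text \<open>For unitary operators, convergence of
  \<open>\<langle>U_C (X n) P | U_C g P\<rangle>\<close> to the squared norm of \<open>P\<close>
  already gives convergence in norm, and this inner product is within reach of dominated
  convergence.\<close>

lemma continuous_U_C_packet:
  "continuous_on (carrier Gaff) (\<lambda>g. U_C g (abs_L2 (packet k)))"
  unfolding continuous_on_sequentially comp_def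
proof (intro allI ballI impI, elim conjE)
  fix X :: "nat \<Rightarrow> quat \<times> quat" and g
  assume g: "g \<in> carrier Gaff" and X: "\<forall>n. X n \<in> carrier Gaff" "X \<longlonglongrightarrow> g"
  define P where "P = abs_L2 (packet k)"
  have UP: "U_C h P = abs_L2 (U_fun h (packet k))" if "h \<in> carrier Gaff" for h
    unfolding P_def by (rule U_C_abs_L2[OF that square_integrable_packet])
  have sq: "square_integrable (U_fun h (packet k))" if "h \<in> carrier Gaff" for h
    by (intro square_integrable_U_fun that square_integrable_packet)
  have inner: "\<langle>U_C h P | U_C g P\<rangle> = (\<integral>x. cnj (U_fun h (packet k) x) * U_fun g (packet k) x \<partial>lborel)"
    if "h \<in> carrier Gaff" for h
    unfolding UP[OF that] UP[OF g] by (intro cinner_cong rep_abs_L2 sq that g)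
  obtain b a where gba: "g = (b, a)" and a: "a \<noteq> 0"
    using g by (auto simp: Gaff_def)
  have Xa: "snd (X n) \<noteq> 0" for n
    using X(1) by (auto simp: Gaff_def split_beta)
  have lim_b: "(\<lambda>n. fst (X n)) \<longlonglongrightarrow> b" and lim_a: "(\<lambda>n. snd (X n)) \<longlonglongrightarrow> a"
    using tendsto_fst[OF X(2)] tendsto_snd[OF X(2)] by (simp_all add: gba)
  have lim_s: "(\<lambda>n. 1 / (norm (snd (X n)))\<^sup>2) \<longlonglongrightarrow> 1 / (norm a)\<^sup>2"
    using a by (intro tendsto_intros lim_a) simp
  \<comment> \<open>The limit \<open>a\<close> is nonzero, so the prefactors stay bounded; their
    bound \<open>B\<close> enters the majorant.\<close>
  then have "Bseq (\<lambda>n. 1 / (norm (snd (X n)))\<^sup>2)"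
    by (rule convergent_imp_Bseq[OF convergentI])
  then obtain B where B: "\<And>n. norm (1 / (norm (snd (X n)))\<^sup>2) \<le> B"
    unfolding Bseq_def by blast
  have Ug_int: "integrable lborel (U_fun g (packet k))"
  proof -
    have "integrable lborel (\<lambda>x. packet k (- (qinv a \<odot> b) + qinv a \<odot> x))"
      using a by (intro integrable_similarity[OF linear_qmult, of _ "1 / norm a"] integrable_packet)
        (simp_all add: norm_qmult norm_qinv)
    then show ?thesis
      by (simp add: gba U_fun_def qmult_algebra)
  qed
  have lim: "(\<lambda>n. \<langle>U_C (X n) P | U_C g P\<rangle>) \<longlonglongrightarrow> \<langle>U_C g P | U_C g P\<rangle>"
    unfolding inner[OF g] inner[OF X(1)[rule_format]]
  proof (rule integral_dominated_convergence)
    show "integrable lborel (\<lambda>x. B * cmod (U_fun g (packet k) x))"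
      using Ug_int by simp
    show "AE x in lborel. (\<lambda>n. cnj (U_fun (X n) (packet k) x) * U_fun g (packet k) x)
        \<longlonglongrightarrow> cnj (U_fun g (packet k) x) * U_fun g (packet k) x"
    proof (rule AE_I2, intro tendsto_intros)
      fix x
      have "continuous_on (carrier Gaff) (\<lambda>h. qinv (snd h) \<odot> (x - fst h))"
        by (intro continuous_intros) (auto simp: Gaff_def)
      then have "(\<lambda>n. qinv (snd (X n)) \<odot> (x - fst (X n))) \<longlonglongrightarrow> qinv a \<odot> (x - b)"
        using g X unfolding continuous_on_sequentially comp_def gba by fastforce
      moreover have "isCont (packet k) (qinv a \<odot> (x - b))"
        using continuous_packet by (simp add: continuous_on_eq_continuous_at)
      ultimately have "(\<lambda>n. packet k (qinv (snd (X n)) \<odot> (x - fst (X n)))) \<longlonglongrightarrow> packet k (qinv a \<odot> (x - b))"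
        using isCont_tendsto_compose by blast
      then show "(\<lambda>n. U_fun (X n) (packet k) x) \<longlonglongrightarrow> U_fun g (packet k) x"
        unfolding U_fun_def split_beta gba fst_conv snd_conv by (intro tendsto_intros lim_s)
    qed
    show "AE x in lborel. norm (cnj (U_fun (X n) (packet k) x) * U_fun g (packet k) x)
        \<le> B * cmod (U_fun g (packet k) x)" for n
    proof (rule AE_I2)
      fix x
      have "cmod (U_fun (X n) (packet k) x) \<le> 1 / (norm (snd (X n)))\<^sup>2 * 1"
        unfolding U_fun_def split_beta norm_mult norm_packet
        by (intro mult_mono) (auto simp: gauss_le_1 norm_divide norm_power)
      also have "\<dots> \<le> B"
        using B[of n] by simp
      finally show "norm (cnj (U_fun (X n) (packet k) x) * U_fun g (packet k) x)
          \<le> B * cmod (U_fun g (packet k) x)"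
        by (simp add: norm_mult mult_right_mono)
    qed
    note [measurable] = cnj_measurable
    show "(\<lambda>x. cnj (U_fun g (packet k) x) * U_fun g (packet k) x) \<in> borel_measurable lborel"
      "(\<lambda>x. cnj (U_fun (X n) (packet k) x) * U_fun g (packet k) x) \<in> borel_measurable lborel" for n
      by measurable
  qed
  have "(norm (U_C (X n) P - U_C g P))\<^sup>2 = 2 * (norm P)\<^sup>2 - 2 * Re \<langle>U_C (X n) P | U_C g P\<rangle>" for n
  proof -
    have "norm (U_C (X n) P) = norm P" "norm (U_C g P) = norm P"
      using X(1) g norm_unitary_op unitary_op_U_C by blast+
    then show ?thesis
      unfolding power2_norm_eq_inner
      by (simp add: inner_diff_left inner_diff_right inner_commute)
        (simp add: power2_norm_eq_inner[symmetric] inner_L2_def cinner_commute[of "U_C g P" "U_C (X n) P"])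
  qed
  moreover have "(\<lambda>n. 2 * (norm P)\<^sup>2 - 2 * Re \<langle>U_C (X n) P | U_C g P\<rangle>)
      \<longlonglongrightarrow> 2 * (norm P)\<^sup>2 - 2 * Re \<langle>U_C g P | U_C g P\<rangle>"
    by (intro tendsto_intros lim)
  moreover have "Re \<langle>U_C g P | U_C g P\<rangle> = (norm P)\<^sup>2"
    by (simp add: cinner_self norm_unitary_op[OF unitary_op_U_C[OF g]])
  ultimately have "(\<lambda>n. (norm (U_C (X n) P - U_C g P))\<^sup>2) \<longlonglongrightarrow> 0"
    by simp
  then have "(\<lambda>n. sqrt ((norm (U_C (X n) P - U_C g P))\<^sup>2)) \<longlonglongrightarrow> sqrt 0"
    by (rule tendsto_real_sqrt)
  then have "(\<lambda>n. norm (U_C (X n) P - U_C g P)) \<longlonglongrightarrow> 0"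
    by simp
  then show "(\<lambda>n. U_C (X n) (abs_L2 (packet k))) \<longlonglongrightarrow> U_C g (abs_L2 (packet k))"
    unfolding P_def[symmetric] by (simp add: LIM_zero_iff tendsto_norm_zero_iff)
qed

text \<open>Unitarity makes the approximation of a vector uniform over the group, so the vectors
  with continuous orbit map form a closed subspace, to which totality of the packets
  applies.\<close>

lemma continuous_U_C: "continuous_on (carrier Gaff) (\<lambda>g. U_C g f)"
proof -
  define S where "S = {f. continuous_on (carrier Gaff) (\<lambda>g. U_C g f)}"
  have lin: "U_C g (f + h) = U_C g f + U_C g h" "U_C g (c *\<^sub>C f) = c *\<^sub>C U_C g f"
    if "g \<in> carrier Gaff" for g f h c
    using clinear_op_U_C[OF that] by (simp_all add: clinear_op_def)
  have "S = UNIV"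
  proof (rule packet_total)
    show "csubspace S"
      unfolding csubspace_def
    proof (intro conjI ballI allI)
      have "U_C g 0 = 0" if "g \<in> carrier Gaff" for g
        using norm_unitary_op[OF unitary_op_U_C[OF that], of 0] by simp
      then show "0 \<in> S"
        by (simp add: S_def cong: continuous_on_cong)
      show "f + h \<in> S" if "f \<in> S" "h \<in> S" for f h
        using that by (simp add: S_def lin continuous_on_add cong: continuous_on_cong)
      show "c *\<^sub>C f \<in> S" if "f \<in> S" for c f
        using that by (simp add: S_def lin bounded_linear.continuous_on[OF bounded_linear_cscale] cong: continuous_on_cong)
    qed
    show "closed S"
      unfolding closed_sequential_limits
    proof (intro allI impI, elim conjE)
      fix X :: "nat \<Rightarrow> quat L2" and f
      assume X: "\<forall>n. X n \<in> S" "X \<longlonglongrightarrow> f"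
      have "continuous_on (carrier Gaff) (\<lambda>g. U_C g f)"
      proof (rule uniform_limit_theorem)
        show "\<forall>\<^sub>F n in sequentially. continuous_on (carrier Gaff) (\<lambda>g. U_C g (X n))"
          using X(1) by (simp add: S_def)
        show "uniform_limit (carrier Gaff) (\<lambda>n g. U_C g (X n)) (\<lambda>g. U_C g f) sequentially"
          using X(2) unfolding uniform_limit_iff tendsto_iff
          by (simp add: dist_unitary_op unitary_op_U_C)
      qed simp
      then show "f \<in> S"
        by (simp add: S_def)
    qed
    show "abs_L2 (packet k) \<in> S" for k
      by (simp add: S_def continuous_U_C_packet)
  qed
  then show ?thesis
    by (auto simp: S_def)
qed

theorem unitary_rep_U_C: "unitary_rep Gaff U_C"
  unfolding unitary_rep_def using group_Gaff U_C_hom continuous_U_C by blast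

section \<open>The Plancherel theorem\<close>

text \<open>The same Gaussian limit is computed on the position side through the correlation and on
  the frequency side through monotone convergence. In the form with
  \<open>\<integral>\<^sup>+\<close> it yields square-integrability of the transform as a
  corollary.\<close>

lemma Plancherel_fourier_integral:
  assumes u: "integrable lborel u" "square_integrable u"
  shows "(\<integral>\<^sup>+k. ennreal ((cmod (fourier_integral u k))\<^sup>2) \<partial>lborel)
    = (\<integral>\<^sup>+x. ennreal ((cmod (u x))\<^sup>2) \<partial>lborel)"
proof -
  have [measurable]: "u \<in> borel_measurable borel"
    using u by (auto dest: borel_measurable_integrable)
  define f where "f = abs_L2 u"
  have carrier: "(- z, qone) \<in> carrier Gaff" for z
    by simp
  have corr: "(\<integral>y. cnj (u y) * u (y + z) \<partial>lborel) = \<langle>f | U_C (- z, qone) f\<rangle>" for z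
  proof -
    have "\<langle>f | U_C (- z, qone) f\<rangle> = (\<integral>y. cnj (u y) * U_fun (- z, qone) u y \<partial>lborel)"
      unfolding f_def U_C_abs_L2[OF carrier u(2)]
      by (intro cinner_cong rep_abs_L2 u(2) square_integrable_U_fun carrier)
    then show ?thesis
      by (simp add: U_fun_def)
  qed
  \<comment> \<open>The correlation is continuous because the representation is strongly continuous.\<close>
  have "(\<lambda>n. \<integral>k. of_real (gauss (1 / Suc n) k) * (fourier_integral u k * cnj (fourier_integral u k)) \<partial>lborel)
      \<longlonglongrightarrow> (\<integral>y. cnj (u y) * u y \<partial>lborel)"
  proof (rule fourier_product_gauss_tendsto[OF u(1) u(1)])
    show "cmod (\<integral>y. cnj (u y) * u (y + z) \<partial>lborel) \<le> norm f * norm f" for z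
      unfolding corr using cinner_Cauchy_Schwarz[of f "U_C (- z, qone) f"] 
      by (simp add: norm_unitary_op[OF unitary_op_U_C[OF carrier]])
    have "continuous_on UNIV (\<lambda>z. U_C (- z, qone) f)"
      by (rule continuous_on_compose2[OF continuous_U_C, of _ "\<lambda>z. (- z, qone)"])
        (auto intro!: continuous_intros)
    then have "continuous_on UNIV (\<lambda>z. \<langle>f | U_C (- z, qone) f\<rangle>)"
      by (intro bounded_bilinear.continuous_on[OF bounded_bilinear_cinner] continuous_intros)
    then show "isCont (\<lambda>z. \<integral>y. cnj (u y) * u (y + z) \<partial>lborel) 0"
      unfolding corr by (simp add: continuous_on_eq_continuous_at)
  qed
  moreover have "(\<integral>k. of_real (gauss (1 / Suc n) k) * (fourier_integral u k * cnj (fourier_integral u k)) \<partial>lborel)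
      = of_real (\<integral>k. gauss (1 / Suc n) k * (cmod (fourier_integral u k))\<^sup>2 \<partial>lborel)" for n
    unfolding integral_complex_of_real[symmetric]
    by (simp add: complex_norm_square[symmetric])
  moreover have "(\<integral>y. cnj (u y) * u y \<partial>lborel) = of_real ((norm f)\<^sup>2)"
  proof -
    have "(\<integral>y. cnj (u y) * u y \<partial>lborel) = \<langle>f | f\<rangle>"
      unfolding f_def by (intro cinner_cong[symmetric] rep_abs_L2 u(2))
    then show ?thesis
      by (simp add: cinner_self)
  qed
  ultimately have "(\<lambda>n. \<integral>k. gauss (1 / Suc n) k * (cmod (fourier_integral u k))\<^sup>2 \<partial>lborel) \<longlonglongrightarrow> (norm f)\<^sup>2"
    by (simp only: tendsto_of_real_iff)
  then have "(\<lambda>n. ennreal (\<integral>k. gauss (1 / Suc n) k * (cmod (fourier_integral u k))\<^sup>2 \<partial>lborel)) \<longlonglongrightarrow> ennreal ((norm f)\<^sup>2)"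
    by (rule tendsto_ennrealI)
  moreover have "ennreal (\<integral>k. gauss (1 / Suc n) k * (cmod (fourier_integral u k))\<^sup>2 \<partial>lborel)
      = (\<integral>\<^sup>+k. ennreal (gauss (1 / Suc n) k * (cmod (fourier_integral u k))\<^sup>2) \<partial>lborel)" for n
  proof (rule nn_integral_eq_integral[symmetric])
    define B where "B = 1 / (2 * pi)\<^sup>2 * (\<integral>x. cmod (u x) \<partial>lborel)"
    show "integrable lborel (\<lambda>k. gauss (1 / Suc n) k * (cmod (fourier_integral u k))\<^sup>2)"
    proof (rule Bochner_Integration.integrable_bound)
      show "integrable lborel (\<lambda>k :: quat. gauss (1 / Suc n) k * B\<^sup>2)"
        by (simp add: integrable_gauss)
      have "(cmod (fourier_integral u k))\<^sup>2 \<le> B\<^sup>2" for k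
        using norm_fourier_integral_le[of u k] by (intro power_mono) (auto simp: B_def)
      then show "AE k in lborel. norm (gauss (1 / Suc n) k * (cmod (fourier_integral u k))\<^sup>2) \<le> norm (gauss (1 / Suc n) k * B\<^sup>2)"
        by (auto simp: abs_mult intro!: mult_left_mono)
    qed measurable
  qed simp
  \<comment> \<open>Monotone rather than dominated convergence: a majorant independent of
    \<open>n\<close> would presuppose that the transform is square-integrable.\<close>
  moreover have "(\<lambda>n. \<integral>\<^sup>+k. ennreal (gauss (1 / Suc n) k * (cmod (fourier_integral u k))\<^sup>2) \<partial>lborel)
      \<longlonglongrightarrow> (\<integral>\<^sup>+k. ennreal ((cmod (fourier_integral u k))\<^sup>2) \<partial>lborel)"
  proof (rule nn_integral_LIMSEQ)
    show "incseq (\<lambda>n k. ennreal (gauss (1 / Suc n) k * (cmod (fourier_integral u k))\<^sup>2))"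
    proof (intro incseq_SucI le_funI ennreal_leI mult_right_mono)
      show "gauss (1 / Suc n) k \<le> gauss (1 / Suc (Suc n)) k" for n and k :: quat
        unfolding gauss_def exp_le_cancel_iff neg_le_iff_le
        by (intro divide_right_mono mult_right_mono) (auto simp: frac_le)
    qed simp
    show "(\<lambda>n. ennreal (gauss (1 / Suc n) k * (cmod (fourier_integral u k))\<^sup>2)) \<longlonglongrightarrow> ennreal ((cmod (fourier_integral u k))\<^sup>2)" for k
    proof (rule tendsto_ennrealI)
      have "(\<lambda>n. gauss (1 / Suc n) k) \<longlonglongrightarrow> exp (- (0 * (norm k)\<^sup>2 / 2))"
        unfolding gauss_def by (intro tendsto_intros LIMSEQ_Suc[OF lim_1_over_n]) simp
      then show "(\<lambda>n. gauss (1 / Suc n) k * (cmod (fourier_integral u k))\<^sup>2) \<longlonglongrightarrow> (cmod (fourier_integral u k))\<^sup>2"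
        using tendsto_mult_right[where c = "(cmod (fourier_integral u k))\<^sup>2"] by fastforce
    qed
  qed measurable
  ultimately have "(\<integral>\<^sup>+k. ennreal ((cmod (fourier_integral u k))\<^sup>2) \<partial>lborel) = ennreal ((norm f)\<^sup>2)"
    using LIMSEQ_unique by (metis (no_types, lifting) ext)
  then show ?thesis
    by (simp add: f_def ennreal_norm_abs_L2[OF u(2)])
qed

lemma square_integrable_fourier_integral:
  assumes u: "integrable lborel u" "square_integrable u"
  shows "square_integrable (fourier_integral u)"
proof -
  have "u \<in> borel_measurable borel"
    using u by (auto dest: borel_measurable_integrable)
  then show ?thesis
    using u(2) Plancherel_fourier_integral[OF u] by (simp add: square_integrable_iff)
qed

lemma fourier_integral_add:
  assumes "integrable lborel u" "integrable lborel v"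
  shows "fourier_integral (\<lambda>x. u x + v x) k = fourier_integral u k + fourier_integral v k"
  using integrable_fourier_kernel[OF assms(1)] integrable_fourier_kernel[OF assms(2)]
  by (simp add: fourier_integral_def distrib_left add_divide_distrib)

lemma fourier_integral_cmult: "fourier_integral (\<lambda>x. c * u x) k = c * fourier_integral u k"
proof -
  have "(\<integral>x. exp (- (\<i> * of_real (k \<bullet> x))) * (c * u x) \<partial>lborel) = (\<integral>x. c * (exp (- (\<i> * of_real (k \<bullet> x))) * u x) \<partial>lborel)"
    by (simp only: mult_ac)
  then show ?thesis
    by (simp add: fourier_integral_def)
qed

lemma fourier_integral_cong_AE:
  assumes [measurable]: "u \<in> borel_measurable borel" "v \<in> borel_measurable borel"
    and "AE x in lborel. u x = v x"
  shows "fourier_integral u = fourier_integral v"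
proof
  fix k
  have "(\<integral>x. exp (- (\<i> * of_real (k \<bullet> x))) * u x \<partial>lborel) = (\<integral>x. exp (- (\<i> * of_real (k \<bullet> x))) * v x \<partial>lborel)"
    by (rule integral_cong_AE) (use assms(3) in auto)
  then show "fourier_integral u k = fourier_integral v k"
    by (simp add: fourier_integral_def)
qed

section \<open>The Fourier transform on classes and approximation by cutoffs\<close>

definition L1_L2 :: "quat L2 set" where
  "L1_L2 = {f. integrable lborel (rep_L2 f)}"

definition fourier_L1_L2 :: "quat L2 \<Rightarrow> quat L2" where
  "fourier_L1_L2 f = abs_L2 (fourier_integral (rep_L2 f))"

lemma integrable_cong_AE_rep:
  assumes "AE x in lborel. rep_L2 f x = \<phi> x" "integrable lborel \<phi>"
  shows "integrable lborel (rep_L2 f)"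
  using assms by (subst integrable_cong_AE[of _ _ \<phi>]) auto

lemma L1_L2_abs: "square_integrable \<phi> \<Longrightarrow> integrable lborel \<phi> \<Longrightarrow> abs_L2 \<phi> \<in> L1_L2"
  unfolding L1_L2_def using integrable_cong_AE_rep[OF rep_abs_L2] by blast

lemma fourier_L1_L2_abs:
  assumes "square_integrable \<phi>" "integrable lborel \<phi>"
  shows "fourier_L1_L2 (abs_L2 \<phi>) = abs_L2 (fourier_integral \<phi>)"
proof -
  have "fourier_integral (rep_L2 (abs_L2 \<phi>)) = fourier_integral \<phi>"
    using assms by (intro fourier_integral_cong_AE rep_abs_L2) (auto simp: square_integrable_def)
  then show ?thesis
    by (simp add: fourier_L1_L2_def)
qed

lemma square_integrable_fourier_rep:
  "f \<in> L1_L2 \<Longrightarrow> square_integrable (fourier_integral (rep_L2 f))"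
  by (intro square_integrable_fourier_integral square_integrable_rep_L2) (simp add: L1_L2_def)

lemma norm_fourier_L1_L2:
  assumes "f \<in> L1_L2"
  shows "norm (fourier_L1_L2 f) = norm f"
proof -
  have "ennreal ((norm (fourier_L1_L2 f))\<^sup>2)
      = (\<integral>\<^sup>+k. ennreal ((cmod (fourier_integral (rep_L2 f) k))\<^sup>2) \<partial>lborel)"
    unfolding fourier_L1_L2_def
    by (rule ennreal_norm_abs_L2[OF square_integrable_fourier_rep[OF assms], symmetric])
  also have "\<dots> = ennreal ((norm f)\<^sup>2)"
    using assms Plancherel_fourier_integral[OF _ square_integrable_rep_L2[of f]]
    by (simp add: L1_L2_def ennreal_norm_L2)
  finally have "ennreal ((norm (fourier_L1_L2 f))\<^sup>2) = ennreal ((norm f)\<^sup>2)" .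
  then show ?thesis
    by (simp add: power2_eq_iff_nonneg)
qed

lemma
  assumes f: "f \<in> L1_L2" and g: "g \<in> L1_L2"
  shows L1_L2_add: "f + g \<in> L1_L2"
    and fourier_L1_L2_add: "fourier_L1_L2 (f + g) = fourier_L1_L2 f + fourier_L1_L2 g"
proof -
  have eq: "f + g = abs_L2 (\<lambda>x. rep_L2 f x + rep_L2 g x)"
    by (simp add: abs_L2_add square_integrable_rep_L2)
  have int: "integrable lborel (rep_L2 f)" "integrable lborel (rep_L2 g)"
    using f g by (simp_all add: L1_L2_def)
  show "f + g \<in> L1_L2"
    unfolding eq using int by (intro L1_L2_abs square_integrable_add square_integrable_rep_L2) simp
  have "fourier_L1_L2 (f + g) = abs_L2 (fourier_integral (\<lambda>x. rep_L2 f x + rep_L2 g x))"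
    unfolding eq using int by (intro fourier_L1_L2_abs square_integrable_add square_integrable_rep_L2) simp
  also have "\<dots> = fourier_L1_L2 f + fourier_L1_L2 g"
    unfolding fourier_integral_add[OF int, abs_def] fourier_L1_L2_def
    by (intro abs_L2_add square_integrable_fourier_rep f g)
  finally show "fourier_L1_L2 (f + g) = fourier_L1_L2 f + fourier_L1_L2 g" .
qed

lemma
  assumes f: "f \<in> L1_L2"
  shows L1_L2_cscale: "c *\<^sub>C f \<in> L1_L2"
    and fourier_L1_L2_cscale: "fourier_L1_L2 (c *\<^sub>C f) = c *\<^sub>C fourier_L1_L2 f"
proof -
  have eq: "c *\<^sub>C f = abs_L2 (\<lambda>x. c * rep_L2 f x)"
    by (simp add: abs_L2_cscale square_integrable_rep_L2)
  have int: "integrable lborel (rep_L2 f)"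
    using f by (simp add: L1_L2_def)
  show "c *\<^sub>C f \<in> L1_L2"
    unfolding eq using int by (intro L1_L2_abs square_integrable_cmult square_integrable_rep_L2) simp
  have "fourier_L1_L2 (c *\<^sub>C f) = abs_L2 (fourier_integral (\<lambda>x. c * rep_L2 f x))"
    unfolding eq using int by (intro fourier_L1_L2_abs square_integrable_cmult square_integrable_rep_L2) simp
  also have "\<dots> = c *\<^sub>C fourier_L1_L2 f"
    unfolding fourier_integral_cmult[abs_def] fourier_L1_L2_def
    by (intro abs_L2_cscale square_integrable_fourier_rep f)
  finally show "fourier_L1_L2 (c *\<^sub>C f) = c *\<^sub>C fourier_L1_L2 f" .
qed

lemma dist_fourier_L1_L2:
  assumes "f \<in> L1_L2" "g \<in> L1_L2"
  shows "dist (fourier_L1_L2 f) (fourier_L1_L2 g) = dist f g"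
proof -
  have "f - g \<in> L1_L2" and "fourier_L1_L2 (f - g) = fourier_L1_L2 f - fourier_L1_L2 g"
    using assms by (simp_all add: minus_L2_def uminus_L2_def L1_L2_add L1_L2_cscale
        fourier_L1_L2_add fourier_L1_L2_cscale)
  then show ?thesis
    by (metis dist_norm norm_fourier_L1_L2)
qed

text \<open>A fixed choice of approximants in \<open>L1_L2\<close> that is linear in the vector, so
  that the extended Fourier transform inherits linearity term by term.\<close>

definition ball_cutoff :: "nat \<Rightarrow> quat L2 \<Rightarrow> quat L2" where
  "ball_cutoff n f = abs_L2 (\<lambda>x. indicator (cball 0 (real n)) x * rep_L2 f x)"

lemma borel_measurable_indicator_cball [measurable]:
  "(indicator (cball a r) :: 'a::euclidean_space \<Rightarrow> complex) \<in> borel_measurable borel"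
proof -
  have [measurable]: "cball a r \<in> sets borel"
    by (rule borel_closed[OF closed_cball])
  show ?thesis
    unfolding indicator_def[abs_def] by measurable
qed

lemma square_integrable_cutoff:
  assumes "square_integrable \<phi>"
  shows "square_integrable (\<lambda>x. indicator (cball 0 (real n)) x * \<phi> x)"
proof -
  have [measurable]: "\<phi> \<in> borel_measurable borel"
    using assms by (simp add: square_integrable_def)
  have "integrable lborel (\<lambda>x. (cmod (indicator (cball 0 (real n)) x * \<phi> x))\<^sup>2)"
    by (rule Bochner_Integration.integrable_bound[of _ "\<lambda>x. (cmod (\<phi> x))\<^sup>2"])
      (use assms in \<open>auto simp: square_integrable_def norm_mult indicator_def\<close>)
  then show ?thesis
    by (simp add: square_integrable_def)
qed

lemma rep_ball_cutoff:
  "AE x in lborel. rep_L2 (ball_cutoff n f) x = indicator (cball 0 (real n)) x * rep_L2 f x"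
  unfolding ball_cutoff_def by (intro rep_abs_L2 square_integrable_cutoff square_integrable_rep_L2)

lemma ball_cutoff_L1_L2: "ball_cutoff n f \<in> L1_L2"
proof -
  have sq: "square_integrable (\<lambda>x :: quat. indicator (cball 0 (real n)) x :: complex)"
  proof -
    have "integrable lborel (\<lambda>x :: quat. indicator (cball 0 (real n)) x :: real)"
      using emeasure_lborel_cball_finite by (auto simp: integrable_indicator_iff)
    moreover have "(cmod (indicator (cball 0 (real n)) x))\<^sup>2 = (indicator (cball 0 (real n)) x :: real)" for x :: quat
      by (simp add: indicator_def)
    ultimately show ?thesis
      by (simp add: square_integrable_def)
  qed
  have cnj: "cnj (indicator (cball 0 (real n)) x) = indicator (cball 0 (real n)) x" for x :: quat
    by (simp add: indicator_def)
  have "integrable lborel (\<lambda>x. indicator (cball 0 (real n)) x * rep_L2 f x)"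
    using square_integrable_mult[OF sq square_integrable_rep_L2[of f]] by (simp only: cnj)
  then show ?thesis
    unfolding ball_cutoff_def by (intro L1_L2_abs square_integrable_cutoff square_integrable_rep_L2)
qed

lemma ball_cutoff_add: "ball_cutoff n (f + g) = ball_cutoff n f + ball_cutoff n g"
proof (rule L2_eqI)
  show "AE x in lborel. rep_L2 (ball_cutoff n (f + g)) x = rep_L2 (ball_cutoff n f + ball_cutoff n g) x"
    using rep_ball_cutoff[of n "f + g"] rep_ball_cutoff[of n f] rep_ball_cutoff[of n g]
      rep_L2_add[of f g] rep_L2_add[of "ball_cutoff n f" "ball_cutoff n g"]
    by eventually_elim (simp add: distrib_left)
qed

lemma ball_cutoff_cscale: "ball_cutoff n (c *\<^sub>C f) = c *\<^sub>C ball_cutoff n f"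
proof (rule L2_eqI)
  show "AE x in lborel. rep_L2 (ball_cutoff n (c *\<^sub>C f)) x = rep_L2 (c *\<^sub>C ball_cutoff n f) x"
    using rep_ball_cutoff[of n "c *\<^sub>C f"] rep_ball_cutoff[of n f]
      rep_L2_cscale[of c f] rep_L2_cscale[of c "ball_cutoff n f"]
    by eventually_elim simp
qed

lemma ball_cutoff_tendsto: "(\<lambda>n. ball_cutoff n f) \<longlonglongrightarrow> f"
proof -
  define r where "r n x = (1 - indicator (cball 0 (real n)) x) * rep_L2 f x" for n and x :: quat
  have "(norm (f - ball_cutoff n f))\<^sup>2 = (\<integral>x. (cmod (r n x))\<^sup>2 \<partial>lborel)" for n
    unfolding norm_L2_square
  proof (rule integral_cong_AE)
    show "AE x in lborel. (cmod (rep_L2 (f - ball_cutoff n f) x))\<^sup>2 = (cmod (r n x))\<^sup>2"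
      using rep_L2_diff[of f "ball_cutoff n f"] rep_ball_cutoff[of n f]
      by eventually_elim (simp add: r_def left_diff_distrib)
  qed (auto simp: r_def)
  moreover have "(\<lambda>n. \<integral>x. (cmod (r n x))\<^sup>2 \<partial>lborel) \<longlonglongrightarrow> (\<integral>x. 0 \<partial>(lborel :: quat measure))"
  proof (rule integral_dominated_convergence[OF _ _ integrable_rep_L2_square[of f]])
    show "AE x in lborel. (\<lambda>n. (cmod (r n x))\<^sup>2) \<longlonglongrightarrow> 0"
    proof (rule AE_I2)
      fix x :: quat
      have "\<forall>\<^sub>F n in sequentially. (cmod (r n x))\<^sup>2 = 0"
        using eventually_ge_at_top[of "nat \<lceil>norm x\<rceil>"]
        by eventually_elim (auto simp: r_def indicator_def dist_norm)
      then show "(\<lambda>n. (cmod (r n x))\<^sup>2) \<longlonglongrightarrow> 0"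
        by (rule tendsto_eventually)
    qed
    show "AE x in lborel. norm ((cmod (r n x))\<^sup>2) \<le> (cmod (rep_L2 f x))\<^sup>2" for n
      by (auto simp: r_def indicator_def)
  qed (auto simp: r_def)
  ultimately have "(\<lambda>n. (norm (f - ball_cutoff n f))\<^sup>2) \<longlonglongrightarrow> 0"
    by simp
  then have "(\<lambda>n. sqrt ((norm (f - ball_cutoff n f))\<^sup>2)) \<longlonglongrightarrow> sqrt 0"
    by (rule tendsto_real_sqrt)
  then have "(\<lambda>n. dist (ball_cutoff n f) f) \<longlonglongrightarrow> 0"
    by (simp add: dist_norm norm_minus_commute)
  then show ?thesis
    by (rule iffD2[OF tendsto_dist_iff])
qed

text \<open>Polarization recovers the real inner product from the norm;
  \<open>\<i> *\<^sub>C g\<close> in place of \<open>g\<close> then reaches the imaginary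
  part.\<close>

lemma clinear_isometry_cinner:
  assumes T: "clinear_op T" and norm: "\<And>f. norm (T f) = norm f"
  shows "\<langle>T f | T g\<rangle> = \<langle>f | g\<rangle>"
proof -
  have inner: "T f \<bullet> T g = f \<bullet> g" for f g
  proof -
    have "T (f + g) = T f + T g"
      using T by (simp add: clinear_op_def)
    then show ?thesis
      using norm[of "f + g"] norm[of f] norm[of g]
      by (simp add: dot_norm[of "T f" "T g"] dot_norm[of f g])
  qed
  have "T (\<i> *\<^sub>C g) = \<i> *\<^sub>C T g"
    using T by (simp add: clinear_op_def)
  then show ?thesis
    using inner[of f g] inner[of f "\<i> *\<^sub>C g"]
    by (simp add: inner_L2_def cinner_cscale_right complex_eq_iff)
qed

text \<open>Translation turns into modulation and the Gaussian is self-dual. This exhibits every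
  packet as a Fourier transform.\<close>

lemma fourier_integral_gauss_translate:
  "fourier_integral (\<lambda>x. of_real (gauss 1 (x + p))) = packet p"
proof
  fix k
  have "(\<integral>x. exp (- (\<i> * of_real (k \<bullet> x))) * of_real (gauss 1 (x + p)) \<partial>lborel)
      = (\<integral>x. exp (- (\<i> * of_real (k \<bullet> (x - p)))) * of_real (gauss 1 x) \<partial>lborel)"
    using integral_similarity[of "\<lambda>x. x" 1 "\<lambda>x. exp (- (\<i> * of_real (k \<bullet> (x - p)))) * of_real (gauss 1 x)" p]
    by (simp add: add.commute linear_id[unfolded id_def])
  also have "\<dots> = (\<integral>x. exp (\<i> * of_real (k \<bullet> p)) * (exp (- (\<i> * of_real (k \<bullet> x))) * of_real (gauss 1 x)) \<partial>lborel)"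
    by (simp add: inner_diff_right algebra_simps exp_diff exp_minus divide_inverse)
  also have "\<dots> = exp (\<i> * of_real (k \<bullet> p)) * of_real (sqrt (2 * pi / 1) ^ DIM(quat) * exp (- ((norm k)\<^sup>2 / (2 * 1))))"
    by (simp only: integral_mult_right_zero gaussian_integral(2)[OF zero_less_one])
  also have "sqrt (2 * pi / 1) ^ DIM(quat) * exp (- ((norm k)\<^sup>2 / (2 * 1))) = (2 * pi)\<^sup>2 * gauss 1 k"
    using power_mult[of "sqrt (2 * pi)" 2 2] by (simp add: gauss_def)
  finally show "fourier_integral (\<lambda>x. of_real (gauss 1 (x + p))) k = packet p k"
    by (simp add: fourier_integral_def packet_def inner_commute)
qed

section \<open>Existence and uniqueness of the unitary Fourier transform\<close>

definition is_fourier :: "(quat L2 \<Rightarrow> quat L2) \<Rightarrow> bool" where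
  "is_fourier F \<longleftrightarrow> unitary_op F \<and> (\<forall>f\<in>L1_L2. F f = fourier_L1_L2 f)"

text \<open>Both operators are prescribed on \<open>L1_L2\<close>, which contains the cutoffs of
  every vector, and isometries are continuous.\<close>

lemma is_fourier_unique:
  assumes "is_fourier F" "is_fourier G"
  shows "F = G"
proof
  fix f
  have "(\<lambda>n. F (ball_cutoff n f)) \<longlonglongrightarrow> F f" "(\<lambda>n. G (ball_cutoff n f)) \<longlonglongrightarrow> G f"
    using assms by (simp_all add: is_fourier_def tendsto_unitary_op[OF _ ball_cutoff_tendsto])
  moreover have "F (ball_cutoff n f) = G (ball_cutoff n f)" for n
    using assms ball_cutoff_L1_L2 by (simp add: is_fourier_def)
  ultimately show "F f = G f"
    using LIMSEQ_unique by simp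
qed

text \<open>Extension by continuity: by Plancherel the transforms of the cutoffs form a Cauchy
  sequence.\<close>

lemma is_fourier_exists: "\<exists>F. is_fourier F"
proof -
  define F where "F f = lim (\<lambda>n. fourier_L1_L2 (ball_cutoff n f))" for f
  have lim: "(\<lambda>n. fourier_L1_L2 (ball_cutoff n f)) \<longlonglongrightarrow> F f" for f
  proof -
    have "Cauchy (\<lambda>n. ball_cutoff n f)"
      using ball_cutoff_tendsto LIMSEQ_imp_Cauchy by blast
    then have "Cauchy (\<lambda>n. fourier_L1_L2 (ball_cutoff n f))"
      by (simp add: Cauchy_def dist_fourier_L1_L2 ball_cutoff_L1_L2)
    then show ?thesis
      unfolding F_def by (simp add: Cauchy_convergent_iff convergent_LIMSEQ_iff)
  qed
  have F_add: "F (f + g) = F f + F g" for f g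
  proof (rule LIMSEQ_unique[OF lim])
    show "(\<lambda>n. fourier_L1_L2 (ball_cutoff n (f + g))) \<longlonglongrightarrow> F f + F g"
      using tendsto_add[OF lim lim] by (simp add: ball_cutoff_add fourier_L1_L2_add ball_cutoff_L1_L2)
  qed
  have F_cscale: "F (c *\<^sub>C f) = c *\<^sub>C F f" for c f
  proof (rule LIMSEQ_unique[OF lim])
    show "(\<lambda>n. fourier_L1_L2 (ball_cutoff n (c *\<^sub>C f))) \<longlonglongrightarrow> c *\<^sub>C F f"
      using tendsto_cscale[OF lim] by (simp add: ball_cutoff_cscale fourier_L1_L2_cscale ball_cutoff_L1_L2)
  qed
  have F_norm: "norm (F f) = norm f" for f
  proof (rule LIMSEQ_unique[OF tendsto_norm[OF lim]])
    show "(\<lambda>n. norm (fourier_L1_L2 (ball_cutoff n f))) \<longlonglongrightarrow> norm f"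
      using tendsto_norm[OF ball_cutoff_tendsto] by (simp add: norm_fourier_L1_L2 ball_cutoff_L1_L2)
  qed
  have F_L1_L2: "F f = fourier_L1_L2 f" if "f \<in> L1_L2" for f
  proof (rule LIMSEQ_unique[OF lim])
    show "(\<lambda>n. fourier_L1_L2 (ball_cutoff n f)) \<longlonglongrightarrow> fourier_L1_L2 f"
      using ball_cutoff_tendsto[of f] that
      unfolding tendsto_iff by (simp add: dist_fourier_L1_L2 ball_cutoff_L1_L2)
  qed
  have F_lin: "clinear_op F"
    by (simp add: clinear_op_def F_add F_cscale)
  have F_dist: "dist (F f) (F g) = dist f g" for f g
  proof -
    have "F (f - g) = F f - F g"
      by (simp add: F_add F_cscale minus_L2_def uminus_L2_def)
    then show ?thesis
      by (metis dist_norm F_norm)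
  qed
  \<comment> \<open>An isometry need not be surjective. The range is closed because the domain is
    complete, and it contains every packet.\<close>
  have "range F = UNIV"
  proof (rule packet_total)
    have "F 0 = 0"
      using F_norm[of 0] by simp
    show "csubspace (range F)"
      unfolding csubspace_def
    proof (intro conjI ballI allI)
      show "0 \<in> range F"
        using \<open>F 0 = 0\<close> by (rule range_eqI[OF sym])
      show "f + g \<in> range F" if "f \<in> range F" "g \<in> range F" for f g
        using that by (auto simp flip: F_add)
      show "c *\<^sub>C f \<in> range F" if "f \<in> range F" for c f
        using that by (auto simp flip: F_cscale)
    qed
    show "closed (range F)"
      unfolding closed_sequential_limits
    proof (intro allI impI, elim conjE)
      fix Y h
      assume Y: "\<forall>n. Y n \<in> range F" "Y \<longlonglongrightarrow> h"
      then have "\<forall>n. \<exists>f. Y n = F f"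
        by (auto simp: image_iff)
      then obtain X where X: "\<And>n. Y n = F (X n)"
        using choice[of "\<lambda>n f. Y n = F f"] by auto
      have "Cauchy Y"
        using Y(2) LIMSEQ_imp_Cauchy by blast
      then have "Cauchy X"
        by (simp add: Cauchy_def X F_dist)
      then obtain f where "X \<longlonglongrightarrow> f"
        using Cauchy_convergent convergent_def by blast
      then have "(\<lambda>n. F (X n)) \<longlonglongrightarrow> F f"
        by (simp add: tendsto_iff F_dist)
      then have "Y \<longlonglongrightarrow> F f"
        unfolding X[symmetric] .
      then have "h = F f"
        by (rule LIMSEQ_unique[OF Y(2)])
      then show "h \<in> range F"
        by simp
    qed
    show "abs_L2 (packet p) \<in> range F" for p
    proof -
      define u where "u x = complex_of_real (gauss 1 (x + p))" for x
      have "square_integrable (U_fun (- p, qone) (packet 0))"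
        by (intro square_integrable_U_fun square_integrable_packet) simp
      then have sq: "square_integrable u"
        by (simp add: U_fun_def packet_def u_def[abs_def])
      have "integrable lborel (\<lambda>x. packet 0 (p + x))"
        using integrable_similarity[of "\<lambda>x. x" 1 "packet 0" p]
        by (simp add: integrable_packet linear_id[unfolded id_def])
      then have "integrable lborel u"
        by (simp add: packet_def u_def[abs_def] add.commute)
      then have "F (abs_L2 u) = abs_L2 (packet p)"
        using sq by (simp add: F_L1_L2 L1_L2_abs fourier_L1_L2_abs u_def[abs_def] fourier_integral_gauss_translate)
      then show ?thesis
        by (metis rangeI)
    qed
  qed
  then have "is_fourier F"
    by (simp add: is_fourier_def unitary_op_def F_lin clinear_isometry_cinner F_norm F_L1_L2)
  then show ?thesis by blast
qed

lemma is_fourier_fourier: "is_fourier fourier"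
proof -
  have eq: "F f = fourier_L1_L2 f \<longleftrightarrow> (AE k in lborel. rep_L2 (F f) k = fourier_integral (rep_L2 f) k)"
    if f: "f \<in> L1_L2" for F f
  proof
    assume "F f = fourier_L1_L2 f"
    then show "AE k in lborel. rep_L2 (F f) k = fourier_integral (rep_L2 f) k"
      by (simp add: fourier_L1_L2_def rep_abs_L2 square_integrable_fourier_rep f)
  next
    assume "AE k in lborel. rep_L2 (F f) k = fourier_integral (rep_L2 f) k"
    then have "AE k in lborel. rep_L2 (F f) k = rep_L2 (fourier_L1_L2 f) k"
      using rep_abs_L2[OF square_integrable_fourier_rep[OF f], folded fourier_L1_L2_def]
      by eventually_elim simp
    then show "F f = fourier_L1_L2 f"
      by (rule L2_eqI)
  qed
  have "unitary_op F \<and> (\<forall>f. integrable lborel (rep_L2 f) \<longrightarrow>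
        (AE k in lborel. rep_L2 (F f) k = fourier_integral (rep_L2 f) k)) \<longleftrightarrow> is_fourier F" for F
    unfolding is_fourier_def using eq[of _ F] by (auto simp: L1_L2_def)
  then have "fourier = (THE F. is_fourier F)"
    unfolding fourier_def by (simp only:)
  moreover have "\<exists>!F. is_fourier F"
    by (rule ex_ex1I[OF is_fourier_exists is_fourier_unique])
  ultimately show ?thesis
    using theI'[of is_fourier] by simp
qed

lemma unitary_op_fourier: "unitary_op fourier"
  using is_fourier_fourier by (simp add: is_fourier_def)

lemma fourier_eq_L1_L2: "f \<in> L1_L2 \<Longrightarrow> fourier f = fourier_L1_L2 f"
  using is_fourier_fourier by (simp add: is_fourier_def)

section \<open>The representation in the Fourier domain\<close>

lemma borel_measurable_qmult [measurable]:
  assumes "f \<in> borel_measurable M" "g \<in> borel_measurable M"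
  shows "(\<lambda>x. f x \<odot> g x) \<in> borel_measurable M"
proof (rule borel_measurable_continuous_Pair[OF assms])
  show "continuous_on UNIV (\<lambda>x. fst x \<odot> snd x)"
    by (intro continuous_intros)
qed

lemma borel_measurable_qconj [measurable]:
  assumes "f \<in> borel_measurable M"
  shows "(\<lambda>x. qconj (f x)) \<in> borel_measurable M"
proof -
  have "qconj \<in> borel_measurable borel"
    by (intro borel_measurable_continuous_onI continuous_intros)
  then show ?thesis
    using measurable_compose[OF assms] by blast
qed

lemma square_integrable_modulate:
  assumes "square_integrable \<phi>"
  shows "square_integrable (\<lambda>k. exp (- (\<i> * of_real (k \<bullet> b))) * \<phi> k)"
proof -
  have [measurable]: "\<phi> \<in> borel_measurable borel"
    using assms by (simp add: square_integrable_def)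
  have "(\<lambda>k. exp (- (\<i> * of_real (k \<bullet> b))) * \<phi> k) \<in> borel_measurable borel"
    by measurable
  then show ?thesis
    using assms by (simp add: square_integrable_def norm_mult)
qed

definition modulate :: "quat \<Rightarrow> quat L2 \<Rightarrow> quat L2" where
  "modulate b f = abs_L2 (\<lambda>k. exp (- (\<i> * of_real (k \<bullet> b))) * rep_L2 f k)"

lemma rep_modulate:
  "AE k in lborel. rep_L2 (modulate b f) k = exp (- (\<i> * of_real (k \<bullet> b))) * rep_L2 f k"
  unfolding modulate_def by (intro rep_abs_L2 square_integrable_modulate square_integrable_rep_L2)

lemma modulate_abs_L2:
  assumes "square_integrable \<phi>"
  shows "modulate b (abs_L2 \<phi>) = abs_L2 (\<lambda>k. exp (- (\<i> * of_real (k \<bullet> b))) * \<phi> k)"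
proof (rule L2_eqI)
  show "AE k in lborel. rep_L2 (modulate b (abs_L2 \<phi>)) k
      = rep_L2 (abs_L2 (\<lambda>k. exp (- (\<i> * of_real (k \<bullet> b))) * \<phi> k)) k"
    using rep_modulate[of b "abs_L2 \<phi>"] rep_abs_L2[OF assms]
      rep_abs_L2[OF square_integrable_modulate[OF assms, of b]]
    by eventually_elim simp
qed

lemma dist_modulate: "dist (modulate b f) (modulate b g) = dist f g"
proof -
  have "(norm (modulate b f - modulate b g))\<^sup>2 = (norm (f - g))\<^sup>2"
    unfolding norm_L2_square
  proof (rule integral_cong_AE)
    show "AE k in lborel. (cmod (rep_L2 (modulate b f - modulate b g) k))\<^sup>2 = (cmod (rep_L2 (f - g) k))\<^sup>2"
      using rep_L2_diff[of "modulate b f" "modulate b g"] rep_L2_diff[of f g]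
        rep_modulate[of b f] rep_modulate[of b g]
      by eventually_elim (simp add: norm_mult flip: right_diff_distrib)
  qed simp_all
  then show ?thesis
    by (simp add: dist_norm power2_eq_iff_nonneg)
qed

text \<open>With \<open>y = qinv a \<odot> (x - b)\<close>, the exponent
  \<open>k \<bullet> x\<close> splits into \<open>k \<bullet> b\<close> and the pairing of
  \<open>qconj a \<odot> k\<close> with \<open>y\<close>; the factor |a|^4 of the substitution and
  the prefactor |a|^(-2) leave |a|^2.\<close>

lemma fourier_integral_U_fun:
  assumes a: "a \<noteq> 0" and [measurable]: "\<phi> \<in> borel_measurable borel"
  shows "fourier_integral (U_fun (b, a) \<phi>) k
    = of_real ((norm a)\<^sup>2) * (exp (- (\<i> * of_real (k \<bullet> b))) * fourier_integral \<phi> (qconj a \<odot> k))"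
proof -
  define h where "h y = of_real (1 / (norm a)\<^sup>2) * exp (- (\<i> * of_real (k \<bullet> b))) *
      (exp (- (\<i> * of_real ((qconj a \<odot> k) \<bullet> y))) * \<phi> y)" for y
  have [measurable]: "h \<in> borel_measurable borel"
    unfolding h_def by measurable
  have "exp (- (\<i> * of_real (k \<bullet> x))) * U_fun (b, a) \<phi> x = h (qinv a \<odot> (x - b))" for x
  proof -
    have "(qconj a \<odot> k) \<bullet> (qinv a \<odot> (x - b)) = k \<bullet> x - k \<bullet> b"
      using a by (simp add: inner_qmult[symmetric] qmult_qinv_cancel inner_diff_right)
    then have "- (\<i> * of_real (k \<bullet> x)) = - (\<i> * of_real (k \<bullet> b)) + - (\<i> * of_real ((qconj a \<odot> k) \<bullet> (qinv a \<odot> (x - b))))"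
      by (simp only: of_real_diff) (simp add: algebra_simps)
    then have "exp (- (\<i> * of_real (k \<bullet> x))) = exp (- (\<i> * of_real (k \<bullet> b))) * exp (- (\<i> * of_real ((qconj a \<odot> k) \<bullet> (qinv a \<odot> (x - b)))))"
      by (simp only: exp_add)
    then show ?thesis
      by (simp add: h_def U_fun_def)
  qed
  then have "(\<integral>x. exp (- (\<i> * of_real (k \<bullet> x))) * U_fun (b, a) \<phi> x \<partial>lborel) = norm a ^ 4 *\<^sub>R (\<integral>y. h y \<partial>lborel)"
    using integral_U_substitution[OF a, of h b] by simp
  also have "\<dots> = of_real (norm a ^ 4 * (1 / (norm a)\<^sup>2)) * (exp (- (\<i> * of_real (k \<bullet> b))) *
      (\<integral>y. exp (- (\<i> * of_real ((qconj a \<odot> k) \<bullet> y))) * \<phi> y \<partial>lborel))"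
    unfolding h_def integral_mult_right_zero by (simp add: scaleR_conv_of_real)
  also have "norm a ^ 4 * (1 / (norm a)\<^sup>2) = (norm a)\<^sup>2"
    using a by (simp add: field_simps flip: power_add)
  finally show ?thesis
    by (simp add: fourier_integral_def)
qed

lemma U_C_L1_L2:
  assumes a: "a \<noteq> 0" and f: "f \<in> L1_L2"
  shows "integrable lborel (U_fun (b, a) (rep_L2 f))"
proof -
  have "integrable lborel (\<lambda>x. rep_L2 f (- (qinv a \<odot> b) + qinv a \<odot> x))"
    using a f by (intro integrable_similarity[OF linear_qmult, of _ "1 / norm a"])
      (simp_all add: norm_qmult norm_qinv L1_L2_def)
  then show ?thesis
    by (simp add: U_fun_def qmult_algebra)
qed

text \<open>The frequency dilation is the representation itself at another group element, so its
  unitarity and square-integrability need no separate proof.\<close>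

lemma U_fun_dilation:
  "a \<noteq> 0 \<Longrightarrow> U_fun (0, qinv (qconj a)) \<phi> k = of_real ((norm a)\<^sup>2) * \<phi> (qconj a \<odot> k)"
  by (simp add: U_fun_def norm_qinv power_one_over)

text \<open>The Fourier integral gives the identity on \<open>L1_L2\<close>; both sides are
  isometric in \<open>f\<close>, so it survives the limit of the cutoffs.\<close>

lemma fourier_U_C:
  assumes a: "a \<noteq> 0"
  shows "fourier (U_C (b, a) f) = modulate b (U_C (0, qinv (qconj a)) (fourier f))"
proof -
  have car: "(b, a) \<in> carrier Gaff" "(0, qinv (qconj a)) \<in> carrier Gaff"
    using a by simp_all
  have L1_L2: "fourier (U_C (b, a) h) = modulate b (U_C (0, qinv (qconj a)) (fourier h))" if h: "h \<in> L1_L2" for h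
  proof -
    let ?\<phi> = "rep_L2 h"
    have sq: "square_integrable (U_fun (b, a) ?\<phi>)"
      by (intro square_integrable_U_fun car square_integrable_rep_L2)
    have sq': "square_integrable (U_fun (0, qinv (qconj a)) (fourier_integral ?\<phi>))"
      by (intro square_integrable_U_fun car square_integrable_fourier_rep h)
    have "fourier (U_C (b, a) h) = abs_L2 (fourier_integral (U_fun (b, a) ?\<phi>))"
      unfolding U_C_def using sq U_C_L1_L2[OF a h, of b]
      by (simp add: fourier_eq_L1_L2 L1_L2_abs fourier_L1_L2_abs)
    also have "fourier_integral (U_fun (b, a) ?\<phi>)
        = (\<lambda>k. exp (- (\<i> * of_real (k \<bullet> b))) * U_fun (0, qinv (qconj a)) (fourier_integral ?\<phi>) k)"
      by (rule ext) (simp only: fourier_integral_U_fun[OF a borel_measurable_rep_L2] U_fun_dilation[OF a] mult_ac)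
    also have "abs_L2 \<dots> = modulate b (abs_L2 (U_fun (0, qinv (qconj a)) (fourier_integral ?\<phi>)))"
      by (rule modulate_abs_L2[OF sq', symmetric])
    also have "abs_L2 (U_fun (0, qinv (qconj a)) (fourier_integral ?\<phi>)) = U_C (0, qinv (qconj a)) (fourier h)"
      by (simp add: fourier_eq_L1_L2 fourier_L1_L2_def h U_C_abs_L2[OF car(2) square_integrable_fourier_rep])
    finally show ?thesis .
  qed
  have "(\<lambda>n. fourier (U_C (b, a) (ball_cutoff n f))) \<longlonglongrightarrow> fourier (U_C (b, a) f)"
    by (rule tendsto_unitary_op[OF unitary_op_fourier tendsto_unitary_op[OF unitary_op_U_C[OF car(1)] ball_cutoff_tendsto]])
  moreover have "(\<lambda>n. fourier (U_C (b, a) (ball_cutoff n f))) \<longlonglongrightarrow> modulate b (U_C (0, qinv (qconj a)) (fourier f))"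
    using ball_cutoff_tendsto[of f] unfolding L1_L2[OF ball_cutoff_L1_L2] tendsto_iff
    by (simp add: dist_modulate dist_unitary_op[OF unitary_op_U_C[OF car(2)]] dist_unitary_op[OF unitary_op_fourier])
  ultimately show ?thesis
    by (rule LIMSEQ_unique)
qed

definition hat :: "quat L2 \<Rightarrow> quat \<Rightarrow> complex" where
  "hat f = rep_L2 (fourier f)"

lemma borel_measurable_hat [measurable]: "hat f \<in> borel_measurable borel"
  by (simp add: hat_def)

lemma square_integrable_hat: "square_integrable (hat f)"
  by (simp add: hat_def square_integrable_rep_L2)

lemma nn_integral_hat: "(\<integral>\<^sup>+k. ennreal ((cmod (hat f k))\<^sup>2) \<partial>lborel) = ennreal ((norm f)\<^sup>2)"
  by (simp add: hat_def ennreal_norm_L2 norm_unitary_op[OF unitary_op_fourier])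

definition coeff_density :: "quat L2 \<Rightarrow> quat L2 \<Rightarrow> quat \<Rightarrow> quat \<Rightarrow> complex" where
  "coeff_density f \<eta> a k = cnj (hat f k) * hat \<eta> (qconj a \<odot> k)"

lemma borel_measurable_coeff_density [measurable]:
  "(\<lambda>(a, k). coeff_density f \<eta> a k) \<in> borel_measurable (borel \<Otimes>\<^sub>M borel)"
  "coeff_density f \<eta> a \<in> borel_measurable borel"
proof -
  note [measurable] = cnj_measurable
  show "(\<lambda>(a, k). coeff_density f \<eta> a k) \<in> borel_measurable (borel \<Otimes>\<^sub>M borel)"
    "coeff_density f \<eta> a \<in> borel_measurable borel"
    unfolding coeff_density_def by measurable
qed

lemma square_integrable_dilation:
  assumes a: "a \<noteq> 0" and \<phi>: "square_integrable \<phi>"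
  shows "square_integrable (\<lambda>k. \<phi> (qconj a \<odot> k))"
proof -
  have "square_integrable (U_fun (0, qinv (qconj a)) \<phi>)"
    using a by (intro square_integrable_U_fun \<phi>) simp
  from square_integrable_cmult[OF this, of "of_real (1 / (norm a)\<^sup>2)"] show ?thesis
    using a by (simp add: U_fun_dilation)
qed

lemma integrable_coeff_density: "a \<noteq> 0 \<Longrightarrow> integrable lborel (coeff_density f \<eta> a)"
  unfolding coeff_density_def[abs_def]
  by (intro square_integrable_mult square_integrable_hat square_integrable_dilation)

text \<open>In the Fourier domain a translation is a character, so \<open>b\<close> becomes the
  variable of a Fourier integral. The factor \<open>(2 * pi)\<^sup>2\<close> undoes the
  normalization of \<open>fourier_integral\<close>, and |a|^2 belongs to the unitary
  dilation.\<close>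

lemma cinner_U_C_eq_fourier_integral:
  assumes a: "a \<noteq> 0"
  shows "\<langle>f | U_C (b, a) \<eta>\<rangle>
    = of_real ((2 * pi)\<^sup>2 * (norm a)\<^sup>2) * fourier_integral (coeff_density f \<eta> a) b"
proof -
  have car: "(0, qinv (qconj a)) \<in> carrier Gaff"
    using a by simp
  have "\<langle>f | U_C (b, a) \<eta>\<rangle> = \<langle>fourier f | fourier (U_C (b, a) \<eta>)\<rangle>"
    by (simp add: unitary_op_cinner[OF unitary_op_fourier])
  also have "\<dots> = (\<integral>k. cnj (hat f k) *
      (exp (- (\<i> * of_real (k \<bullet> b))) * U_fun (0, qinv (qconj a)) (hat \<eta>) k) \<partial>lborel)"
  proof (rule cinner_cong)
    show "AE k in lborel. rep_L2 (fourier (U_C (b, a) \<eta>)) k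
        = exp (- (\<i> * of_real (k \<bullet> b))) * U_fun (0, qinv (qconj a)) (hat \<eta>) k"
      unfolding fourier_U_C[OF a]
      using rep_modulate[of b "U_C (0, qinv (qconj a)) (fourier \<eta>)"] rep_L2_U_C[OF car, of "fourier \<eta>"]
      by eventually_elim (simp add: hat_def)
  qed (auto simp: hat_def intro!: square_integrable_modulate square_integrable_U_fun car square_integrable_rep_L2)
  also have "\<dots> = (\<integral>k. of_real ((norm a)\<^sup>2) * (exp (- (\<i> * of_real (b \<bullet> k))) * coeff_density f \<eta> a k) \<partial>lborel)"
    by (rule Bochner_Integration.integral_cong[OF refl])
      (simp add: U_fun_dilation[OF a] coeff_density_def inner_commute[of b])
  also have "\<dots> = of_real ((2 * pi)\<^sup>2 * (norm a)\<^sup>2) * fourier_integral (coeff_density f \<eta> a) b"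
    unfolding fourier_integral_def integral_mult_right_zero by simp
  finally show ?thesis .
qed

section \<open>Integration over the group\<close>

lemma nn_integral_dilation:
  fixes \<psi> :: "quat \<Rightarrow> ennreal"
  assumes [measurable]: "\<psi> \<in> borel_measurable borel" and k: "k \<noteq> 0"
  shows "(\<integral>\<^sup>+a. \<psi> (qconj a \<odot> k) * ennreal (1 / norm a ^ 4) \<partial>lborel)
    = (\<integral>\<^sup>+p. \<psi> p * ennreal (1 / norm p ^ 4) \<partial>lborel)"
proof -
  \<comment> \<open>The factor \<open>|k|\<^sup>4\<close> cancels the Jacobian of \<open>a \<mapsto> a\<^sup>* k\<close>.\<close>
  define h where "h p = \<psi> p * ennreal (norm k ^ 4 / norm p ^ 4)" for p
  have [measurable]: "h \<in> borel_measurable borel"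
    unfolding h_def by measurable
  have lin: "linear (\<lambda>a. qconj a \<odot> k)"
    using linear_compose[OF linear_qconj, of "\<lambda>p. p \<odot> k"] bilinear_qmult
    by (simp add: bilinear_def comp_def)
  have "\<psi> (qconj a \<odot> k) * ennreal (1 / norm a ^ 4) = h (0 + qconj a \<odot> k)" for a
    using k by (simp add: h_def norm_qmult power_mult_distrib)
  then have "(\<integral>\<^sup>+a. \<psi> (qconj a \<odot> k) * ennreal (1 / norm a ^ 4) \<partial>lborel)
      = (\<integral>\<^sup>+a. h (0 + qconj a \<odot> k) \<partial>lborel)"
    by simp
  also have "\<dots> = ennreal (1 / norm k ^ CARD(4)) * (\<integral>\<^sup>+p. h p \<partial>lborel)"
    using k by (intro nn_integral_similarity lin) (auto simp: norm_qmult)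
  also have "\<dots> = (\<integral>\<^sup>+p. ennreal (1 / norm k ^ 4) * h p \<partial>lborel)"
    by (simp add: nn_integral_cmult)
  also have "\<dots> = (\<integral>\<^sup>+p. \<psi> p * ennreal (1 / norm p ^ 4) \<partial>lborel)"
  proof (rule nn_integral_cong)
    fix p :: quat
    have "ennreal (1 / norm k ^ 4) * ennreal (norm k ^ 4 / norm p ^ 4) = ennreal (1 / norm p ^ 4)"
      using k by (simp flip: ennreal_mult')
    then show "ennreal (1 / norm k ^ 4) * h p = \<psi> p * ennreal (1 / norm p ^ 4)"
      by (simp add: h_def mult.left_commute)
  qed
  finally show ?thesis .
qed

text \<open>After Tonelli the integral over \<open>a\<close> has the same value for every nonzero
  \<open>k\<close>, because da/|a|^4 is invariant on the multiplicative group; it therefore factors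
  out. The origin is a null set.\<close>

lemma nn_integral_product_dilation:
  fixes \<phi> \<psi> :: "quat \<Rightarrow> ennreal"
  assumes [measurable]: "\<phi> \<in> borel_measurable borel" "\<psi> \<in> borel_measurable borel"
  shows "(\<integral>\<^sup>+a. ennreal (1 / norm a ^ 4) * (\<integral>\<^sup>+k. \<phi> k * \<psi> (qconj a \<odot> k) \<partial>lborel) \<partial>lborel)
    = (\<integral>\<^sup>+k. \<phi> k \<partial>lborel) * (\<integral>\<^sup>+p. \<psi> p * ennreal (1 / norm p ^ 4) \<partial>lborel)"
proof -
  have "(\<integral>\<^sup>+a. ennreal (1 / norm a ^ 4) * (\<integral>\<^sup>+k. \<phi> k * \<psi> (qconj a \<odot> k) \<partial>lborel) \<partial>lborel)
      = (\<integral>\<^sup>+a. \<integral>\<^sup>+k. \<phi> k * (\<psi> (qconj a \<odot> k) * ennreal (1 / norm a ^ 4)) \<partial>lborel \<partial>lborel)"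
    by (simp add: mult_ac flip: nn_integral_cmult)
  also have "\<dots> = (\<integral>\<^sup>+k. \<integral>\<^sup>+a. \<phi> k * (\<psi> (qconj a \<odot> k) * ennreal (1 / norm a ^ 4)) \<partial>lborel \<partial>lborel)"
    by (rule lborel_pair.Fubini') measurable
  also have "\<dots> = (\<integral>\<^sup>+k. \<phi> k * (\<integral>\<^sup>+p. \<psi> p * ennreal (1 / norm p ^ 4) \<partial>lborel) \<partial>lborel)"
  proof (rule nn_integral_cong_AE, use AE_lborel_singleton[of 0] in eventually_elim)
    case (elim k)
    then show ?case
      using nn_integral_dilation[of \<psi> k] by (simp add: nn_integral_cmult)
  qed
  also have "\<dots> = (\<integral>\<^sup>+k. \<phi> k \<partial>lborel) * (\<integral>\<^sup>+p. \<psi> p * ennreal (1 / norm p ^ 4) \<partial>lborel)"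
    by (rule nn_integral_multc) measurable
  finally show ?thesis .
qed

section \<open>Tonelli's theorem for the left Haar measure\<close>

lemma space_haar_Gaff: "space haar_Gaff = carrier Gaff"
  by (simp add: haar_Gaff_def space_restrict_space space_pair_measure)

lemma carrier_Gaff_borel: "carrier Gaff \<in> sets (borel \<Otimes>\<^sub>M borel)"
proof -
  have "{p \<in> space (borel \<Otimes>\<^sub>M borel). snd p \<noteq> (0 :: quat)} \<in> sets (borel \<Otimes>\<^sub>M (borel :: quat measure))"
    by measurable
  then show ?thesis
    by (simp add: Gaff_def space_pair_measure case_prod_beta')
qed

lemma borel_measurable_haar_Gaff:
  "F \<in> borel_measurable (borel \<Otimes>\<^sub>M borel) \<Longrightarrow> F \<in> borel_measurable haar_Gaff"
  unfolding haar_Gaff_def measurable_density_eq1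
  by (intro measurable_restrict_space1)
    (simp cong: measurable_cong_sets sets_pair_measure_cong)

text \<open>The integral over \<open>b\<close> is innermost because Plancherel is applied in
  \<open>b\<close> for each fixed \<open>a\<close>.\<close>

lemma nn_integral_haar_Gaff:
  assumes [measurable]: "F \<in> borel_measurable (borel \<Otimes>\<^sub>M borel)"
  shows "(\<integral>\<^sup>+g. F g \<partial>haar_Gaff)
    = (\<integral>\<^sup>+a. \<integral>\<^sup>+b. ennreal (1 / norm a ^ 8) * F (b, a) \<partial>lborel \<partial>lborel)"
proof -
  have sets [measurable_cong]: "sets (lborel \<Otimes>\<^sub>M lborel) = sets (borel \<Otimes>\<^sub>M (borel :: quat measure))"
    by (simp cong: sets_pair_measure_cong)
  define G where "G = (\<lambda>g :: quat \<times> quat. ennreal (1 / norm (snd g) ^ 8))"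
  have [measurable]: "G \<in> borel_measurable (borel \<Otimes>\<^sub>M borel)"
    unfolding G_def by measurable
  have res: "H \<in> borel_measurable (restrict_space (lborel \<Otimes>\<^sub>M lborel) (carrier Gaff))"
    if "H \<in> borel_measurable (borel \<Otimes>\<^sub>M borel)" for H :: "quat \<times> quat \<Rightarrow> ennreal"
    using that by (intro measurable_restrict_space1) (simp cong: measurable_cong_sets add: sets)
  have "(\<integral>\<^sup>+g. F g \<partial>haar_Gaff) = (\<integral>\<^sup>+g. G g * F g \<partial>restrict_space (lborel \<Otimes>\<^sub>M lborel) (carrier Gaff))"
  proof -
    have eq: "(\<lambda>(b, a). ennreal (1 / norm a ^ 8)) = G"
      by (auto simp: G_def)
    show ?thesis
      unfolding haar_Gaff_def eq by (intro nn_integral_density res) measurable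
  qed
  also have "\<dots> = (\<integral>\<^sup>+g. G g * F g * indicator (carrier Gaff) g \<partial>(lborel \<Otimes>\<^sub>M lborel))"
    by (rule nn_integral_restrict_space) (simp add: sets space_pair_measure carrier_Gaff_borel)
  also have "\<dots> = (\<integral>\<^sup>+g. G g * F g \<partial>(lborel \<Otimes>\<^sub>M lborel))"
    by (rule nn_integral_cong) (auto simp: G_def Gaff_def indicator_def)
  also have "\<dots> = (\<integral>\<^sup>+a. \<integral>\<^sup>+b. G (b, a) * F (b, a) \<partial>lborel \<partial>lborel)"
    by (rule lborel_pair.nn_integral_snd[symmetric]) measurable
  finally show ?thesis
    by (simp add: G_def)
qed

text \<open>This agrees with \<open>\<langle>f | U_C (b, a) \<eta>\<rangle>\<close> on the group, but is Borel on all of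
  \<open>\<real>\<^sup>4 \<times> \<real>\<^sup>4\<close>, which is what Tonelli's theorem needs.\<close>

definition coefficient :: "quat L2 \<Rightarrow> quat L2 \<Rightarrow> quat \<times> quat \<Rightarrow> complex" where
  "coefficient f \<eta> = (\<lambda>(b, a). of_real ((2 * pi)\<^sup>2 * (norm a)\<^sup>2) * fourier_integral (coeff_density f \<eta> a) b)"

lemma coefficient_eq: "g \<in> carrier Gaff \<Longrightarrow> coefficient f \<eta> g = \<langle>f | U_C g \<eta>\<rangle>"
  by (cases g) (simp add: coefficient_def cinner_U_C_eq_fourier_integral)

lemma borel_measurable_coefficient [measurable]:
  "coefficient f \<eta> \<in> borel_measurable (borel \<Otimes>\<^sub>M borel)"
proof -
  have [measurable]: "(\<lambda>p. coeff_density f \<eta> (fst p) (snd p)) \<in> borel_measurable (borel \<Otimes>\<^sub>M borel)"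
    using borel_measurable_coeff_density(1)[of f \<eta>] by (simp add: case_prod_beta')
  have [measurable]: "(\<lambda>p. coeff_density f \<eta> (snd (fst p)) (snd p)) \<in> borel_measurable ((borel \<Otimes>\<^sub>M borel) \<Otimes>\<^sub>M borel)"
    by (rule measurable_compose[of "\<lambda>p. (snd (fst p), snd p)", OF _ borel_measurable_coeff_density(1), unfolded prod.case]) measurable
  show ?thesis
    unfolding coefficient_def case_prod_beta' fourier_integral_def by measurable
qed

text \<open>The integrand vanishes at \<open>p = 0\<close>, since \<open>1 / 0 = 0\<close>.\<close>

definition C_weight :: "quat L2 \<Rightarrow> ennreal" where
  "C_weight \<eta> = (\<integral>\<^sup>+p. ennreal ((cmod (hat \<eta> p))\<^sup>2) * ennreal (1 / norm p ^ 4) \<partial>lborel)"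

lemma C_weight_eq: "C_weight \<eta> = (\<integral>\<^sup>+k. ennreal ((cmod (rep_L2 (fourier \<eta>) k))\<^sup>2 / norm k ^ 4) \<partial>lborel)"
  unfolding C_weight_def hat_def by (simp flip: ennreal_mult')

lemma C_dom_iff: "\<eta> \<in> C_dom \<longleftrightarrow> C_weight \<eta> < \<infinity>"
  unfolding C_dom_def C_weight_eq by (auto simp: ennreal_mult_less_top)

text \<open>The value infinity is allowed, so that irreducibility can use this for arbitrary
  \<open>\<eta>\<close> and not only within \<open>C_dom\<close>.\<close>

lemma nn_integral_coeff_density:
  "(\<integral>\<^sup>+a. ennreal (1 / norm a ^ 4) * (\<integral>\<^sup>+k. ennreal ((cmod (coeff_density f \<eta> a k))\<^sup>2) \<partial>lborel) \<partial>lborel)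
    = ennreal ((norm f)\<^sup>2) * C_weight \<eta>"
  using nn_integral_product_dilation[of "\<lambda>k. ennreal ((cmod (hat f k))\<^sup>2)" "\<lambda>k. ennreal ((cmod (hat \<eta> k))\<^sup>2)"]
  by (simp add: coeff_density_def norm_mult power_mult_distrib ennreal_mult nn_integral_hat C_weight_def)

text \<open>Plancherel in \<open>b\<close> requires a square-integrable coefficient density.
  Membership of \<open>\<eta>\<close> in \<open>C_dom\<close> makes the integral over
  \<open>a\<close> finite and so provides this for almost every \<open>a\<close>.\<close>

lemma nn_integral_coefficient:
  assumes \<eta>: "\<eta> \<in> C_dom"
  shows "(\<integral>\<^sup>+g. ennreal ((cmod (coefficient f \<eta> g))\<^sup>2) \<partial>haar_Gaff)
    = ennreal ((norm f)\<^sup>2) * (ennreal ((2 * pi) ^ 4) * C_weight \<eta>)"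
proof -
  have "(\<integral>\<^sup>+a. ennreal (1 / norm a ^ 4) * (\<integral>\<^sup>+k. ennreal ((cmod (coeff_density f \<eta> a k))\<^sup>2) \<partial>lborel) \<partial>lborel) \<noteq> \<infinity>"
    using \<eta> unfolding nn_integral_coeff_density C_dom_iff by (auto simp: ennreal_mult_eq_top_iff)
  then have fin: "AE a in lborel. ennreal (1 / norm a ^ 4) * (\<integral>\<^sup>+k. ennreal ((cmod (coeff_density f \<eta> a k))\<^sup>2) \<partial>lborel) \<noteq> \<infinity>"
    by (intro nn_integral_PInf_AE) measurable
  have "(\<integral>\<^sup>+g. ennreal ((cmod (coefficient f \<eta> g))\<^sup>2) \<partial>haar_Gaff)
      = (\<integral>\<^sup>+a. \<integral>\<^sup>+b. ennreal (1 / norm a ^ 8) * ennreal ((cmod (coefficient f \<eta> (b, a)))\<^sup>2) \<partial>lborel \<partial>lborel)"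
    by (rule nn_integral_haar_Gaff) measurable
  also have "\<dots> = (\<integral>\<^sup>+a. ennreal ((2 * pi) ^ 4) * (ennreal (1 / norm a ^ 4) *
      (\<integral>\<^sup>+k. ennreal ((cmod (coeff_density f \<eta> a k))\<^sup>2) \<partial>lborel)) \<partial>lborel)"
  proof (rule nn_integral_cong_AE, use AE_lborel_singleton[of 0] fin in eventually_elim)
    case (elim a)
    have int: "integrable lborel (coeff_density f \<eta> a)"
      using elim(1) by (rule integrable_coeff_density)
    have "(\<integral>\<^sup>+k. ennreal ((cmod (coeff_density f \<eta> a k))\<^sup>2) \<partial>lborel) < \<infinity>"
      using elim by (simp add: ennreal_mult_eq_top_iff less_top)
    then have sq: "square_integrable (coeff_density f \<eta> a)"
      by (simp add: square_integrable_iff)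
    \<comment> \<open>The Haar density |a|^(-8) meets the square of |a|^2 from the coefficient and
      leaves the invariant weight |a|^(-4).\<close>
    have "1 / norm a ^ 8 * ((2 * pi)\<^sup>2 * (norm a)\<^sup>2)\<^sup>2 = (2 * pi) ^ 4 * (1 / norm a ^ 4)"
      using elim(1) by (simp add: field_simps flip: power_add power_mult)
    then have "1 / norm a ^ 8 * (cmod (coefficient f \<eta> (b, a)))\<^sup>2
        = (2 * pi) ^ 4 * (1 / norm a ^ 4) * (cmod (fourier_integral (coeff_density f \<eta> a) b))\<^sup>2" for b
      by (simp only: coefficient_def prod.case norm_mult norm_of_real power_mult_distrib power2_abs mult.assoc[symmetric])
    then have "ennreal (1 / norm a ^ 8) * ennreal ((cmod (coefficient f \<eta> (b, a)))\<^sup>2)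
        = ennreal ((2 * pi) ^ 4 * (1 / norm a ^ 4)) * ennreal ((cmod (fourier_integral (coeff_density f \<eta> a) b))\<^sup>2)" for b
      by (simp flip: ennreal_mult' del: times_divide_eq_left times_divide_eq_right)
    then have "(\<integral>\<^sup>+b. ennreal (1 / norm a ^ 8) * ennreal ((cmod (coefficient f \<eta> (b, a)))\<^sup>2) \<partial>lborel)
        = ennreal ((2 * pi) ^ 4 * (1 / norm a ^ 4)) * (\<integral>\<^sup>+b. ennreal ((cmod (fourier_integral (coeff_density f \<eta> a) b))\<^sup>2) \<partial>lborel)"
      by (simp add: nn_integral_cmult)
    moreover have "ennreal ((2 * pi) ^ 4 * (1 / norm a ^ 4)) = ennreal ((2 * pi) ^ 4) * ennreal (1 / norm a ^ 4)"
      by (rule ennreal_mult') simp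
    ultimately show ?case
      unfolding Plancherel_fourier_integral[OF int sq] by (simp only: mult.assoc)
  qed
  also have "\<dots> = ennreal ((2 * pi) ^ 4) * (ennreal ((norm f)\<^sup>2) * C_weight \<eta>)"
    by (simp add: nn_integral_cmult nn_integral_coeff_density)
  finally show ?thesis
    by (simp only: mult_ac)
qed

section \<open>Irreducibility\<close>

lemma exists_nonzero_L2: "\<exists>f :: quat L2. f \<noteq> 0"
proof
  have "(gauss 1 x)\<^sup>2 = gauss 2 x" for x :: quat
    by (simp add: gauss_def power2_eq_square flip: exp_add)
  then have "ennreal ((norm (abs_L2 (packet 0)))\<^sup>2) = (\<integral>\<^sup>+x. ennreal (gauss 2 (x :: quat)) \<partial>lborel)"
    using ennreal_norm_abs_L2[OF square_integrable_packet[of 0]] by simp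
  also have "\<dots> = ennreal (\<integral>x. gauss 2 (x :: quat) \<partial>lborel)"
    by (rule nn_integral_eq_integral) (simp_all add: integrable_gauss)
  finally have "ennreal ((norm (abs_L2 (packet 0)))\<^sup>2) = ennreal (\<integral>x. gauss 2 (x :: quat) \<partial>lborel)" .
  then show "abs_L2 (packet 0) \<noteq> 0"
    using integral_gauss[where 'a = quat, of 2] by auto
qed

text \<open>A proper nonzero invariant subspace would contain some \<open>\<eta> \<noteq> 0\<close>
  and be orthogonal to some \<open>f \<noteq> 0\<close>. All coefficients then vanish, hence so does
  the product of \<open>(norm f)\<^sup>2\<close> and \<open>C_weight \<eta>\<close>; as 1/|p|^4 is
  positive off the origin, \<open>\<eta>\<close> would be 0.\<close>

theorem irreducible_rep_U_C: "irreducible_rep Gaff U_C"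
  unfolding irreducible_rep_def
proof (intro conjI allI impI exists_nonzero_L2)
  fix S :: "quat L2 set"
  assume S: "csubspace S \<and> closed S \<and> (\<forall>g\<in>carrier Gaff. U_C g ` S \<subseteq> S)"
  show "S = {0} \<or> S = UNIV"
  proof (rule ccontr)
    assume nontrivial: "\<not> (S = {0} \<or> S = UNIV)"
    then have S': "csubspace S" "closed S" "S \<noteq> UNIV"
      using S by simp_all
    obtain f where f: "f \<noteq> 0" "\<And>s. s \<in> S \<Longrightarrow> \<langle>f | s\<rangle> = 0"
      using exists_orthogonal_vector[OF S'] by blast
    have "0 \<in> S" "S \<noteq> {0}"
      using S'(1) nontrivial by (simp_all add: csubspace_def)
    then obtain \<eta> where \<eta>: "\<eta> \<in> S" "\<eta> \<noteq> 0"
      by blast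
    have zero: "(\<integral>\<^sup>+k. ennreal ((cmod (coeff_density f \<eta> a k))\<^sup>2) \<partial>lborel) = 0" if a: "a \<noteq> 0" for a
    proof -
      have "fourier_integral (coeff_density f \<eta> a) b = 0" for b
      proof -
        have "U_C (b, a) \<eta> \<in> S"
          using S \<eta>(1) a by (auto simp: image_subset_iff)
        then show ?thesis
          using f(2) cinner_U_C_eq_fourier_integral[OF a, of f b \<eta>] a by simp
      qed
      then have "AE k in lborel. coeff_density f \<eta> a k = 0"
        by (intro fourier_integral_zero_imp_AE_zero integrable_coeff_density a)
      then show ?thesis
        by (subst nn_integral_0_iff_AE) auto
    qed
    have "ennreal (1 / norm a ^ 4) * (\<integral>\<^sup>+k. ennreal ((cmod (coeff_density f \<eta> a k))\<^sup>2) \<partial>lborel) = 0" for a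
      using zero[of a] by (cases "a = 0") auto
    then have "ennreal ((norm f)\<^sup>2) * C_weight \<eta> = 0"
      unfolding nn_integral_coeff_density[symmetric] by (simp only: nn_integral_const mult_zero_left)
    then have "C_weight \<eta> = 0"
      using f(1) by simp
    then have "AE p in lborel. ennreal ((cmod (hat \<eta> p))\<^sup>2) * ennreal (1 / norm p ^ 4) = 0"
      unfolding C_weight_def by (subst (asm) nn_integral_0_iff_AE) auto
    then have "AE p in lborel. ennreal ((cmod (hat \<eta> p))\<^sup>2) = 0"
      using AE_lborel_singleton[of 0] by eventually_elim (auto simp: ennreal_eq_0_iff divide_le_0_iff)
    then have "(\<integral>\<^sup>+p. ennreal ((cmod (hat \<eta> p))\<^sup>2) \<partial>lborel) = 0"
      by (subst nn_integral_0_iff_AE) auto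
    then show False
      using \<eta>(2) by (simp add: nn_integral_hat)
  qed
qed

section \<open>Square-integrability\<close>

definition C_symbol :: "quat L2 \<Rightarrow> quat \<Rightarrow> complex" where
  "C_symbol \<eta> k = of_real ((2 * pi / norm k)\<^sup>2) * rep_L2 (fourier \<eta>) k"

lemma nn_integral_C_symbol:
  "(\<integral>\<^sup>+k. ennreal ((cmod (C_symbol \<eta> k))\<^sup>2) \<partial>lborel) = ennreal ((2 * pi) ^ 4) * C_weight \<eta>"
proof -
  have "((2 * pi / norm k)\<^sup>2)\<^sup>2 = (2 * pi) ^ 4 * (1 / norm k ^ 4)" for k :: quat
    by (simp add: power_divide flip: power_mult)
  then have "(cmod (C_symbol \<eta> k))\<^sup>2 = (2 * pi) ^ 4 * ((cmod (rep_L2 (fourier \<eta>) k))\<^sup>2 / norm k ^ 4)" for k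
    unfolding C_symbol_def norm_mult norm_of_real power_mult_distrib[of "\<bar>_\<bar>"] power2_abs by simp
  then have "ennreal ((cmod (C_symbol \<eta> k))\<^sup>2)
      = ennreal ((2 * pi) ^ 4) * ennreal ((cmod (rep_L2 (fourier \<eta>) k))\<^sup>2 / norm k ^ 4)" for k
    by (simp only: ennreal_mult'[of "(2 * pi) ^ 4"] zero_le_power pi_ge_zero mult_nonneg_nonneg zero_le_numeral)
  then show ?thesis
    unfolding C_weight_eq by (simp add: nn_integral_cmult)
qed

lemma square_integrable_C_symbol:
  assumes "\<eta> \<in> C_dom"
  shows "square_integrable (C_symbol \<eta>)"
proof -
  have "C_symbol \<eta> \<in> borel_measurable borel"
    unfolding C_symbol_def[abs_def] by measurable
  then show ?thesis
    using assms unfolding C_dom_iff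
    by (simp add: square_integrable_iff nn_integral_C_symbol ennreal_mult_less_top)
qed

lemma fourier_inj: "fourier f = fourier g \<Longrightarrow> f = g"
  using dist_unitary_op[OF unitary_op_fourier, of f g] by simp

text \<open>Surjectivity of \<open>fourier\<close> provides a vector that fits the description of
  \<open>C_op\<close>, and injectivity makes it unique; the domain condition is what turns the
  symbol into an element of L^2.\<close>

lemma fourier_C_op:
  assumes "\<eta> \<in> C_dom"
  shows "fourier (C_op \<eta>) = abs_L2 (C_symbol \<eta>)"
proof -
  note sq = square_integrable_C_symbol[OF assms]
  have iff: "(AE k in lborel. rep_L2 (fourier h) k = of_real ((2 * pi / norm k)\<^sup>2) * rep_L2 (fourier \<eta>) k)
      \<longleftrightarrow> fourier h = abs_L2 (C_symbol \<eta>)" for h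
  proof
    assume "AE k in lborel. rep_L2 (fourier h) k = of_real ((2 * pi / norm k)\<^sup>2) * rep_L2 (fourier \<eta>) k"
    then have "AE k in lborel. rep_L2 (fourier h) k = rep_L2 (abs_L2 (C_symbol \<eta>)) k"
      using rep_abs_L2[OF sq] by eventually_elim (simp add: C_symbol_def)
    then show "fourier h = abs_L2 (C_symbol \<eta>)"
      by (rule L2_eqI)
  next
    assume "fourier h = abs_L2 (C_symbol \<eta>)"
    then show "AE k in lborel. rep_L2 (fourier h) k = of_real ((2 * pi / norm k)\<^sup>2) * rep_L2 (fourier \<eta>) k"
      using rep_abs_L2[OF sq] by (simp add: C_symbol_def)
  qed
  obtain h where h: "fourier h = abs_L2 (C_symbol \<eta>)"
    using unitary_op_fourier surjD[of fourier "abs_L2 (C_symbol \<eta>)"] by (auto simp: unitary_op_def)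
  have "C_op \<eta> = h"
    unfolding C_op_def iff using h fourier_inj by (intro the_equality) auto
  then show ?thesis
    by (simp add: h)
qed

lemma ennreal_norm_C_op:
  assumes "\<eta> \<in> C_dom"
  shows "ennreal ((norm (C_op \<eta>))\<^sup>2) = ennreal ((2 * pi) ^ 4) * C_weight \<eta>"
  unfolding nn_integral_C_symbol[symmetric] ennreal_norm_abs_L2[OF square_integrable_C_symbol[OF assms]]
  by (simp add: fourier_C_op[OF assms, symmetric] norm_unitary_op[OF unitary_op_fourier])

section \<open>Linearity of the Duflo-Moore operator on its domain\<close>

lemma hat_add: "AE k in lborel. hat (f + g) k = hat f k + hat g k"
  unfolding hat_def unitary_op_add[OF unitary_op_fourier] by (rule rep_L2_add)

lemma hat_cscale: "AE k in lborel. hat (c *\<^sub>C f) k = c * hat f k"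
  unfolding hat_def unitary_op_cscale[OF unitary_op_fourier] by (rule rep_L2_cscale)

text \<open>Polarization in \<open>\<eta>\<close> takes place inside \<open>C_dom\<close>, which
  therefore has to be a complex subspace.\<close>

lemma C_dom_add:
  assumes "f \<in> C_dom" "g \<in> C_dom"
  shows "f + g \<in> C_dom"
proof -
  have "C_weight (f + g) \<le> (\<integral>\<^sup>+p. 2 * (ennreal ((cmod (hat f p))\<^sup>2) * ennreal (1 / norm p ^ 4)
      + ennreal ((cmod (hat g p))\<^sup>2) * ennreal (1 / norm p ^ 4)) \<partial>lborel)"
    unfolding C_weight_def
  proof (rule nn_integral_mono_AE, use hat_add[of f g] in eventually_elim)
    case (elim p)
    have "(cmod (hat f p + hat g p))\<^sup>2 \<le> (cmod (hat f p) + cmod (hat g p))\<^sup>2"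
      by (intro power_mono norm_triangle_ineq norm_ge_zero)
    also have "\<dots> \<le> 2 * ((cmod (hat f p))\<^sup>2 + (cmod (hat g p))\<^sup>2)"
      using sum_squares_bound[of "cmod (hat f p)" "cmod (hat g p)"] by (simp add: power2_sum)
    finally have "ennreal ((cmod (hat (f + g) p))\<^sup>2) \<le> ennreal (2 * ((cmod (hat f p))\<^sup>2 + (cmod (hat g p))\<^sup>2))"
      unfolding elim by (rule ennreal_leI)
    also have "\<dots> = 2 * (ennreal ((cmod (hat f p))\<^sup>2) + ennreal ((cmod (hat g p))\<^sup>2))"
      by (simp add: ennreal_mult')
    finally have "ennreal ((cmod (hat (f + g) p))\<^sup>2) * ennreal (1 / norm p ^ 4)
        \<le> 2 * (ennreal ((cmod (hat f p))\<^sup>2) + ennreal ((cmod (hat g p))\<^sup>2)) * ennreal (1 / norm p ^ 4)"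
      by (rule mult_right_mono) simp
    then show ?case
      by (simp only: distrib_right distrib_left mult.assoc)
  qed
  also have "\<dots> = 2 * (C_weight f + C_weight g)"
    unfolding C_weight_def by (subst nn_integral_cmult, measurable, subst nn_integral_add) auto
  also have "\<dots> < \<infinity>"
    using assms by (simp add: C_dom_iff ennreal_mult_less_top)
  finally show ?thesis
    by (simp add: C_dom_iff)
qed

lemma C_dom_cscale:
  assumes "f \<in> C_dom"
  shows "c *\<^sub>C f \<in> C_dom"
proof -
  have "C_weight (c *\<^sub>C f) = (\<integral>\<^sup>+p. ennreal ((cmod c)\<^sup>2) * (ennreal ((cmod (hat f p))\<^sup>2) * ennreal (1 / norm p ^ 4)) \<partial>lborel)"
    unfolding C_weight_def
    by (rule nn_integral_cong_AE, use hat_cscale[of c f] in eventually_elim)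
      (simp add: norm_mult power_mult_distrib ennreal_mult mult.assoc)
  also have "\<dots> = ennreal ((cmod c)\<^sup>2) * C_weight f"
    unfolding C_weight_def by (rule nn_integral_cmult) measurable
  finally show ?thesis
    using assms by (simp add: C_dom_iff ennreal_mult_less_top)
qed

text \<open>The two sides are compared in the Fourier domain, where the operator is a multiplication
  and the symbols agree almost everywhere.\<close>

lemma C_op_add:
  assumes "f \<in> C_dom" "g \<in> C_dom"
  shows "C_op (f + g) = C_op f + C_op g"
proof (rule fourier_inj)
  have "fourier (C_op f + C_op g) = abs_L2 (\<lambda>k. C_symbol f k + C_symbol g k)"
    using assms by (simp add: unitary_op_add[OF unitary_op_fourier] fourier_C_op abs_L2_add square_integrable_C_symbol)
  also have "\<dots> = abs_L2 (C_symbol (f + g))"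
  proof (rule abs_L2_cong)
    show "square_integrable (\<lambda>k. C_symbol f k + C_symbol g k)"
      using assms by (intro square_integrable_add square_integrable_C_symbol)
    show "C_symbol (f + g) \<in> borel_measurable borel"
      using square_integrable_C_symbol[OF C_dom_add[OF assms]] by (simp add: square_integrable_def)
    show "AE k in lborel. C_symbol f k + C_symbol g k = C_symbol (f + g) k"
      using hat_add[of f g, unfolded hat_def] unfolding C_symbol_def by eventually_elim (simp add: distrib_left)
  qed
  finally show "fourier (C_op (f + g)) = fourier (C_op f + C_op g)"
    using assms by (simp add: fourier_C_op C_dom_add)
qed

lemma C_op_cscale:
  assumes "f \<in> C_dom"
  shows "C_op (c *\<^sub>C f) = c *\<^sub>C C_op f"
proof (rule fourier_inj)
  have "fourier (c *\<^sub>C C_op f) = abs_L2 (\<lambda>k. c * C_symbol f k)"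
    using assms by (simp add: unitary_op_cscale[OF unitary_op_fourier] fourier_C_op abs_L2_cscale square_integrable_C_symbol)
  also have "\<dots> = abs_L2 (C_symbol (c *\<^sub>C f))"
  proof (rule abs_L2_cong)
    show "square_integrable (\<lambda>k. c * C_symbol f k)"
      using assms by (intro square_integrable_cmult square_integrable_C_symbol)
    show "C_symbol (c *\<^sub>C f) \<in> borel_measurable borel"
      using square_integrable_C_symbol[OF C_dom_cscale[OF assms]] by (simp add: square_integrable_def)
    show "AE k in lborel. c * C_symbol f k = C_symbol (c *\<^sub>C f) k"
      using hat_cscale[of c f, unfolded hat_def] unfolding C_symbol_def by eventually_elim simp
  qed
  finally show "fourier (C_op (c *\<^sub>C f)) = fourier (c *\<^sub>C C_op f)"
    using assms by (simp add: fourier_C_op C_dom_cscale)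
qed

section \<open>Polarization and the orthogonality relation\<close>

definition sesquilinear_on :: "'a::euclidean_space L2 set \<Rightarrow> ('a L2 \<Rightarrow> 'a L2 \<Rightarrow> complex) \<Rightarrow> bool" where
  "sesquilinear_on D B \<longleftrightarrow> (\<forall>f\<in>D. \<forall>g\<in>D. \<forall>h\<in>D.
     B (f + g) h = B f h + B g h \<and> B f (g + h) = B f g + B f h \<and>
     (\<forall>c. B (c *\<^sub>C f) g = cnj c * B f g \<and> B f (c *\<^sub>C g) = c * B f g))"

text \<open>The difference \<open>R\<close> vanishes on the diagonal. Expanding it at
  \<open>f + g\<close> gives \<open>R f g + R g f = 0\<close>, and \<open>\<i> *\<^sub>C g\<close>
  in place of \<open>g\<close> gives \<open>R f g - R g f = 0\<close>.\<close>

lemma sesquilinear_on_eqI: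
  assumes D: "\<And>f g. f \<in> D \<Longrightarrow> g \<in> D \<Longrightarrow> f + g \<in> D" "\<And>c f. f \<in> D \<Longrightarrow> c *\<^sub>C f \<in> D"
    and A: "sesquilinear_on D A" and B: "sesquilinear_on D B"
    and diag: "\<And>f. f \<in> D \<Longrightarrow> A f f = B f f"
    and fg: "f \<in> D" "g \<in> D"
  shows "A f g = B f g"
proof -
  define R where "R f g = A f g - B f g" for f g
  have R: "R (f + g) h = R f h + R g h" "R f (g + h) = R f g + R f h"
    "R (c *\<^sub>C f) g = cnj c * R f g" "R f (c *\<^sub>C g) = c * R f g"
    if "f \<in> D" "g \<in> D" "h \<in> D" for f g h c
    using A B that unfolding sesquilinear_on_def R_def by (simp_all add: algebra_simps)
  have diag: "R f f = 0" if "f \<in> D" for f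
    using diag[OF that] by (simp add: R_def)
  have 1: "R f g + R g f = 0" if fg: "f \<in> D" "g \<in> D" for f g
    using diag[OF D(1)[OF fg]] diag[OF fg(1)] diag[OF fg(2)] fg D(1)[OF fg] by (simp add: R add.commute)
  have "\<i> * R f g - \<i> * R g f = 0"
    using 1[OF fg(1) D(2)[OF fg(2), of \<i>]] fg R(3)[OF fg(2) fg(1) fg(1), of \<i>] R(4)[OF fg fg(1), of \<i>]
    by simp
  then have "R f g = R g f"
    by simp
  then show ?thesis
    using 1[OF fg] by (simp add: R_def)
qed

lemma integrable_coefficient_square:
  assumes "\<eta> \<in> C_dom"
  shows "integrable haar_Gaff (\<lambda>g. (cmod (coefficient f \<eta> g))\<^sup>2)"
    and "(\<integral>g. (cmod (coefficient f \<eta> g))\<^sup>2 \<partial>haar_Gaff) = (norm f)\<^sup>2 * (norm (C_op \<eta>))\<^sup>2"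
proof -
  have [measurable]: "coefficient f \<eta> \<in> borel_measurable haar_Gaff"
    by (rule borel_measurable_haar_Gaff) measurable
  have nn: "(\<integral>\<^sup>+g. ennreal ((cmod (coefficient f \<eta> g))\<^sup>2) \<partial>haar_Gaff) = ennreal ((norm f)\<^sup>2 * (norm (C_op \<eta>))\<^sup>2)"
    unfolding nn_integral_coefficient[OF assms] ennreal_norm_C_op[OF assms, symmetric]
    by (simp add: ennreal_mult)
  then show "integrable haar_Gaff (\<lambda>g. (cmod (coefficient f \<eta> g))\<^sup>2)"
    by (intro integrableI_bounded) auto
  show "(\<integral>g. (cmod (coefficient f \<eta> g))\<^sup>2 \<partial>haar_Gaff) = (norm f)\<^sup>2 * (norm (C_op \<eta>))\<^sup>2"
    by (subst integral_eq_nn_integral) (auto simp: nn)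
qed

text \<open>The integrand with the adjoint moved to the other side of its inner product, which makes
  the dependence on each of the four vectors visibly linear or conjugate-linear.\<close>

definition coefficient_form :: "quat L2 \<Rightarrow> quat L2 \<Rightarrow> quat L2 \<Rightarrow> quat L2 \<Rightarrow> quat \<times> quat \<Rightarrow> complex" where
  "coefficient_form f1 \<eta>1 \<eta>2 f2 g = \<langle>f1 | U_C g \<eta>1\<rangle> * \<langle>U_C g \<eta>2 | f2\<rangle>"

text \<open>On the group this is a product of two square-integrable functions; the argument runs
  through \<open>coefficient\<close>, whose measurability is known.\<close>

lemma integrable_coefficient_form:
  assumes "\<eta>1 \<in> C_dom" "\<eta>2 \<in> C_dom"
  shows "integrable haar_Gaff (coefficient_form f1 \<eta>1 \<eta>2 f2)"
proof -
  note [measurable] = cnj_measurable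
  have [measurable]: "coefficient f \<eta> \<in> borel_measurable haar_Gaff" for f \<eta>
    by (rule borel_measurable_haar_Gaff) measurable
  have "integrable haar_Gaff (\<lambda>g. coefficient f1 \<eta>1 g * cnj (coefficient f2 \<eta>2 g))"
  proof (rule Bochner_Integration.integrable_bound)
    show "integrable haar_Gaff (\<lambda>g. (cmod (coefficient f1 \<eta>1 g))\<^sup>2 + (cmod (coefficient f2 \<eta>2 g))\<^sup>2)"
      using assms by (intro Bochner_Integration.integrable_add integrable_coefficient_square)
    have "cmod u * cmod v \<le> (cmod u)\<^sup>2 + (cmod v)\<^sup>2" for u v
    proof -
      have "0 \<le> cmod u * cmod v"
        by simp
      then show ?thesis
        using sum_squares_bound[of "cmod u" "cmod v"] by linarith
    qed
    then show "AE g in haar_Gaff. norm (coefficient f1 \<eta>1 g * cnj (coefficient f2 \<eta>2 g))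
        \<le> norm ((cmod (coefficient f1 \<eta>1 g))\<^sup>2 + (cmod (coefficient f2 \<eta>2 g))\<^sup>2)"
      by (simp add: norm_mult)
  qed measurable
  also have "?this \<longleftrightarrow> ?thesis"
    by (intro Bochner_Integration.integrable_cong refl)
      (simp add: space_haar_Gaff coefficient_eq coefficient_form_def cinner_commute[of _ f2])
  finally show ?thesis .
qed

lemma coefficient_form_linear:
  assumes "g \<in> carrier Gaff"
  shows "coefficient_form (f + h) \<eta>1 \<eta>2 f2 g = coefficient_form f \<eta>1 \<eta>2 f2 g + coefficient_form h \<eta>1 \<eta>2 f2 g"
    "coefficient_form f1 (f + h) \<eta>2 f2 g = coefficient_form f1 f \<eta>2 f2 g + coefficient_form f1 h \<eta>2 f2 g"
    "coefficient_form f1 \<eta>1 (f + h) f2 g = coefficient_form f1 \<eta>1 f f2 g + coefficient_form f1 \<eta>1 h f2 g"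
    "coefficient_form f1 \<eta>1 \<eta>2 (f + h) g = coefficient_form f1 \<eta>1 \<eta>2 f g + coefficient_form f1 \<eta>1 \<eta>2 h g"
    "coefficient_form (c *\<^sub>C f1) \<eta>1 \<eta>2 f2 g = cnj c * coefficient_form f1 \<eta>1 \<eta>2 f2 g"
    "coefficient_form f1 (c *\<^sub>C \<eta>1) \<eta>2 f2 g = c * coefficient_form f1 \<eta>1 \<eta>2 f2 g"
    "coefficient_form f1 \<eta>1 (c *\<^sub>C \<eta>2) f2 g = cnj c * coefficient_form f1 \<eta>1 \<eta>2 f2 g"
    "coefficient_form f1 \<eta>1 \<eta>2 (c *\<^sub>C f2) g = c * coefficient_form f1 \<eta>1 \<eta>2 f2 g"
  using unitary_op_U_C[OF assms]
  by (simp_all add: coefficient_form_def unitary_op_add unitary_op_cscale cinner_add_left cinner_add_right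
      cinner_cscale_left cinner_cscale_right distrib_left distrib_right)

lemma integral_coefficient_form:
  assumes \<eta>1: "\<eta>1 \<in> C_dom" and \<eta>2: "\<eta>2 \<in> C_dom"
  shows "(\<integral>g. coefficient_form f1 \<eta>1 \<eta>2 f2 g \<partial>haar_Gaff) = \<langle>C_op \<eta>2 | C_op \<eta>1\<rangle> * \<langle>f1 | f2\<rangle>"
proof -
  define B where "B f1 \<eta>1 \<eta>2 f2 = (\<integral>g. coefficient_form f1 \<eta>1 \<eta>2 f2 g \<partial>haar_Gaff)" for f1 \<eta>1 \<eta>2 f2
  note int = integrable_coefficient_form
  have add: "(\<integral>g. u g \<partial>haar_Gaff) = (\<integral>g. v g \<partial>haar_Gaff) + (\<integral>g. w g \<partial>haar_Gaff)"
    if "\<And>g. g \<in> carrier Gaff \<Longrightarrow> u g = v g + w g" "integrable haar_Gaff v" "integrable haar_Gaff w"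
    for u v w :: "quat \<times> quat \<Rightarrow> complex"
  proof -
    have "(\<integral>g. u g \<partial>haar_Gaff) = (\<integral>g. v g + w g \<partial>haar_Gaff)"
      by (rule Bochner_Integration.integral_cong[OF refl]) (simp add: that(1) space_haar_Gaff)
    then show ?thesis
      by (simp add: that(2,3))
  qed
  have cmult: "(\<integral>g. u g \<partial>haar_Gaff) = c * (\<integral>g. v g \<partial>haar_Gaff)"
    if "\<And>g. g \<in> carrier Gaff \<Longrightarrow> u g = c * v g" for c and u v :: "quat \<times> quat \<Rightarrow> complex"
  proof -
    have "(\<integral>g. u g \<partial>haar_Gaff) = (\<integral>g. c * v g \<partial>haar_Gaff)"
      by (rule Bochner_Integration.integral_cong[OF refl]) (simp add: that space_haar_Gaff)
    then show ?thesis
      by simp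
  qed
  have diag: "B f \<eta> \<eta> f = \<langle>C_op \<eta> | C_op \<eta>\<rangle> * \<langle>f | f\<rangle>" if "\<eta> \<in> C_dom" for f \<eta>
  proof -
    have "B f \<eta> \<eta> f = (\<integral>g. of_real ((cmod (coefficient f \<eta> g))\<^sup>2) \<partial>haar_Gaff)"
      unfolding B_def
    proof (rule Bochner_Integration.integral_cong[OF refl])
      fix g
      assume "g \<in> space haar_Gaff"
      then show "coefficient_form f \<eta> \<eta> f g = of_real ((cmod (coefficient f \<eta> g))\<^sup>2)"
        by (simp only: space_haar_Gaff coefficient_eq coefficient_form_def complex_norm_square cinner_commute[of _ f])
    qed
    then show ?thesis
      using integrable_coefficient_square(2)[OF that, of f]
      by (simp only: integral_complex_of_real) (simp add: cinner_self)
  qed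
  \<comment> \<open>The vector \<open>\<eta>2\<close> takes the conjugate-linear slot, since it
    stands on the left of its inner product; hence the exchanged order in
    \<open>\<langle>C_op \<eta>2 | C_op \<eta>1\<rangle>\<close>.\<close>
  have mid: "B f \<eta>1 \<eta>2 f = \<langle>C_op \<eta>2 | C_op \<eta>1\<rangle> * \<langle>f | f\<rangle>" for f
  proof (rule sesquilinear_on_eqI[of C_dom "\<lambda>\<eta>2 \<eta>1. B f \<eta>1 \<eta>2 f" "\<lambda>\<eta>2 \<eta>1. \<langle>C_op \<eta>2 | C_op \<eta>1\<rangle> * \<langle>f | f\<rangle>" \<eta>2 \<eta>1])
    show "sesquilinear_on C_dom (\<lambda>\<eta>2 \<eta>1. B f \<eta>1 \<eta>2 f)"
      unfolding sesquilinear_on_def B_def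
      by (intro ballI conjI allI add cmult int) (simp_all add: coefficient_form_linear C_dom_add C_dom_cscale)
    show "sesquilinear_on C_dom (\<lambda>\<eta>2 \<eta>1. \<langle>C_op \<eta>2 | C_op \<eta>1\<rangle> * \<langle>f | f\<rangle>)"
      unfolding sesquilinear_on_def
      by (simp add: C_op_add C_op_cscale cinner_add_left cinner_add_right cinner_cscale_left
          cinner_cscale_right distrib_right)
  qed (use \<eta>1 \<eta>2 in \<open>auto simp: C_dom_add C_dom_cscale diag\<close>)
  have "B f1 \<eta>1 \<eta>2 f2 = \<langle>C_op \<eta>2 | C_op \<eta>1\<rangle> * \<langle>f1 | f2\<rangle>"
  proof (rule sesquilinear_on_eqI[of UNIV "\<lambda>f1 f2. B f1 \<eta>1 \<eta>2 f2" "\<lambda>f1 f2. \<langle>C_op \<eta>2 | C_op \<eta>1\<rangle> * \<langle>f1 | f2\<rangle>"])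
    show "sesquilinear_on UNIV (\<lambda>f1 f2. B f1 \<eta>1 \<eta>2 f2)"
      unfolding sesquilinear_on_def B_def
      by (intro ballI conjI allI add cmult int \<eta>1 \<eta>2) (simp_all add: coefficient_form_linear)
    show "sesquilinear_on UNIV (\<lambda>f1 f2. \<langle>C_op \<eta>2 | C_op \<eta>1\<rangle> * \<langle>f1 | f2\<rangle>)"
      unfolding sesquilinear_on_def
      by (simp add: cinner_add_left cinner_add_right cinner_cscale_left cinner_cscale_right distrib_left)
  qed (auto simp: mid)
  then show ?thesis
    by (simp add: B_def)
qed

theorem mainTheorem1:
  "unitary_rep Gaff U_C \<and> irreducible_rep Gaff U_C \<and>
   (\<forall>\<eta>\<^sub>1\<in>C_dom. \<forall>\<eta>\<^sub>2\<in>C_dom. \<forall>f\<^sub>1 f\<^sub>2.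
      integrable haar_Gaff (\<lambda>g. \<langle>f\<^sub>1 | U_C g \<eta>\<^sub>1\<rangle> * \<langle>\<eta>\<^sub>2 | cadjoint (U_C g) f\<^sub>2\<rangle>) \<and>
      (\<integral>g. \<langle>f\<^sub>1 | U_C g \<eta>\<^sub>1\<rangle> * \<langle>\<eta>\<^sub>2 | cadjoint (U_C g) f\<^sub>2\<rangle> \<partial>haar_Gaff)
        = \<langle>C_op \<eta>\<^sub>2 | C_op \<eta>\<^sub>1\<rangle> * \<langle>f\<^sub>1 | f\<^sub>2\<rangle>)"
proof (intro conjI ballI allI unitary_rep_U_C irreducible_rep_U_C)
  fix \<eta>\<^sub>1 \<eta>\<^sub>2 f\<^sub>1 f\<^sub>2
  assume \<eta>: "\<eta>\<^sub>1 \<in> C_dom" "\<eta>\<^sub>2 \<in> C_dom"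
  \<comment> \<open>Unitarity of \<open>U_C g\<close>, and with it the value of
    \<open>cadjoint\<close>, is available on the carrier, which is the whole space of
    \<open>haar_Gaff\<close>.\<close>
  have eq: "\<langle>f\<^sub>1 | U_C g \<eta>\<^sub>1\<rangle> * \<langle>\<eta>\<^sub>2 | cadjoint (U_C g) f\<^sub>2\<rangle> = coefficient_form f\<^sub>1 \<eta>\<^sub>1 \<eta>\<^sub>2 f\<^sub>2 g"
    if "g \<in> space haar_Gaff" for g
    using that by (simp add: space_haar_Gaff coefficient_form_def cadjoint_unitary unitary_op_U_C)
  show "integrable haar_Gaff (\<lambda>g. \<langle>f\<^sub>1 | U_C g \<eta>\<^sub>1\<rangle> * \<langle>\<eta>\<^sub>2 | cadjoint (U_C g) f\<^sub>2\<rangle>)"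
    using integrable_coefficient_form[OF \<eta>]
    by (simp cong: Bochner_Integration.integrable_cong add: eq)
  show "(\<integral>g. \<langle>f\<^sub>1 | U_C g \<eta>\<^sub>1\<rangle> * \<langle>\<eta>\<^sub>2 | cadjoint (U_C g) f\<^sub>2\<rangle> \<partial>haar_Gaff)
      = \<langle>C_op \<eta>\<^sub>2 | C_op \<eta>\<^sub>1\<rangle> * \<langle>f\<^sub>1 | f\<^sub>2\<rangle>"
    using integral_coefficient_form[OF \<eta>]
    by (simp cong: Bochner_Integration.integral_cong add: eq)
qed

end
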